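(* Let $G$ be a (real) Lie group with Lie algebra $\mathfrak g$ and let $\varrho:G\to\mathrm{GL}(\mathfrak g^* )$ be a representation. The canonical symplectic form $\Omega$ on the cotangent bundle $T^*G$ is left-invariant for the Lie group structure on $T^*G$ defined by $$\alpha_g\cdot\beta_h=\bigl(\varrho(h^{-1})(\alpha)+\beta\bigr)_{gh}\qquad(g,h\in G,\ \alpha,\beta\in\mathfrak g^* )$$ if and only if the left-invariant flat connection $\nabla^\rho$ on $G$ is torsion-free.
   Context: Elements of $\mathfrak g$ are viewed as left-invariant vector fields on $G$ and elements of $\mathfrak g^*$ as left-invariant one-forms on $G$; for $\alpha\in\mathfrak g^*$ and $g\in G$, $\alpha_g\in T_g^*G$ is the value of $\alpha$ at $g$. The map $G\times\mathfrak g^*\to T^*G$, $(g,\alpha)\mapsto\alpha_g$, is a diffeomorphism, and the product in the claim is the one transported from the semi-direct product group law $(g,\alpha)\cdot(h,\beta)=(gh,\varrho(h^{-1})(\alpha)+\beta)$ on $G\times\mathfrak g^*$. The canonical one-form $\theta$ on $T^*G$ is given by $\theta_{\alpha_g}(X^* )=\alpha_g(\pi_*X^* )$ for $X^*\in T_{\alpha_g}(T^*G)$, where $\pi:T^*G\to G$ is the bundle projection, and $\Omega=d\theta$. Let $\rho:\mathfrak g\to\mathrm{End}(\mathfrak g^* )$ be the derivative of $\varrho$ at the identity and $\tau:\mathfrak g\to\mathrm{End}(\mathfrak g)$ the dual representation, i.e. $\alpha(\tau(X)Y)=(\rho(-X)\alpha)(Y)$ for $X,Y\in\mathfrak g$,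 $\alpha\in\mathfrak g^*$. The left-invariant connection $\nabla^\rho$ on $G$ is defined by $\nabla^\rho_XY=\tau(X)(Y)$ for left-invariant vector fields $X,Y\in\mathfrak g$; it is flat since $\tau$ is a representation. It is torsion-free if $\nabla^\rho_XY-\nabla^\rho_YX=[X,Y]$ for all $X,Y\in\mathfrak g$. *)

theory Defs
  imports "HOL-Analysis.Analysis" "HOL-Algebra.Group"
begin

section \<open>Smooth maps between normed spaces\<close>

text \<open>
  Only used for open \<open>S\<close> in finite-dimensional spaces, where asking that all iterated directional
  derivatives exist and are continuous is the usual notion of a smooth map.
\<close>

primrec Ck_on :: "nat \<Rightarrow> 'a::real_normed_vector set \<Rightarrow> ('a \<Rightarrow> 'b::real_normed_vector) \<Rightarrow> bool" where
  "Ck_on 0 S f \<longleftrightarrow> continuous_on S f"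
| "Ck_on (Suc n) S f \<longleftrightarrow>
     (\<forall>x\<in>S. f differentiable (at x)) \<and> (\<forall>v. Ck_on n S (\<lambda>x. frechet_derivative f (at x) v))"

definition smooth_on :: "'a::real_normed_vector set \<Rightarrow> ('a \<Rightarrow> 'b::real_normed_vector) \<Rightarrow> bool" where
  "smooth_on S f \<longleftrightarrow> (\<forall>n. Ck_on n S f)"


section \<open>Smooth manifolds\<close>

text \<open>
  A chart is a pair (domain, coordinate map); the values of the coordinate map outside the domain
  are irrelevant. A manifold is given by an atlas, not necessarily maximal. Its underlying set is
  the union of the chart domains and its topology is the one generated by the charts.
  The model space is a normed space, required to be finite-dimensional in \<open>smooth_manifold\<close>
  (rather than of class \<open>euclidean_space\<close>, which would exclude dimension 0).
\<close>

type_synonym ('a, 'e) chart = "'a set \<times> ('a \<Rightarrow> 'e)"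

definition chart_inv :: "('a, 'e) chart \<Rightarrow> 'e \<Rightarrow> 'a" where
  "chart_inv c = inv_into (fst c) (snd c)"

definition points :: "('a, 'e) chart set \<Rightarrow> 'a set" where
  "points A = (\<Union>c\<in>A. fst c)"

definition charts_at :: "('a, 'e) chart set \<Rightarrow> 'a \<Rightarrow> ('a, 'e) chart set" where
  "charts_at A p = {c \<in> A. p \<in> fst c}"

definition chart_at :: "('a, 'e) chart set \<Rightarrow> 'a \<Rightarrow> ('a, 'e) chart" where
  "chart_at A p = (SOME c. c \<in> charts_at A p)"

definition manifold_topology :: "('a, 'e::real_normed_vector) chart set \<Rightarrow> 'a topology" where
  "manifold_topology A =
     topology_generated_by {{p \<in> fst c. snd c p \<in> V} | c V. c \<in> A \<and> open V}"

definition smooth_atlas :: "('a, 'e::real_normed_vector) chart set \<Rightarrow> bool" where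
  "smooth_atlas A \<longleftrightarrow>
     (\<forall>c\<in>A. inj_on (snd c) (fst c) \<and>
       (\<forall>d\<in>A. open (snd c ` (fst c \<inter> fst d)) \<and>
              smooth_on (snd c ` (fst c \<inter> fst d)) (snd d \<circ> chart_inv c)))"

definition smooth_manifold :: "('a, 'e::real_normed_vector) chart set \<Rightarrow> bool" where
  "smooth_manifold A \<longleftrightarrow>
     (\<exists>B::'e set. finite B \<and> span B = UNIV) \<and>
     smooth_atlas A \<and>
     Hausdorff_space (manifold_topology A) \<and> second_countable (manifold_topology A)"

definition smooth_map ::
  "('a, 'e::real_normed_vector) chart set \<Rightarrow> ('b, 'f::real_normed_vector) chart set
    \<Rightarrow> ('a \<Rightarrow> 'b) \<Rightarrow> bool" where
  "smooth_map A B f \<longleftrightarrow>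
     f \<in> points A \<rightarrow> points B \<and>
     (\<forall>c\<in>A. \<forall>d\<in>B.
        open (snd c ` {p \<in> fst c. f p \<in> fst d}) \<and>
        smooth_on (snd c ` {p \<in> fst c. f p \<in> fst d}) (snd d \<circ> f \<circ> chart_inv c))"

definition smooth_function :: "('a, 'e::real_normed_vector) chart set \<Rightarrow> ('a \<Rightarrow> real) \<Rightarrow> bool" where
  "smooth_function A f \<longleftrightarrow> (\<forall>c\<in>A. smooth_on (snd c ` fst c) (f \<circ> chart_inv c))"

definition product_atlas ::
  "('a, 'e) chart set \<Rightarrow> ('b, 'f) chart set \<Rightarrow> ('a \<times> 'b, 'e \<times> 'f) chart set" where
  "product_atlas A B =
     (\<lambda>(c, d). (fst c \<times> fst d, \<lambda>(p, q). (snd c p, snd d q))) ` (A \<times> B)"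


section \<open>Tangent vectors, vector fields and one-forms\<close>

text \<open>
  A tangent vector at \<open>p\<close> is a family of coordinate vectors, one for each chart around \<open>p\<close>, related
  by the derivatives of the transition maps; it is extended by 0 to all other charts. The linear
  structure is pointwise. Covectors, vector fields and one-forms are likewise extended by 0 outside
  their domains, so that equality is equality of functions.
\<close>

type_synonym ('a, 'e) tangent = "('a, 'e) chart \<Rightarrow> 'e"

type_synonym ('a, 'e) covector = "('a, 'e) tangent \<Rightarrow> real"

type_synonym ('a, 'e) vfield = "'a \<Rightarrow> ('a, 'e) tangent"

type_synonym ('a, 'e) oneform = "'a \<Rightarrow> ('a, 'e) covector"

type_synonym ('a, 'e) twoform = "'a \<Rightarrow> ('a, 'e) tangent \<Rightarrow> ('a, 'e) tangent \<Rightarrow> real"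

definition tangent_space ::
  "('a, 'e::real_normed_vector) chart set \<Rightarrow> 'a \<Rightarrow> ('a, 'e) tangent set" where
  "tangent_space A p = {v.
     (\<forall>c. c \<notin> charts_at A p \<longrightarrow> v c = 0) \<and>
     (\<forall>c\<in>charts_at A p. \<forall>d\<in>charts_at A p.
        v d = frechet_derivative (snd d \<circ> chart_inv c) (at (snd c p)) (v c))}"

text \<open>The tangent vector at \<open>p\<close> whose component in the chart \<open>c\<close> is \<open>u\<close>:\<close>

definition coord_vector ::
  "('a, 'e::real_normed_vector) chart set \<Rightarrow> ('a, 'e) chart \<Rightarrow> 'a \<Rightarrow> 'e \<Rightarrow> ('a, 'e) tangent" where
  "coord_vector A c p u = (\<lambda>d.
     if d \<in> charts_at A p then frechet_derivative (snd d \<circ> chart_inv c) (at (snd c p)) u else 0)"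

text \<open>The differential of \<open>f\<close> at \<open>p\<close>; it does not depend on the chart chosen at \<open>p\<close>.\<close>

definition differential ::
  "('a, 'e::real_normed_vector) chart set \<Rightarrow> ('b, 'f::real_normed_vector) chart set
    \<Rightarrow> ('a \<Rightarrow> 'b) \<Rightarrow> 'a \<Rightarrow> ('a, 'e) tangent \<Rightarrow> ('b, 'f) tangent" where
  "differential A B f p v = (\<lambda>d.
     if d \<in> charts_at B (f p)
     then let c = chart_at A p
          in frechet_derivative (snd d \<circ> f \<circ> chart_inv c) (at (snd c p)) (v c)
     else 0)"

definition deriv_along ::
  "('a, 'e::real_normed_vector) chart set \<Rightarrow> ('a \<Rightarrow> real) \<Rightarrow> 'a \<Rightarrow> ('a, 'e) tangent \<Rightarrow> real" where
  "deriv_along A f p v =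
     (let c = chart_at A p in frechet_derivative (f \<circ> chart_inv c) (at (snd c p)) (v c))"

definition cotangent_space ::
  "('a, 'e::real_normed_vector) chart set \<Rightarrow> 'a \<Rightarrow> ('a, 'e) covector set" where
  "cotangent_space A p = {\<xi>.
     (\<forall>v. v \<notin> tangent_space A p \<longrightarrow> \<xi> v = 0) \<and>
     (\<forall>u\<in>tangent_space A p. \<forall>v\<in>tangent_space A p. \<xi> (\<lambda>c. u c + v c) = \<xi> u + \<xi> v) \<and>
     (\<forall>r. \<forall>v\<in>tangent_space A p. \<xi> (\<lambda>c. r *\<^sub>R v c) = r * \<xi> v)}"

definition vector_fields :: "('a, 'e::real_normed_vector) chart set \<Rightarrow> ('a, 'e) vfield set" where
  "vector_fields A = {X.
     (\<forall>p\<in>points A. X p \<in> tangent_space A p) \<and>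
     (\<forall>p. p \<notin> points A \<longrightarrow> X p = (\<lambda>c. 0)) \<and>
     (\<forall>c\<in>A. smooth_on (snd c ` fst c) (\<lambda>x. X (chart_inv c x) c))}"

definition one_forms :: "('a, 'e::real_normed_vector) chart set \<Rightarrow> ('a, 'e) oneform set" where
  "one_forms A = {\<alpha>.
     (\<forall>p\<in>points A. \<alpha> p \<in> cotangent_space A p) \<and>
     (\<forall>p. p \<notin> points A \<longrightarrow> \<alpha> p = (\<lambda>v. 0)) \<and>
     (\<forall>c\<in>A. \<forall>u. smooth_on (snd c ` fst c)
        (\<lambda>x. \<alpha> (chart_inv c x) (coord_vector A c (chart_inv c x) u)))}"

text \<open>In a chart, \<open>[X, Y] = DY(X) - DX(Y)\<close>, that is, \<open>[X, Y] f = X (Y f) - Y (X f)\<close>.\<close>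

definition lie_bracket ::
  "('a, 'e::real_normed_vector) chart set
    \<Rightarrow> ('a, 'e) vfield \<Rightarrow> ('a, 'e) vfield \<Rightarrow> ('a, 'e) vfield" where
  "lie_bracket A X Y = (\<lambda>p c.
     if c \<in> charts_at A p
     then frechet_derivative (\<lambda>x. Y (chart_inv c x) c) (at (snd c p)) (X p c)
        - frechet_derivative (\<lambda>x. X (chart_inv c x) c) (at (snd c p)) (Y p c)
     else 0)"

text \<open>
  In a chart, \<open>(d\<theta>)(u, v) = D(\<theta>(v))(u) - D(\<theta>(u))(v)\<close> for \<open>u\<close>, \<open>v\<close> extended to vector fields with
  constant coordinates; the value does not depend on the chart chosen at \<open>p\<close>.
\<close>

definition exterior_derivative ::
  "('a, 'e::real_normed_vector) chart set \<Rightarrow> ('a, 'e) oneform \<Rightarrow> ('a, 'e) twoform" where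
  "exterior_derivative A \<theta> p u v =
     (let c = chart_at A p;
          \<theta>c = (\<lambda>w x. \<theta> (chart_inv c x) (coord_vector A c (chart_inv c x) w))
      in frechet_derivative (\<theta>c (v c)) (at (snd c p)) (u c)
       - frechet_derivative (\<theta>c (u c)) (at (snd c p)) (v c))"


section \<open>The cotangent bundle and its canonical symplectic form\<close>

definition cotangent_bundle ::
  "('a, 'e::real_normed_vector) chart set \<Rightarrow> ('a \<times> ('a, 'e) covector) set" where
  "cotangent_bundle A = Sigma (points A) (cotangent_space A)"

text \<open>
  The bundle chart over \<open>c\<close> sends \<open>(p, \<xi>)\<close> to the coordinates of \<open>p\<close> and the coordinate expression
  of \<open>\<xi>\<close>, an element of the dual of the model space (linear maps on the finite-dimensional model
  space are bounded).
\<close>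

definition cotangent_chart ::
  "('a, 'e::real_normed_vector) chart set \<Rightarrow> ('a, 'e) chart
    \<Rightarrow> ('a \<times> ('a, 'e) covector, 'e \<times> ('e \<Rightarrow>\<^sub>L real)) chart" where
  "cotangent_chart A c =
     ({(p, \<xi>) \<in> cotangent_bundle A. p \<in> fst c},
      \<lambda>(p, \<xi>). (snd c p, Blinfun (\<lambda>u. \<xi> (coord_vector A c p u))))"

definition cotangent_atlas ::
  "('a, 'e::real_normed_vector) chart set
    \<Rightarrow> ('a \<times> ('a, 'e) covector, 'e \<times> ('e \<Rightarrow>\<^sub>L real)) chart set" where
  "cotangent_atlas A = cotangent_chart A ` A"

definition canonical_one_form ::
  "('a, 'e::real_normed_vector) chart set
    \<Rightarrow> ('a \<times> ('a, 'e) covector, 'e \<times> ('e \<Rightarrow>\<^sub>L real)) oneform" where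
  "canonical_one_form A = (\<lambda>(p, \<xi>) v.
     if (p, \<xi>) \<in> cotangent_bundle A \<and> v \<in> tangent_space (cotangent_atlas A) (p, \<xi>)
     then \<xi> (differential (cotangent_atlas A) A fst (p, \<xi>) v)
     else 0)"

definition canonical_symplectic_form ::
  "('a, 'e::real_normed_vector) chart set
    \<Rightarrow> ('a \<times> ('a, 'e) covector, 'e \<times> ('e \<Rightarrow>\<^sub>L real)) twoform" where
  "canonical_symplectic_form A = exterior_derivative (cotangent_atlas A) (canonical_one_form A)"


section \<open>Lie groups\<close>

record ('a, 'e) smooth_monoid = "'a monoid" +
  atlas :: "('a, 'e) chart set"

locale lie_group = group G
  for G :: "('a, 'e::real_normed_vector) smooth_monoid" (structure) +
  assumes manifold: "smooth_manifold (atlas G)"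
    and carrier_eq: "carrier G = points (atlas G)"
    and smooth_mult:
      "smooth_map (product_atlas (atlas G) (atlas G)) (atlas G) (\<lambda>(g, h). g \<otimes> h)"
    and smooth_inv: "smooth_map (atlas G) (atlas G) (\<lambda>g. inv g)"

definition left_differential ::
  "('a, 'e::real_normed_vector) smooth_monoid \<Rightarrow> 'a \<Rightarrow> 'a \<Rightarrow> ('a, 'e) tangent \<Rightarrow> ('a, 'e) tangent"
  where
  "left_differential G g = differential (atlas G) (atlas G) (\<lambda>h. g \<otimes>\<^bsub>G\<^esub> h)"

definition lie_algebra ::
  "('a, 'e::real_normed_vector) smooth_monoid \<Rightarrow> ('a, 'e) vfield set" where
  "lie_algebra G = {X \<in> vector_fields (atlas G).
     \<forall>g\<in>carrier G. \<forall>h\<in>carrier G. left_differential G g h (X h) = X (g \<otimes>\<^bsub>G\<^esub> h)}"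

definition dual_lie_algebra ::
  "('a, 'e::real_normed_vector) smooth_monoid \<Rightarrow> ('a, 'e) oneform set" where
  "dual_lie_algebra G = {\<alpha> \<in> one_forms (atlas G).
     \<forall>g\<in>carrier G. \<forall>h\<in>carrier G. \<forall>v\<in>tangent_space (atlas G) h.
       \<alpha> (g \<otimes>\<^bsub>G\<^esub> h) (left_differential G g h v) = \<alpha> h v}"

text \<open>
  The function \<open>\<alpha>(X)\<close> on \<open>G\<close> is constant for left-invariant \<open>\<alpha>\<close> and \<open>X\<close>; its value is the pairing
  of the dual space with the Lie algebra.
\<close>

definition pairing ::
  "('a, 'e::real_normed_vector) smooth_monoid \<Rightarrow> ('a, 'e) oneform \<Rightarrow> ('a, 'e) vfield \<Rightarrow> real" where
  "pairing G \<alpha> X = \<alpha> \<one>\<^bsub>G\<^esub> (X \<one>\<^bsub>G\<^esub>)"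

definition left_invariant_twoform ::
  "('a, 'e::real_normed_vector) smooth_monoid \<Rightarrow> ('a, 'e) twoform \<Rightarrow> bool" where
  "left_invariant_twoform G \<omega> \<longleftrightarrow>
     (\<forall>g\<in>carrier G. \<forall>h\<in>carrier G.
      \<forall>u\<in>tangent_space (atlas G) h. \<forall>v\<in>tangent_space (atlas G) h.
        \<omega> (g \<otimes>\<^bsub>G\<^esub> h) (left_differential G g h u) (left_differential G g h v) = \<omega> h u v)"


section \<open>Representations on the dual of the Lie algebra\<close>

definition form_add :: "('a, 'e) oneform \<Rightarrow> ('a, 'e) oneform \<Rightarrow> ('a, 'e) oneform" where
  "form_add \<alpha> \<beta> = (\<lambda>g v. \<alpha> g v + \<beta> g v)"

definition form_scale :: "real \<Rightarrow> ('a, 'e) oneform \<Rightarrow> ('a, 'e) oneform" where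
  "form_scale r \<alpha> = (\<lambda>g v. r * \<alpha> g v)"

text \<open>
  A smooth homomorphism from \<open>G\<close> to the general linear group of the dual of the Lie algebra;
  smoothness is that of the matrix coefficients.
\<close>

locale dual_representation = lie_group G
  for G :: "('a, 'e::real_normed_vector) smooth_monoid" (structure) +
  fixes \<rho> :: "'a \<Rightarrow> ('a, 'e) oneform \<Rightarrow> ('a, 'e) oneform"
  assumes rep_bij: "g \<in> carrier G \<Longrightarrow> bij_betw (\<rho> g) (dual_lie_algebra G) (dual_lie_algebra G)"
    and rep_add: "\<lbrakk>g \<in> carrier G; \<alpha> \<in> dual_lie_algebra G; \<beta> \<in> dual_lie_algebra G\<rbrakk>
      \<Longrightarrow> \<rho> g (form_add \<alpha> \<beta>) = form_add (\<rho> g \<alpha>) (\<rho> g \<beta>)"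
    and rep_scale: "\<lbrakk>g \<in> carrier G; \<alpha> \<in> dual_lie_algebra G\<rbrakk>
      \<Longrightarrow> \<rho> g (form_scale r \<alpha>) = form_scale r (\<rho> g \<alpha>)"
    and rep_mult: "\<lbrakk>g \<in> carrier G; h \<in> carrier G; \<alpha> \<in> dual_lie_algebra G\<rbrakk>
      \<Longrightarrow> \<rho> (g \<otimes> h) \<alpha> = \<rho> g (\<rho> h \<alpha>)"
    and rep_smooth: "\<lbrakk>\<alpha> \<in> dual_lie_algebra G; X \<in> lie_algebra G\<rbrakk>
      \<Longrightarrow> smooth_function (atlas G) (\<lambda>g. pairing G (\<rho> g \<alpha>) X)"

text \<open>
  The derivative of \<open>\<rho>\<close> at the identity in the direction \<open>X\<close>, applied to \<open>\<alpha>\<close>, described by its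
  values on the Lie algebra.
\<close>

definition rep_derivative ::
  "('a, 'e::real_normed_vector) smooth_monoid \<Rightarrow> ('a \<Rightarrow> ('a, 'e) oneform \<Rightarrow> ('a, 'e) oneform)
    \<Rightarrow> ('a, 'e) vfield \<Rightarrow> ('a, 'e) oneform \<Rightarrow> ('a, 'e) oneform" where
  "rep_derivative G \<rho> X \<alpha> = (THE \<beta>. \<beta> \<in> dual_lie_algebra G \<and>
     (\<forall>Y\<in>lie_algebra G.
        pairing G \<beta> Y = deriv_along (atlas G) (\<lambda>g. pairing G (\<rho> g \<alpha>) Y) \<one>\<^bsub>G\<^esub> (X \<one>\<^bsub>G\<^esub>)))"

definition dual_rep_derivative ::
  "('a, 'e::real_normed_vector) smooth_monoid \<Rightarrow> ('a \<Rightarrow> ('a, 'e) oneform \<Rightarrow> ('a, 'e) oneform)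
    \<Rightarrow> ('a, 'e) vfield \<Rightarrow> ('a, 'e) vfield \<Rightarrow> ('a, 'e) vfield" where
  "dual_rep_derivative G \<rho> X Y = (THE Z. Z \<in> lie_algebra G \<and>
     (\<forall>\<alpha>\<in>dual_lie_algebra G.
        pairing G \<alpha> Z = pairing G (rep_derivative G \<rho> (\<lambda>g c. - X g c) \<alpha>) Y))"

text \<open>
  A left-invariant connection on \<open>G\<close> is determined by its restriction to left-invariant vector
  fields, and is represented by this restriction.
\<close>

definition rep_connection ::
  "('a, 'e::real_normed_vector) smooth_monoid \<Rightarrow> ('a \<Rightarrow> ('a, 'e) oneform \<Rightarrow> ('a, 'e) oneform)
    \<Rightarrow> ('a, 'e) vfield \<Rightarrow> ('a, 'e) vfield \<Rightarrow> ('a, 'e) vfield" where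
  "rep_connection G \<rho> X Y = dual_rep_derivative G \<rho> X Y"

definition torsion_free ::
  "('a, 'e::real_normed_vector) smooth_monoid
    \<Rightarrow> (('a, 'e) vfield \<Rightarrow> ('a, 'e) vfield \<Rightarrow> ('a, 'e) vfield) \<Rightarrow> bool" where
  "torsion_free G nabla \<longleftrightarrow>
     (\<forall>X\<in>lie_algebra G. \<forall>Y\<in>lie_algebra G.
        (\<lambda>g c. nabla X Y g c - nabla Y X g c) = lie_bracket (atlas G) X Y)"


section \<open>The Lie group structure on the cotangent bundle\<close>

definition left_trivialization ::
  "'a \<times> ('a, 'e) oneform \<Rightarrow> 'a \<times> ('a, 'e) covector" where
  "left_trivialization = (\<lambda>(g, \<alpha>). (g, \<alpha> g))"

definition cotangent_group ::
  "('a, 'e::real_normed_vector) smooth_monoid \<Rightarrow> ('a \<Rightarrow> ('a, 'e) oneform \<Rightarrow> ('a, 'e) oneform)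
    \<Rightarrow> ('a \<times> ('a, 'e) covector, 'e \<times> ('e \<Rightarrow>\<^sub>L real)) smooth_monoid" where
  "cotangent_group G \<rho> =
     \<lparr>carrier = cotangent_bundle (atlas G),
      mult = (\<lambda>a b.
        let untriv = inv_into (carrier G \<times> dual_lie_algebra G) left_trivialization;
            (g, \<alpha>) = untriv a;
            (h, \<beta>) = untriv b
        in left_trivialization (g \<otimes>\<^bsub>G\<^esub> h, form_add (\<rho> (inv\<^bsub>G\<^esub> h) \<alpha>) \<beta>)),
      one = left_trivialization (\<one>\<^bsub>G\<^esub>, \<lambda>g v. 0),
      atlas = cotangent_atlas (atlas G)\<rparr>"

end

theory Submission
  imports Defs
begin

text \<open>
  Left translation by \<open>\<alpha>\<^sub>g\<close> on the cotangent bundle is the cotangent lift of left translation by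
  \<open>g\<close> composed with the fibre translation by the one-form \<open>\<kappa>\<close>, \<open>\<kappa>(h) = (\<rho>(h\<inverse>)\<alpha>)\<^sub>h\<close>. Cotangent lifts
  preserve \<open>\<Omega>\<close> and the fibre translation changes it by the pull-back of \<open>d\<kappa>\<close>, so \<open>\<Omega>\<close> is
  left-invariant iff every such \<open>\<kappa>\<close> is closed. For left-invariant \<open>X\<close>, \<open>Y\<close> and \<open>\<beta> = \<rho>(h\<inverse>)\<alpha>\<close> one
  has \<open>d\<kappa>(X, Y)(h) = \<beta>(\<nabla>\<^sub>X Y - \<nabla>\<^sub>Y X - [X, Y])(h)\<close>, and \<open>\<beta>\<close> ranges over the whole dual space.
\<close>

section \<open>Finite-dimensional normed spaces\<close>

text \<open>If \<beta> is left-invariant, then \<beta> at \<open>g h\<close> composed with the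
  differential of left translation by \<open>g\<close> is \<beta> at \<open>h\<close>. Hence the
  product turns a covector \<xi> at \<open>h\<close> into a covector at \<open>g h\<close> that
  pulls back to \<xi> + \<kappa>(h), which is where the lift and the fibre translation come from.
  The formula for d\<kappa> is Cartan's: the function \<kappa>(Y) at \<open>h\<close> is the pairing
  of \<rho>(h^{-1})\<alpha> with \<open>Y\<close>, and its derivative along \<open>X\<close> is the
  pairing of \<beta> with \<nabla>_X Y; the minus sign in the dual representation is supplied by the
  derivative of inversion. The condition obtained at \<open>(h, \<xi>)\<close> depends on \<alpha>
  and \<open>h\<close> only, so torsion can be tested with translations by covectors at the
  identity, on the zero section. Two features of the setting shape the proof. The model space is a
  normed space with a finite spanning set, so continuity of linear maps is first derived from that
  set. Derivatives are given in fixed directions, so a derivative applied to a moving vector is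
  treated by expanding the vector in a basis.\<close>

definition is_basis :: "'a::real_vector set \<Rightarrow> bool" where
  "is_basis B \<longleftrightarrow> finite B \<and> independent B \<and> span B = UNIV"

lemma is_basis_exists:
  fixes C :: "'a::real_vector set"
  assumes "finite C" "span C = UNIV"
  obtains B :: "'a set" where "is_basis B"
proof -
  obtain B where "B \<subseteq> C" "independent B" "C \<subseteq> span B"
    using maximal_independent_subset[of C] by auto
  then show ?thesis
    using assms span_mono[of C "span B"] that[of B] finite_subset[of B C]
    by (auto simp: is_basis_def span_span)
qed

lemma is_basis_expand:
  assumes "is_basis B"
  shows "(\<Sum>b\<in>B. representation B v b *\<^sub>R b) = v"
  using assms by (intro real_vector.sum_representation_eq) (auto simp: is_basis_def)

lemma linear_basis_expand:
  assumes "is_basis B" "linear f"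
  shows "f v = (\<Sum>b\<in>B. representation B v b *\<^sub>R f b)"
proof -
  have "f v = f (\<Sum>b\<in>B. representation B v b *\<^sub>R b)"
    by (simp only: is_basis_expand[OF assms(1)])
  also have "\<dots> = (\<Sum>b\<in>B. representation B v b *\<^sub>R f b)"
    by (simp only: linear_sum[OF assms(2)] linear_scale[OF assms(2)])
  finally show ?thesis .
qed

lemma linear_representation_basis:
  assumes "is_basis B"
  shows "linear (\<lambda>v. representation B v b)"
  using assms
  by (intro linearI) (auto simp: is_basis_def real_vector.representation_add real_vector.representation_scale)

text \<open>The constant is the distance from \<open>b\<close> to \<open>V\<close>, positive because
  \<open>V\<close> is closed: dividing \<open>w + r b\<close> by \<open>r\<close> gives
  \<open>b\<close> minus an element of \<open>V\<close>. The bound serves twice, for closedness of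
  finite spans and for continuity of coordinates.\<close>

lemma coefficient_lower_bound:
  fixes V :: "'a::real_normed_vector set"
  assumes V: "subspace V" "closed V" and b: "b \<notin> V"
  obtains d where "d > 0" "\<And>w r. w \<in> V \<Longrightarrow> \<bar>r\<bar> * d \<le> norm (w + r *\<^sub>R b)"
proof
  have Vne: "V \<noteq> {}" using subspace_0[OF V(1)] by auto
  show "infdist b V > 0"
    using V b Vne in_closed_iff_infdist_zero[of V b] infdist_nonneg[of b V] by fastforce
  show "\<bar>r\<bar> * infdist b V \<le> norm (w + r *\<^sub>R b)" if "w \<in> V" for w r
  proof (cases "r = 0")
    case False
    have "(- inverse r) *\<^sub>R w \<in> V" using V(1) that by (rule subspace_scale)
    then have "infdist b V \<le> dist b ((- inverse r) *\<^sub>R w)" by (rule infdist_le)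
    also have "\<dots> = norm (inverse r *\<^sub>R (w + r *\<^sub>R b))"
      using False by (simp add: dist_norm scaleR_add_right add.commute)
    also have "\<dots> = norm (w + r *\<^sub>R b) / \<bar>r\<bar>"
      by (simp add: divide_inverse mult.commute)
    finally show ?thesis using False by (simp add: field_simps)
  qed simp
qed

text \<open>If \<open>w n + r n *\<^sub>R b\<close> converges, the lower bound makes
  \<open>r\<close> a Cauchy sequence of reals, hence convergent. The limit of \<open>w\<close> then
  follows by subtraction and lies in \<open>V\<close>.\<close>

lemma closed_span_insert:
  fixes V :: "'a::real_normed_vector set"
  assumes V: "subspace V" "closed V" and b: "b \<notin> V"
  shows "closed {v + r *\<^sub>R b | v r. v \<in> V}"
proof -
  obtain d where d: "d > 0" and lower: "\<And>w r. w \<in> V \<Longrightarrow> \<bar>r\<bar> * d \<le> norm (w + r *\<^sub>R b)"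
    using coefficient_lower_bound[OF V b] by blast
  show ?thesis
    unfolding closed_sequential_limits
  proof (intro allI impI; elim conjE)
    fix X l assume X: "\<forall>n. X n \<in> {v + r *\<^sub>R b | v r. v \<in> V}" and l: "X \<longlonglongrightarrow> l"
    from X have "\<forall>n. \<exists>v r. v \<in> V \<and> X n = v + r *\<^sub>R b" by blast
    then obtain w r where w: "\<And>n. w n \<in> V" and Xe: "\<And>n. X n = w n + r n *\<^sub>R b"
      by metis
    have "Cauchy r"
    proof (rule metric_CauchyI)
      fix e :: real assume "e > 0"
      then have "e * d > 0" using d by simp
      with LIMSEQ_imp_Cauchy[OF l] obtain M where M: "\<And>m n. m \<ge> M \<Longrightarrow> n \<ge> M \<Longrightarrow> dist (X m) (X n) < e * d"
        unfolding Cauchy_def by blast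
      have "dist (r m) (r n) < e" if "m \<ge> M" "n \<ge> M" for m n
      proof -
        have "\<bar>r m - r n\<bar> * d \<le> norm ((w m - w n) + (r m - r n) *\<^sub>R b)"
          using w V(1) by (intro lower subspace_diff)
        also have "\<dots> = dist (X m) (X n)"
          unfolding Xe dist_norm by (simp add: algebra_simps)
        also have "\<dots> < e * d" using M that by blast
        finally show ?thesis using d by (simp add: dist_real_def)
      qed
      then show "\<exists>M. \<forall>m\<ge>M. \<forall>n\<ge>M. dist (r m) (r n) < e" by blast
    qed
    then obtain r0 where r0: "r \<longlonglongrightarrow> r0" using Cauchy_convergent convergent_def by blast
    have "(\<lambda>n. X n - r n *\<^sub>R b) \<longlonglongrightarrow> l - r0 *\<^sub>R b"
      by (intro tendsto_intros l r0)
    then have "w \<longlonglongrightarrow> l - r0 *\<^sub>R b" by (simp add: Xe)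
    then have "l - r0 *\<^sub>R b \<in> V"
      using V(2) w unfolding closed_sequential_limits by blast
    then show "l \<in> {v + r *\<^sub>R b | v r. v \<in> V}" by force
  qed
qed

lemma closed_span_finite:
  fixes F :: "'a::real_normed_vector set"
  assumes "finite F"
  shows "closed (span F)"
  using assms
proof induction
  case (insert b F)
  show ?case
  proof (cases "b \<in> span F")
    case True
    then show ?thesis using insert by (simp add: span_redundant)
  next
    case False
    have "span (insert b F) = {v + r *\<^sub>R b | v r. v \<in> span F}"
    proof (intro equalityI subsetI)
      fix x assume "x \<in> span (insert b F)"
      then obtain k where "x - k *\<^sub>R b \<in> span F" by (auto simp: span_insert)
      then show "x \<in> {v + r *\<^sub>R b | v r. v \<in> span F}" by (metis (mono_tags, lifting) diff_add_cancel mem_Collect_eq)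
    next
      fix x assume "x \<in> {v + r *\<^sub>R b | v r. v \<in> span F}"
      then obtain v r where "v \<in> span F" "x = v + r *\<^sub>R b" by blast
      then show "x \<in> span (insert b F)" unfolding span_insert by (auto intro: exI[of _ r])
    qed
    then show ?thesis using closed_span_insert[OF _ insert.IH False] by simp
  qed
qed simp

text \<open>The other basis vectors span a closed subspace not containing \<open>b\<close>, so the
  coefficient at \<open>b\<close> is at most the norm times \<open>1 / d\<close>. Hence coordinates
  are continuous for the given norm, and with them all linear maps on the space.\<close>

lemma bounded_linear_representation:
  fixes B :: "'a::real_normed_vector set"
  assumes B: "is_basis B"
  shows "bounded_linear (\<lambda>v. representation B v b)"
proof (cases "b \<in> B")
  case False
  then have "(\<lambda>v. representation B v b) = (\<lambda>_. 0)"
    using real_vector.representation_ne_zero[of B _ b] by (intro ext) auto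
  then show ?thesis by simp
next
  case True
  define V where "V = span (B - {b})"
  have V: "subspace V" "closed V" "b \<notin> V"
    using B True closed_span_finite[of "B - {b}"] by (auto simp: V_def is_basis_def dependent_def)
  obtain d where d: "d > 0" and lower: "\<And>w r. w \<in> V \<Longrightarrow> \<bar>r\<bar> * d \<le> norm (w + r *\<^sub>R b)"
    using coefficient_lower_bound[OF V] by blast
  show ?thesis
  proof (rule bounded_linear_intro[where K = "1 / d"])
    fix v :: 'a
    define r where "r = representation B v b"
    define w where "w = (\<Sum>b'\<in>B - {b}. representation B v b' *\<^sub>R b')"
    have v: "v = w + r *\<^sub>R b"
      using is_basis_expand[OF B, of v] True B unfolding r_def w_def is_basis_def
      by (metis (no_types, lifting) sum.remove add.commute)
    have w: "w \<in> V" unfolding w_def V_def by (intro span_sum span_scale span_base) 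
    have "\<bar>r\<bar> * d \<le> norm v" unfolding v by (rule lower[OF w])
    then show "norm (representation B v b) \<le> norm v * (1 / d)"
      using d by (simp add: r_def field_simps)
  qed (use linear_add[OF linear_representation_basis[OF B, of b]] linear_scale[OF linear_representation_basis[OF B, of b]] in auto)
qed

lemma bounded_linear_finite_dim:
  fixes B :: "'a::real_normed_vector set" and f :: "'a \<Rightarrow> 'b::real_normed_vector"
  assumes B: "is_basis B" and f: "linear f"
  shows "bounded_linear f"
proof -
  have "bounded_linear (\<lambda>v. \<Sum>b\<in>B. representation B v b *\<^sub>R f b)"
    by (intro bounded_linear_sum bounded_linear_compose[OF bounded_linear_scaleR_left]
        bounded_linear_representation[OF B])
  then show ?thesis using linear_basis_expand[OF B f] by (metis (no_types, lifting) ext)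
qed

definition dual_basis :: "'a::real_normed_vector set \<Rightarrow> 'a \<Rightarrow> 'a \<Rightarrow>\<^sub>L real" where
  "dual_basis B b = Blinfun (\<lambda>v. representation B v b)"

lemma dual_basis_apply:
  assumes "is_basis B"
  shows "dual_basis B b v = representation B v b"
  unfolding dual_basis_def
  by (simp add: bounded_linear_Blinfun_apply bounded_linear_representation[OF assms])

lemma blinfun_dual_expand:
  fixes l :: "'a::real_normed_vector \<Rightarrow>\<^sub>L real"
  assumes "is_basis B"
  shows "l = (\<Sum>b\<in>B. l b *\<^sub>R dual_basis B b)"
proof (rule blinfun_eqI)
  fix v
  have "l v = (\<Sum>b\<in>B. representation B v b *\<^sub>R l b)"
    using assms by (intro linear_basis_expand) (auto intro: bounded_linear.linear blinfun.bounded_linear_right)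
  then show "l v = (\<Sum>b\<in>B. l b *\<^sub>R dual_basis B b) v"
    by (simp add: blinfun.sum_left blinfun.scaleR_left dual_basis_apply[OF assms] mult.commute)
qed

lemma dual_separates:
  fixes B :: "'a::real_normed_vector set"
  assumes "is_basis B" "\<And>l :: 'a \<Rightarrow>\<^sub>L real. l v = l w"
  shows "v = w"
proof -
  have "representation B v b = representation B w b" for b
    using assms(2)[of "dual_basis B b"] by (simp add: dual_basis_apply[OF assms(1)])
  then have "(\<Sum>b\<in>B. representation B v b *\<^sub>R b) = (\<Sum>b\<in>B. representation B w b *\<^sub>R b)" by simp
  then show ?thesis by (simp only: is_basis_expand[OF assms(1)])
qed

text \<open>It provides the basis for chain rules through the model space of a product, such as that
  of \<open>G \<times> G\<close>.\<close>

lemma prod_basis_exists: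
  fixes B :: "'a::real_normed_vector set" and C :: "'b::real_normed_vector set"
  assumes B: "is_basis B" and C: "is_basis C"
  obtains D :: "('a \<times> 'b) set" where "is_basis D"
proof -
  let ?D = "(\<lambda>b. (b, 0)) ` B \<union> (\<lambda>c. (0, c)) ` C"
  have "p \<in> span ?D" for p
  proof -
    have "p = (\<Sum>b\<in>B. representation B (fst p) b *\<^sub>R (b, 0)) + (\<Sum>c\<in>C. representation C (snd p) c *\<^sub>R (0, c))"
      by (rule prod_eqI) (simp_all add: fst_sum snd_sum is_basis_expand[OF B] is_basis_expand[OF C])
    also have "\<dots> \<in> span ?D"
      by (intro span_add span_sum span_scale span_base) auto
    finally show ?thesis .
  qed
  then have "span ?D = UNIV" by auto
  then show ?thesis using is_basis_exists[of ?D] B C that by (auto simp: is_basis_def)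
qed


section \<open>Calculus\<close>

lemma frechet_derivative_eq:
  "(f has_derivative f') (at x) \<Longrightarrow> frechet_derivative f (at x) = f'"
  by (rule frechet_derivative_at[symmetric])

text \<open>\<open>frechet_derivative\<close> is a choice among the maps satisfying
  \<open>has_derivative\<close>. Both functions have the same candidates at \<open>x\<close>, so the
  choices agree even where no derivative exists.\<close>

lemma frechet_derivative_cong_open:
  assumes "open S" "x \<in> S" "\<And>y. y \<in> S \<Longrightarrow> f y = g y"
  shows "frechet_derivative f (at x) = frechet_derivative g (at x)"
proof -
  have "(f has_derivative D) (at x) \<longleftrightarrow> (g has_derivative D) (at x)" for D
    using has_derivative_transform_within_open[of f D x UNIV S g]
      has_derivative_transform_within_open[of g D x UNIV S f] assms by auto
  then show ?thesis by (simp add: frechet_derivative_def)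
qed

lemma differentiable_cong_open:
  assumes "open S" "x \<in> S" "\<And>y. y \<in> S \<Longrightarrow> f y = g y" "f differentiable (at x)"
  shows "g differentiable (at x)"
  using has_derivative_transform_within_open[of f _ x UNIV S g] assms
  unfolding differentiable_def by blast

text \<open>For fixed \<open>h\<close>, the mean value inequality is applied in the direction
  \<open>v\<close> to the difference of \<open>f\<close> along two parallel segments, one of them
  displaced by \<open>h u\<close>. Near \<open>x\<close> the linear approximation \<open>A\<close>
  of the derivative in direction \<open>v\<close> shows that this difference grows at the rate
  \<open>h A u\<close>, up to a small error.\<close>

lemma second_difference_bound:
  fixes f :: "'a::real_normed_vector \<Rightarrow> 'b::real_normed_vector"
  assumes S: "open S" "x \<in> S" and f: "\<And>y. y \<in> S \<Longrightarrow> f differentiable (at y)"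
    and A: "((\<lambda>y. frechet_derivative f (at y) v) has_derivative A) (at x)" and e: "e > 0"
  shows "\<exists>d>0. \<forall>h. 0 < h \<and> h < d \<longrightarrow>
    norm (f (x + h *\<^sub>R u + h *\<^sub>R v) - f (x + h *\<^sub>R u) - f (x + h *\<^sub>R v) + f x - h\<^sup>2 *\<^sub>R A u) \<le> e * h\<^sup>2"
proof -
  define g where "g y = frechet_derivative f (at y) v" for y
  define N where "N = norm u + norm v + 1"
  \<comment> \<open>The estimate \<open>gb\<close> is used twice, with an error of at most
    \<open>e' * (h * N)\<close> each time, and the two errors have to add up to
    \<open>e * h\<close>.\<close>
  define e' where "e' = e / (2 * N)"
  have N: "N > 0" unfolding N_def by (simp add: add_nonneg_pos)
  then have e': "e' > 0" using e by (simp add: e'_def)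
  have linA: "linear A" using A has_derivative_linear by blast
  obtain d1 where d1: "d1 > 0" "\<And>y. norm (y - x) < d1 \<Longrightarrow> norm (g y - g x - A (y - x)) \<le> e' * norm (y - x)"
    using A e' unfolding has_derivative_at_alt g_def by blast
  obtain d2 where d2: "d2 > 0" "\<And>y. norm (y - x) < d2 \<Longrightarrow> y \<in> S"
    using S by (metis dist_norm dist_commute openE mem_ball subsetD)
  define d where "d = min d1 d2 / N"
  have "d > 0" using N d1 d2 by (simp add: d_def)
  moreover have "norm (f (x + h *\<^sub>R u + h *\<^sub>R v) - f (x + h *\<^sub>R u) - f (x + h *\<^sub>R v) + f x - h\<^sup>2 *\<^sub>R A u) \<le> e * h\<^sup>2"
    if h: "0 < h" "h < d" for h
  proof -
    have hN: "h * N < min d1 d2" using h N by (simp add: d_def field_simps)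
    have bd: "norm ((s *\<^sub>R u + t *\<^sub>R v)) \<le> h * N" if "s \<in> {0..h}" "t \<in> {0..h}" for s t
    proof -
      have "norm (s *\<^sub>R u + t *\<^sub>R v) \<le> s * norm u + t * norm v"
        using that norm_triangle_ineq[of "s *\<^sub>R u" "t *\<^sub>R v"] by simp
      also have "\<dots> \<le> h * norm u + h * norm v"
        using that by (intro add_mono mult_right_mono) auto
      also have "\<dots> \<le> h * N" using h by (simp add: N_def algebra_simps)
      finally show ?thesis .
    qed
    have inS: "x + (s *\<^sub>R u + t *\<^sub>R v) \<in> S" if "s \<in> {0..h}" "t \<in> {0..h}" for s t
      using bd[OF that] hN by (intro d2) auto
    have gb: "norm (g (x + (s *\<^sub>R u + t *\<^sub>R v)) - g x - A (s *\<^sub>R u + t *\<^sub>R v)) \<le> e' * (h * N)"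
      if "s \<in> {0..h}" "t \<in> {0..h}" for s t
    proof -
      have "norm (g (x + (s *\<^sub>R u + t *\<^sub>R v)) - g x - A (s *\<^sub>R u + t *\<^sub>R v)) \<le> e' * norm (s *\<^sub>R u + t *\<^sub>R v)"
        using bd[OF that] hN d1(2)[of "x + (s *\<^sub>R u + t *\<^sub>R v)"] by simp
      also have "\<dots> \<le> e' * (h * N)" using bd[OF that] e' by simp
      finally show ?thesis .
    qed
    \<comment> \<open>The increment of \<open>p\<close> over the interval from 0 to \<open>h\<close>
      is the second difference minus \<open>h\<^sup>2 *\<^sub>R A u\<close>. The term
      \<open>0 *\<^sub>R u\<close> keeps both segments in the form expected by \<open>fd\<close> and
      \<open>gb\<close>.\<close>
    define p where "p t = f (x + (h *\<^sub>R u + t *\<^sub>R v)) - f (x + (0 *\<^sub>R u + t *\<^sub>R v)) - (t * h) *\<^sub>R A u" for t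
    define p' where "p' t = g (x + (h *\<^sub>R u + t *\<^sub>R v)) - g (x + (0 *\<^sub>R u + t *\<^sub>R v)) - h *\<^sub>R A u" for t
    have fd: "((\<lambda>t. f (x + (s *\<^sub>R u + t *\<^sub>R v))) has_derivative (\<lambda>k. k *\<^sub>R g (x + (s *\<^sub>R u + t *\<^sub>R v)))) (at t within {0..h})"
      if "s \<in> {0..h}" "t \<in> {0..h}" for s t
    proof -
      let ?y = "x + (s *\<^sub>R u + t *\<^sub>R v)"
      have 1: "((\<lambda>t. x + (s *\<^sub>R u + t *\<^sub>R v)) has_derivative (\<lambda>k. k *\<^sub>R v)) (at t within {0..h})"
        by (auto intro!: derivative_eq_intros)
      have 2: "(f has_derivative frechet_derivative f (at ?y)) (at ?y)"
        using f[OF inS[OF that]] frechet_derivative_works by blast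
      have "((\<lambda>t. f (x + (s *\<^sub>R u + t *\<^sub>R v))) has_derivative (\<lambda>k. frechet_derivative f (at ?y) (k *\<^sub>R v))) (at t within {0..h})"
        by (rule has_derivative_compose[OF 1 2])
      then show ?thesis
        using linear_scale[OF has_derivative_linear[OF 2]] by (simp add: g_def)
    qed
    have dp: "(p has_derivative (\<lambda>k. k *\<^sub>R p' t)) (at t within {0..h})" if "t \<in> {0..h}" for t
      unfolding p_def
      by (rule derivative_eq_intros fd refl that | use h that in \<open>simp add: p'_def algebra_simps\<close>)+
    have on: "onorm (\<lambda>k. k *\<^sub>R p' t) \<le> e * h" if "t \<in> {0..h}" for t
    proof (rule onorm_bound)
      have "A (h *\<^sub>R u + t *\<^sub>R v) - A (0 *\<^sub>R u + t *\<^sub>R v) = h *\<^sub>R A u"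
        using linA by (simp add: linear_add linear_scale)
      then have "p' t = (g (x + (h *\<^sub>R u + t *\<^sub>R v)) - g x - A (h *\<^sub>R u + t *\<^sub>R v))
         - (g (x + (0 *\<^sub>R u + t *\<^sub>R v)) - g x - A (0 *\<^sub>R u + t *\<^sub>R v))"
        unfolding p'_def by (simp add: algebra_simps)
      then have "norm (p' t) \<le> norm (g (x + (h *\<^sub>R u + t *\<^sub>R v)) - g x - A (h *\<^sub>R u + t *\<^sub>R v))
         + norm (g (x + (0 *\<^sub>R u + t *\<^sub>R v)) - g x - A (0 *\<^sub>R u + t *\<^sub>R v))"
        by (metis norm_triangle_ineq4)
      also have "\<dots> \<le> e' * (h * N) + e' * (h * N)"
        using h that by (intro add_mono gb) auto
      also have "\<dots> = e * h" using N by (simp add: e'_def field_simps)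
      finally have "norm (p' t) \<le> e * h" .
      then show "norm (k *\<^sub>R p' t) \<le> e * h * norm k" for k
        by (simp add: mult_left_mono mult.commute[of "e * h"])
    qed (use e h in auto)
    have "norm (p h - p 0) \<le> (e * h) * norm (h - 0)"
      by (rule differentiable_bound[of "{0..h}"]) (use h dp on in auto)
    moreover have "p h - p 0 = f (x + h *\<^sub>R u + h *\<^sub>R v) - f (x + h *\<^sub>R u) - f (x + h *\<^sub>R v) + f x - h\<^sup>2 *\<^sub>R A u"
      by (simp add: p_def power2_eq_square algebra_simps)
    ultimately show ?thesis using h by (simp add: power2_eq_square mult.assoc)
  qed
  ultimately show ?thesis by blast
qed

text \<open>The second difference does not change when \<open>u\<close> and \<open>v\<close> are
  exchanged, so for small \<open>h\<close> it is within \<open>e / 2 * h\<^sup>2\<close> of both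
  \<open>h\<^sup>2 *\<^sub>R A u\<close> and \<open>h\<^sup>2 *\<^sub>R B v\<close>. Dividing by
  \<open>h\<^sup>2\<close> bounds the distance between \<open>A u\<close> and \<open>B v\<close> by
  \<open>e\<close>.\<close>

lemma second_derivative_symmetric:
  fixes f :: "'a::real_normed_vector \<Rightarrow> 'b::real_normed_vector"
  assumes S: "open S" "x \<in> S" and f: "\<And>y. y \<in> S \<Longrightarrow> f differentiable (at y)"
    and A: "((\<lambda>y. frechet_derivative f (at y) v) has_derivative A) (at x)"
    and B: "((\<lambda>y. frechet_derivative f (at y) u) has_derivative B) (at x)"
  shows "A u = B v"
proof -
  have "norm (A u - B v) \<le> e" if e: "e > 0" for e
  proof -
    have e2: "e / 2 > 0" using e by simp
    obtain d1 where d1: "d1 > 0" "\<And>h. 0 < h \<Longrightarrow> h < d1 \<Longrightarrow>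
      norm (f (x + h *\<^sub>R u + h *\<^sub>R v) - f (x + h *\<^sub>R u) - f (x + h *\<^sub>R v) + f x - h\<^sup>2 *\<^sub>R A u) \<le> e / 2 * h\<^sup>2"
      using second_difference_bound[OF S f A e2, of u] by blast
    obtain d2 where d2: "d2 > 0" "\<And>h. 0 < h \<Longrightarrow> h < d2 \<Longrightarrow>
      norm (f (x + h *\<^sub>R v + h *\<^sub>R u) - f (x + h *\<^sub>R v) - f (x + h *\<^sub>R u) + f x - h\<^sup>2 *\<^sub>R B v) \<le> e / 2 * h\<^sup>2"
      using second_difference_bound[OF S f B e2, of v] by blast
    define h where "h = min d1 d2 / 2"
    have h: "0 < h" "h < d1" "h < d2" using d1 d2 by (auto simp: h_def)
    define D where "D = f (x + h *\<^sub>R u + h *\<^sub>R v) - f (x + h *\<^sub>R u) - f (x + h *\<^sub>R v) + f x"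
    have 1: "norm (D - h\<^sup>2 *\<^sub>R A u) \<le> e / 2 * h\<^sup>2" using d1(2)[OF h(1,2)] by (simp add: D_def)
    have "D = f (x + h *\<^sub>R v + h *\<^sub>R u) - f (x + h *\<^sub>R v) - f (x + h *\<^sub>R u) + f x"
      by (simp add: D_def algebra_simps)
    then have 2: "norm (D - h\<^sup>2 *\<^sub>R B v) \<le> e / 2 * h\<^sup>2" using d2(2)[OF h(1,3)] by simp
    have "h\<^sup>2 * norm (A u - B v) = norm ((D - h\<^sup>2 *\<^sub>R B v) - (D - h\<^sup>2 *\<^sub>R A u))"
      by (simp add: algebra_simps flip: scaleR_diff_right)
    also have "\<dots> \<le> e / 2 * h\<^sup>2 + e / 2 * h\<^sup>2"
        by (rule order_trans[OF norm_triangle_ineq4 add_mono[OF 2 1]])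
    also have "\<dots> = h\<^sup>2 * e" by simp
    finally show ?thesis using h by simp
  qed
  then have "norm (A u - B v) \<le> 0" by (rule field_le_epsilon) simp
  then show ?thesis by simp
qed

section \<open>Closure properties of C^k maps on open sets\<close>

lemma Ck_on_cong:
  assumes "open S" "\<And>x. x \<in> S \<Longrightarrow> f x = g x" "Ck_on n S f"
  shows "Ck_on n S g"
  using assms(2,3)
proof (induction n arbitrary: f g)
  case 0
  then show ?case using continuous_on_cong by (metis Ck_on.simps(1))
next
  case (Suc n)
  have "g differentiable (at x)" if "x \<in> S" for x
    using differentiable_cong_open[OF assms(1) that, of f g] Suc.prems that by simp
  moreover have "Ck_on n S (\<lambda>x. frechet_derivative g (at x) v)" for v
  proof (rule Suc.IH[of "\<lambda>x. frechet_derivative f (at x) v"])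
    show "frechet_derivative f (at x) v = frechet_derivative g (at x) v" if "x \<in> S" for x
      using frechet_derivative_cong_open[OF assms(1) that, of f g] Suc.prems by simp
  qed (use Suc.prems in simp)
  ultimately show ?case by simp
qed

lemma Ck_on_SucD: "Ck_on (Suc n) S f \<Longrightarrow> Ck_on n S f"
proof (induction n arbitrary: f)
  case 0
  then show ?case
    by (auto intro!: continuous_at_imp_continuous_on differentiable_imp_continuous_within)
qed simp

text \<open>It allows charts to be chosen point by point, as in the smoothness of left-invariant
  forms, where \<open>inv p\<close> may leave the domain of any one chart while \<open>p\<close>
  varies.\<close>

lemma Ck_on_local:
  assumes "\<And>x. x \<in> S \<Longrightarrow> \<exists>T. open T \<and> x \<in> T \<and> Ck_on n T f"
  shows "Ck_on n S f"
  using assms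
proof (induction n arbitrary: f)
  case 0
  then show ?case
    by (auto intro!: continuous_at_imp_continuous_on) (metis continuous_on_eq_continuous_at)
next
  case (Suc n)
  then show ?case by simp metis
qed

lemma Ck_on_Suc_has_derivative:
  "Ck_on (Suc n) S f \<Longrightarrow> x \<in> S \<Longrightarrow> (f has_derivative frechet_derivative f (at x)) (at x)"
  using frechet_derivative_works[of f "at x"] by simp

lemma Ck_on_Suc_derivative: "Ck_on (Suc n) S f \<Longrightarrow> Ck_on n S (\<lambda>x. frechet_derivative f (at x) v)"
  by simp

lemma Ck_on_SucI:
  assumes "open S" "\<And>x. x \<in> S \<Longrightarrow> (f has_derivative D x) (at x)" "\<And>v. Ck_on n S (\<lambda>x. D x v)"
  shows "Ck_on (Suc n) S f"
proof -
  have "Ck_on n S (\<lambda>x. frechet_derivative f (at x) v)" for v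
    by (rule Ck_on_cong[OF assms(1) _ assms(3)[of v]]) (simp add: frechet_derivative_eq[OF assms(2)])
  then show ?thesis using assms(2) by (auto simp: differentiable_def)
qed

lemma Ck_on_const: "Ck_on n S (\<lambda>x. c)"
  by (induction n arbitrary: c) auto

lemma Ck_on_linear:
  assumes L: "bounded_linear L" and S: "open S"
  shows "Ck_on n S f \<Longrightarrow> Ck_on n S (\<lambda>x. L (f x))"
proof (induction n arbitrary: f)
  case 0
  then show ?case using L by (simp add: bounded_linear.continuous_on)
next
  case (Suc n)
  show ?case
    by (rule Ck_on_SucI[OF S bounded_linear.has_derivative[OF L Ck_on_Suc_has_derivative[OF Suc.prems]]
          Suc.IH[OF Ck_on_Suc_derivative[OF Suc.prems]]])
qed

lemma Ck_on_add:
  assumes S: "open S"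
  shows "Ck_on n S f \<Longrightarrow> Ck_on n S g \<Longrightarrow> Ck_on n S (\<lambda>x. f x + g x)"
proof (induction n arbitrary: f g)
  case 0
  then show ?case by (simp add: continuous_on_add)
next
  case (Suc n)
  show ?case
    by (rule Ck_on_SucI[OF S has_derivative_add[OF Suc.prems[THEN Ck_on_Suc_has_derivative]]
          Suc.IH[OF Suc.prems[THEN Ck_on_Suc_derivative]]])
qed

lemma Ck_on_sum:
  assumes "open S" "\<And>i. i \<in> I \<Longrightarrow> Ck_on n S (f i)"
  shows "Ck_on n S (\<lambda>x. \<Sum>i\<in>I. f i x)"
  using assms(2)
proof (induction I rule: infinite_finite_induct)
  case (insert i I)
  then have "Ck_on n S (\<lambda>x. f i x + (\<Sum>i\<in>I. f i x))"
    by (intro Ck_on_add[OF assms(1)]) auto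
  then show ?case using insert by simp
qed (simp_all add: Ck_on_const)

lemma Ck_on_scaleR:
  assumes S: "open S"
  shows "Ck_on n S a \<Longrightarrow> Ck_on n S f \<Longrightarrow> Ck_on n S (\<lambda>x. a x *\<^sub>R f x)"
proof (induction n arbitrary: a f)
  case 0
  then show ?case by (simp add: continuous_on_scaleR)
next
  case (Suc n)
  show ?case
    by (rule Ck_on_SucI[OF S has_derivative_scaleR[OF Suc.prems[THEN Ck_on_Suc_has_derivative]]
          Ck_on_add[OF S Suc.IH[OF Ck_on_SucD[OF Suc.prems(1)] Ck_on_Suc_derivative[OF Suc.prems(2)]]
            Suc.IH[OF Ck_on_Suc_derivative[OF Suc.prems(1)] Ck_on_SucD[OF Suc.prems(2)]]]])
qed

lemma Ck_on_Pair:
  assumes S: "open S"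
  shows "Ck_on n S f \<Longrightarrow> Ck_on n S g \<Longrightarrow> Ck_on n S (\<lambda>x. (f x, g x))"
proof (induction n arbitrary: f g)
  case 0
  then show ?case by (simp add: continuous_on_Pair)
next
  case (Suc n)
  show ?case
    by (rule Ck_on_SucI[OF S has_derivative_Pair[OF Suc.prems[THEN Ck_on_Suc_has_derivative]]
          Suc.IH[OF Suc.prems[THEN Ck_on_Suc_derivative]]])
qed

text \<open>The derivative of the composite in direction \<open>v\<close> is the derivative of
  \<open>f\<close> in the fixed direction \<open>L v\<close>, again composed with the affine map.
  The induction therefore closes without an expansion in a basis.\<close>

lemma Ck_on_affine:
  assumes L: "bounded_linear L" and S: "open S" "\<And>x. x \<in> S \<Longrightarrow> L x + a \<in> T"
  shows "Ck_on n T f \<Longrightarrow> Ck_on n S (\<lambda>x. f (L x + a))"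
proof (induction n arbitrary: f)
  case 0
  then have "continuous_on T f" by simp
  moreover have "continuous_on S (\<lambda>x. L x + a)"
    by (intro continuous_on_add bounded_linear.continuous_on[OF L] continuous_on_id continuous_on_const)
  ultimately have "continuous_on S (\<lambda>x. f (L x + a))"
    by (rule continuous_on_compose2) (use S in auto)
  then show ?case by simp
next
  case (Suc n)
  have L': "((\<lambda>x. L x + a) has_derivative L) (at x)" for x
    by (rule has_derivative_add_const[OF bounded_linear_imp_has_derivative[OF L]])
  have D: "((\<lambda>x. f (L x + a)) has_derivative
      (\<lambda>v. frechet_derivative f (at (L x + a)) (L v))) (at x)" if "x \<in> S" for x
    by (rule has_derivative_compose[OF L' Ck_on_Suc_has_derivative[OF Suc.prems S(2)[OF that]]])
  show ?case
    by (rule Ck_on_SucI[OF S(1) D Suc.IH[OF Ck_on_Suc_derivative[OF Suc.prems]]])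
qed

text \<open>
  Directional derivatives are taken in fixed directions, so the chain rule expands the direction
  in a basis of the middle space.
\<close>

lemma Ck_on_compose:
  fixes B :: "'b::real_normed_vector set" and f :: "'a::real_normed_vector \<Rightarrow> 'b"
  assumes B: "is_basis B" and S: "open S" "\<And>x. x \<in> S \<Longrightarrow> f x \<in> T"
  shows "Ck_on n T g \<Longrightarrow> Ck_on n S f \<Longrightarrow> Ck_on n S (\<lambda>x. g (f x))"
proof (induction n arbitrary: g)
  case 0
  then have "continuous_on S (\<lambda>x. g (f x))"
    using S by (intro continuous_on_compose2[of T g S f]) auto
  then show ?case by simp
next
  case (Suc n)
  let ?Df = "\<lambda>x. frechet_derivative f (at x)" and ?Dg = "\<lambda>x. frechet_derivative g (at (f x))"
  have G: "(g has_derivative ?Dg x) (at (f x))" if "x \<in> S" for x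
    by (rule Ck_on_Suc_has_derivative[OF Suc.prems(1) S(2)[OF that]])
  have D: "((\<lambda>x. g (f x)) has_derivative
      (\<lambda>v. \<Sum>b\<in>B. representation B (?Df x v) b *\<^sub>R ?Dg x b)) (at x)" if "x \<in> S" for x
  proof -
    have "((\<lambda>x. g (f x)) has_derivative (\<lambda>v. ?Dg x (?Df x v))) (at x)"
      by (rule has_derivative_compose[OF Ck_on_Suc_has_derivative[OF Suc.prems(2) that] G[OF that]])
    also have "(\<lambda>v. ?Dg x (?Df x v)) = (\<lambda>v. \<Sum>b\<in>B. representation B (?Df x v) b *\<^sub>R ?Dg x b)"
      using linear_basis_expand[OF B has_derivative_linear[OF G[OF that]]] by (intro ext)
    finally show ?thesis .
  qed
  have "Ck_on n S (\<lambda>x. \<Sum>b\<in>B. representation B (?Df x v) b *\<^sub>R ?Dg x b)" for v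
    by (rule Ck_on_sum[OF S(1) Ck_on_scaleR[OF S(1)
          Ck_on_linear[OF bounded_linear_representation[OF B] S(1) Ck_on_Suc_derivative[OF Suc.prems(2)]]
          Suc.IH[OF Ck_on_Suc_derivative[OF Suc.prems(1)] Ck_on_SucD[OF Suc.prems(2)]]]])
  from Ck_on_SucI[OF S(1) D this] show ?case .
qed

lemma smooth_on_Ck: "smooth_on S f \<Longrightarrow> Ck_on n S f"
  by (simp add: smooth_on_def)

lemma smooth_on_has_derivative:
  "smooth_on S f \<Longrightarrow> x \<in> S \<Longrightarrow> (f has_derivative frechet_derivative f (at x)) (at x)"
  by (rule Ck_on_Suc_has_derivative[OF smooth_on_Ck])

lemma smooth_on_derivative: "smooth_on S f \<Longrightarrow> smooth_on S (\<lambda>x. frechet_derivative f (at x) v)"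
  unfolding smooth_on_def by (rule allI, rule Ck_on_Suc_derivative) (erule spec)

lemma smooth_on_cong:
  assumes "open S" "\<And>x. x \<in> S \<Longrightarrow> f x = g x" "smooth_on S f"
  shows "smooth_on S g"
  unfolding smooth_on_def by (intro allI Ck_on_cong[OF assms(1,2) smooth_on_Ck[OF assms(3)]])

lemma smooth_on_second_symmetric:
  assumes "smooth_on S f" "open S" "x \<in> S"
  shows "frechet_derivative (\<lambda>y. frechet_derivative f (at y) v) (at x) u
       = frechet_derivative (\<lambda>y. frechet_derivative f (at y) u) (at x) v"
  using smooth_on_has_derivative[OF assms(1)]
  by (intro second_derivative_symmetric[OF assms(2,3) _
        smooth_on_has_derivative[OF smooth_on_derivative[OF assms(1)] assms(3)]
        smooth_on_has_derivative[OF smooth_on_derivative[OF assms(1)] assms(3)]])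
    (auto simp: differentiable_def)

lemma has_derivative_compose_fst:
  assumes "(f has_derivative f') (at (fst z))"
  shows "((\<lambda>z. f (fst z)) has_derivative (\<lambda>w. f' (fst w))) (at z)"
  using has_derivative_compose[OF has_derivative_fst[OF has_derivative_ident] assms] .

text \<open>Product rule for a Jacobian applied to a moving vector, as it arises when a vector field
  is rewritten in another chart. Expanding \<open>w\<close> in a basis reduces it to products of
  scalar functions with derivatives of \<open>T\<close> in fixed directions.\<close>

lemma has_derivative_derivative_apply:
  fixes B :: "'a::real_normed_vector set" and T :: "'a \<Rightarrow> 'b::real_normed_vector"
  assumes B: "is_basis B" and T: "smooth_on S T" "open S" "x0 \<in> S"
    and w: "(w has_derivative w') (at x0)"
  shows "((\<lambda>x. frechet_derivative T (at x) (w x)) has_derivative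
    (\<lambda>u. frechet_derivative T (at x0) (w' u) + frechet_derivative (\<lambda>x. frechet_derivative T (at x) (w x0)) (at x0) u)) (at x0)"
proof -
  let ?DT = "\<lambda>x. frechet_derivative T (at x)"
  let ?r = "\<lambda>v b. representation B v b"
  have lin: "linear (?DT x)" if "x \<in> S" for x
    by (rule has_derivative_linear[OF smooth_on_has_derivative[OF T(1) that]])
  have expand: "?DT x v = (\<Sum>b\<in>B. ?r v b *\<^sub>R ?DT x b)" if "x \<in> S" for x v
    by (rule linear_basis_expand[OF B lin[OF that]])
  have Db: "((\<lambda>x. ?DT x b) has_derivative frechet_derivative (\<lambda>x. ?DT x b) (at x0)) (at x0)" for b
    by (rule smooth_on_has_derivative[OF smooth_on_derivative[OF T(1)] T(3)])
  \<comment> \<open>With the coefficients of \<open>w\<close> frozen at \<open>x0\<close>, the sum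
    identifies one half of the product rule as the derivative of the Jacobian applied to the
    constant vector \<open>w x0\<close>.\<close>
  have "((\<lambda>x. \<Sum>b\<in>B. ?r (w x0) b *\<^sub>R ?DT x b) has_derivative
      (\<lambda>u. \<Sum>b\<in>B. ?r (w x0) b *\<^sub>R frechet_derivative (\<lambda>x. ?DT x b) (at x0) u)) (at x0)"
    by (intro has_derivative_sum has_derivative_scaleR_right Db)
  then have "((\<lambda>x. ?DT x (w x0)) has_derivative
      (\<lambda>u. \<Sum>b\<in>B. ?r (w x0) b *\<^sub>R frechet_derivative (\<lambda>x. ?DT x b) (at x0) u)) (at x0)"
    by (rule has_derivative_transform_within_open[OF _ T(2,3)]) (simp add: expand)
  from frechet_derivative_eq[OF this]
  have 1: "(\<Sum>b\<in>B. ?r (w x0) b *\<^sub>R frechet_derivative (\<lambda>x. ?DT x b) (at x0) u)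
      = frechet_derivative (\<lambda>x. ?DT x (w x0)) (at x0) u" for u by simp
  have "((\<lambda>x. \<Sum>b\<in>B. ?r (w x) b *\<^sub>R ?DT x b) has_derivative
      (\<lambda>u. \<Sum>b\<in>B. ?r (w x0) b *\<^sub>R frechet_derivative (\<lambda>x. ?DT x b) (at x0) u + ?r (w' u) b *\<^sub>R ?DT x0 b)) (at x0)"
    by (intro has_derivative_sum has_derivative_scaleR Db
        bounded_linear.has_derivative[OF bounded_linear_representation[OF B] w])
  then have "((\<lambda>x. ?DT x (w x)) has_derivative
      (\<lambda>u. \<Sum>b\<in>B. ?r (w x0) b *\<^sub>R frechet_derivative (\<lambda>x. ?DT x b) (at x0) u + ?r (w' u) b *\<^sub>R ?DT x0 b)) (at x0)"
    by (rule has_derivative_transform_within_open[OF _ T(2,3)]) (simp add: expand)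
  then show ?thesis
    by (simp add: sum.distrib 1 add.commute flip: expand[OF T(3)])
qed

lemma smooth_on_affine:
  assumes "bounded_linear L" "open S" "\<And>x. x \<in> S \<Longrightarrow> L x + a \<in> T" "smooth_on T f"
  shows "smooth_on S (\<lambda>x. f (L x + a))"
  unfolding smooth_on_def by (intro allI Ck_on_affine[OF assms(1-3) smooth_on_Ck[OF assms(4)]])


section \<open>Differentials in charts\<close>

definition local_rep :: "('a, 'e) chart \<Rightarrow> ('b, 'f) chart \<Rightarrow> ('a \<Rightarrow> 'b) \<Rightarrow> 'e \<Rightarrow> 'f" where
  "local_rep c d f = (\<lambda>x. snd d (f (chart_inv c x)))"

definition local_deriv ::
  "('a, 'e::real_normed_vector) chart \<Rightarrow> ('b, 'f::real_normed_vector) chart \<Rightarrow> ('a \<Rightarrow> 'b) \<Rightarrow> 'a \<Rightarrow> 'e \<Rightarrow> 'f" where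
  "local_deriv c d f p = frechet_derivative (local_rep c d f) (at (snd c p))"

definition local_dom :: "('a, 'e) chart \<Rightarrow> ('b, 'f) chart \<Rightarrow> ('a \<Rightarrow> 'b) \<Rightarrow> 'e set" where
  "local_dom c d f = snd c ` {q \<in> fst c. f q \<in> fst d}"

text \<open>
  The weak notion of atlas that suffices for the tangent spaces to be well behaved; it is easier to
  establish for the cotangent atlas than smoothness.
\<close>

definition diff_atlas :: "('a, 'e::real_normed_vector) chart set \<Rightarrow> bool" where
  "diff_atlas A \<longleftrightarrow> (\<forall>c\<in>A. inj_on (snd c) (fst c) \<and>
     (\<forall>d\<in>A. open (local_dom c d (\<lambda>p. p)) \<and>
       (\<forall>x\<in>local_dom c d (\<lambda>p. p). local_rep c d (\<lambda>p. p) differentiable (at x))))"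

text \<open>The inner neighbourhood is required because \<open>local_rep\<close> takes meaningless
  values where \<open>f\<close> leaves the domain of \<open>d\<close>. On that neighbourhood the
  coordinate expression describes \<open>f\<close>, so that chain rules can be carried out.\<close>

definition diff_map ::
  "('a, 'e::real_normed_vector) chart set \<Rightarrow> ('b, 'f::real_normed_vector) chart set \<Rightarrow> ('a \<Rightarrow> 'b) \<Rightarrow> 'a \<Rightarrow> bool" where
  "diff_map A B f p \<longleftrightarrow> p \<in> points A \<and> f p \<in> points B \<and>
     (\<forall>c\<in>charts_at A p. \<forall>d\<in>charts_at B (f p).
        (\<exists>S. open S \<and> snd c p \<in> S \<and> S \<subseteq> local_dom c d f) \<and> local_rep c d f differentiable (at (snd c p)))"

lemma charts_at_iff: "c \<in> charts_at A p \<longleftrightarrow> c \<in> A \<and> p \<in> fst c"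
  by (simp add: charts_at_def)

lemma charts_at_points: "c \<in> charts_at A p \<Longrightarrow> p \<in> points A"
  by (auto simp: charts_at_def points_def)

lemma chart_at_in: "p \<in> points A \<Longrightarrow> chart_at A p \<in> charts_at A p"
  unfolding chart_at_def by (rule someI_ex) (auto simp: charts_at_def points_def)

lemma chart_inv_chart: "diff_atlas A \<Longrightarrow> c \<in> A \<Longrightarrow> p \<in> fst c \<Longrightarrow> chart_inv c (snd c p) = p"
  by (simp add: chart_inv_def diff_atlas_def)

lemma chart_chart_inv: "x \<in> snd c ` fst c \<Longrightarrow> snd c (chart_inv c x) = x"
  by (simp add: chart_inv_def f_inv_into_f)

lemma chart_inv_in: "x \<in> snd c ` fst c \<Longrightarrow> chart_inv c x \<in> fst c"
  by (simp add: chart_inv_def inv_into_into)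

lemma local_domD:
  assumes "diff_atlas A" "c \<in> A" "x \<in> local_dom c d f"
  shows "x \<in> snd c ` fst c" "chart_inv c x \<in> fst c" "snd c (chart_inv c x) = x" "f (chart_inv c x) \<in> fst d"
  using assms chart_inv_chart[OF assms(1,2)] by (auto simp: local_dom_def)

lemma local_domI: "q \<in> fst c \<Longrightarrow> f q \<in> fst d \<Longrightarrow> snd c q \<in> local_dom c d f"
  by (auto simp: local_dom_def)

lemma local_rep_chart:
  "diff_atlas A \<Longrightarrow> c \<in> A \<Longrightarrow> q \<in> fst c \<Longrightarrow> local_rep c d f (snd c q) = snd d (f q)"
  by (simp add: local_rep_def chart_inv_chart)

lemma open_chart_image:
  assumes "diff_atlas A" "c \<in> A"
  shows "open (snd c ` fst c)"
proof -
  have "open (local_dom c c (\<lambda>p. p))" using assms by (auto simp: diff_atlas_def)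
  then show ?thesis by (simp add: local_dom_def)
qed

lemma diff_map_id:
  assumes A: "diff_atlas A" and p: "p \<in> points A"
  shows "diff_map A A (\<lambda>p. p) p"
  unfolding diff_map_def
proof (intro conjI ballI p)
  fix c d assume c: "c \<in> charts_at A p" and d: "d \<in> charts_at A p"
  then have "snd c p \<in> local_dom c d (\<lambda>p. p)" by (auto simp: charts_at_iff local_dom_def)
  then show "\<exists>S. open S \<and> snd c p \<in> S \<and> S \<subseteq> local_dom c d (\<lambda>p. p)"
    and "local_rep c d (\<lambda>p. p) differentiable (at (snd c p))"
    using A c d by (auto simp: diff_atlas_def charts_at_iff)
qed

lemma diff_map_has_derivative:
  assumes "diff_map A B f p" "c \<in> charts_at A p" "d \<in> charts_at B (f p)"
  shows "(local_rep c d f has_derivative local_deriv c d f p) (at (snd c p))"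
proof -
  have "local_rep c d f differentiable (at (snd c p))" using assms by (simp add: diff_map_def)
  then show ?thesis using frechet_derivative_works unfolding local_deriv_def by blast
qed

lemma linear_local_deriv:
  assumes "diff_map A B f p" "c \<in> charts_at A p" "d \<in> charts_at B (f p)"
  shows "linear (local_deriv c d f p)"
  by (rule has_derivative_linear[OF diff_map_has_derivative[OF assms]])

text \<open>The composite enters as a separate map \<open>h\<close> that agrees with it on the
  domain of \<open>c\<close>. Group identities, which hold on the carrier, can thus be used to
  simplify the composite.\<close>

lemma local_deriv_compose:
  assumes A: "diff_atlas A" "diff_atlas B" and f: "diff_map A B f p" and g: "diff_map B C g (f p)"
    and c: "c \<in> charts_at A p" and d: "d \<in> charts_at B (f p)" and e: "e \<in> charts_at C (g (f p))"
    and h: "\<And>q. q \<in> fst c \<Longrightarrow> h q = g (f q)"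
  shows "local_deriv c e h p v = local_deriv d e g (f p) (local_deriv c d f p v)"
proof -
  obtain S where S: "open S" "snd c p \<in> S" "S \<subseteq> local_dom c d f"
    using f c d unfolding diff_map_def by blast
  have p: "c \<in> A" "p \<in> fst c" "d \<in> B" using c d by (auto simp: charts_at_iff)
  have "(local_rep d e g has_derivative local_deriv d e g (f p)) (at (local_rep c d f (snd c p)))"
    using diff_map_has_derivative[OF g d e] by (simp add: local_rep_chart[OF A(1) p(1,2)])
  from has_derivative_compose[OF diff_map_has_derivative[OF f c d] this]
  have "((\<lambda>x. local_rep d e g (local_rep c d f x)) has_derivative
      (\<lambda>v. local_deriv d e g (f p) (local_deriv c d f p v))) (at (snd c p))" .
  moreover have "local_rep d e g (local_rep c d f x) = local_rep c e h x" if "x \<in> S" for x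
    using local_domD[OF A(1) p(1) subsetD[OF S(3) that]] chart_inv_chart[OF A(2) p(3)] h
    by (simp add: local_rep_def)
  ultimately have "(local_rep c e h has_derivative
      (\<lambda>v. local_deriv d e g (f p) (local_deriv c d f p v))) (at (snd c p))"
    using has_derivative_transform_within_open[OF _ S(1,2)] by blast
  then show ?thesis by (simp add: local_deriv_def frechet_derivative_eq)
qed

lemma local_deriv_id:
  assumes A: "diff_atlas A" and c: "c \<in> charts_at A p" and h: "\<And>q. q \<in> fst c \<Longrightarrow> h q = q"
  shows "local_deriv c c h p v = v"
proof -
  have "frechet_derivative (local_rep c c h) (at (snd c p)) = frechet_derivative (\<lambda>x. x) (at (snd c p))"
    using c h open_chart_image[OF A]
    by (intro frechet_derivative_cong_open[of "snd c ` fst c"])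
      (auto simp: charts_at_iff local_rep_def chart_chart_inv chart_inv_in)
  then show ?thesis by (simp add: local_deriv_def)
qed

section \<open>Tangent vectors and differentials in coordinates\<close>

lemma tangent_space_iff:
  "v \<in> tangent_space A p \<longleftrightarrow> (\<forall>c. c \<notin> charts_at A p \<longrightarrow> v c = 0) \<and>
     (\<forall>c\<in>charts_at A p. \<forall>d\<in>charts_at A p. v d = local_deriv c d (\<lambda>p. p) p (v c))"
  by (simp add: tangent_space_def local_deriv_def local_rep_def o_def)

lemma tangentD:
  assumes "v \<in> tangent_space A p" "c \<in> charts_at A p" "d \<in> charts_at A p"
  shows "v d = local_deriv c d (\<lambda>p. p) p (v c)"
  using assms unfolding tangent_space_iff by blast

lemma tangent_outside: "v \<in> tangent_space A p \<Longrightarrow> c \<notin> charts_at A p \<Longrightarrow> v c = 0"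
  unfolding tangent_space_iff by blast

lemma tangentI:
  assumes "\<And>c. c \<notin> charts_at A p \<Longrightarrow> v c = 0"
    and "\<And>c d. c \<in> charts_at A p \<Longrightarrow> d \<in> charts_at A p \<Longrightarrow> local_deriv c d (\<lambda>p. p) p (v c) = v d"
  shows "v \<in> tangent_space A p"
  unfolding tangent_space_iff using assms by simp

lemma tangent_eqI:
  assumes "v \<in> tangent_space A p" "w \<in> tangent_space A p" "c \<in> charts_at A p" "v c = w c"
  shows "v = w"
proof
  fix d show "v d = w d"
    using assms tangentD[OF assms(1,3), of d] tangentD[OF assms(2,3), of d]
    by (cases "d \<in> charts_at A p") (simp_all add: tangent_outside[OF assms(1)] tangent_outside[OF assms(2)])
qed

lemma coord_vector_eq:
  "coord_vector A c p u = (\<lambda>d. if d \<in> charts_at A p then local_deriv c d (\<lambda>p. p) p u else 0)"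
  by (intro ext) (simp add: coord_vector_def local_deriv_def local_rep_def o_def)

lemma differential_eq:
  "differential A B f p v =
     (\<lambda>d. if d \<in> charts_at B (f p) then local_deriv (chart_at A p) d f p (v (chart_at A p)) else 0)"
  by (intro ext) (simp add: differential_def local_deriv_def local_rep_def o_def Let_def)

context
  fixes A :: "('a, 'e::real_normed_vector) chart set"
  assumes A: "diff_atlas A"
begin

lemma local_deriv_transition_linear:
  assumes "c \<in> charts_at A p" "d \<in> charts_at A p"
  shows "linear (local_deriv c d (\<lambda>p. p) p)"
  by (rule linear_local_deriv[OF diff_map_id[OF A charts_at_points[OF assms(1)]] assms])

lemma coord_vector_in:
  assumes c: "c \<in> charts_at A p"
  shows "coord_vector A c p u \<in> tangent_space A p"
proof -
  have i: "diff_map A A (\<lambda>p. p) p" using diff_map_id[OF A] charts_at_points[OF c] by blast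
  have "local_deriv d e (\<lambda>p. p) p (local_deriv c d (\<lambda>p. p) p u) = local_deriv c e (\<lambda>p. p) p u"
    if "d \<in> charts_at A p" "e \<in> charts_at A p" for d e
    by (rule local_deriv_compose[OF A A i i c that, symmetric]) simp
  then show ?thesis
    by (intro tangentI) (simp_all add: coord_vector_eq)
qed

lemma coord_vector_self: "c \<in> charts_at A p \<Longrightarrow> coord_vector A c p u c = u"
  by (simp add: coord_vector_eq local_deriv_id[OF A])

lemma coord_vector_tangent:
  assumes "v \<in> tangent_space A p" "c \<in> charts_at A p"
  shows "coord_vector A c p (v c) = v"
  by (rule tangent_eqI[OF coord_vector_in[OF assms(2)] assms coord_vector_self[OF assms(2)]])

lemma tangent_add:
  assumes "u \<in> tangent_space A p" "v \<in> tangent_space A p"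
  shows "(\<lambda>c. u c + v c) \<in> tangent_space A p"
  by (rule tangentI)
    (simp_all add: linear_add[OF local_deriv_transition_linear] tangent_outside[OF assms(1)]
      tangent_outside[OF assms(2)] tangentD[OF assms(1), symmetric] tangentD[OF assms(2), symmetric])

lemma tangent_scale:
  assumes "v \<in> tangent_space A p"
  shows "(\<lambda>c. r *\<^sub>R v c) \<in> tangent_space A p"
  by (rule tangentI)
    (simp_all add: linear_scale[OF local_deriv_transition_linear] tangent_outside[OF assms] tangentD[OF assms, symmetric])

lemma coord_vector_add:
  assumes "c \<in> charts_at A p"
  shows "coord_vector A c p (u + v) = (\<lambda>d. coord_vector A c p u d + coord_vector A c p v d)"
  using assms by (auto simp: coord_vector_eq linear_add[OF local_deriv_transition_linear])

lemma coord_vector_scale: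
  assumes "c \<in> charts_at A p"
  shows "coord_vector A c p (r *\<^sub>R u) = (\<lambda>d. r *\<^sub>R coord_vector A c p u d)"
  using assms by (auto simp: coord_vector_eq linear_scale[OF local_deriv_transition_linear])

text \<open>\<open>differential\<close> is evaluated in the chart picked by \<open>chart_at\<close>.
  Passing to another chart composes with the Jacobian of a transition map, which is exactly how the
  components of \<open>v\<close> change.\<close>

lemma differential_apply:
  assumes f: "diff_map A B f p" and v: "v \<in> tangent_space A p"
    and c: "c \<in> charts_at A p" and d: "d \<in> charts_at B (f p)"
  shows "differential A B f p v d = local_deriv c d f p (v c)"
proof -
  have p: "p \<in> points A" by (rule charts_at_points[OF c])
  let ?c = "chart_at A p"
  have c': "?c \<in> charts_at A p" by (rule chart_at_in[OF p])
  have "local_deriv c d f p (v c) = local_deriv ?c d f p (local_deriv c ?c (\<lambda>p. p) p (v c))"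
    by (rule local_deriv_compose[OF A A diff_map_id[OF A p] f c c' d]) simp
  then show ?thesis using d tangentD[OF v c c'] by (simp add: differential_eq)
qed

lemma differential_in:
  assumes B: "diff_atlas B" and f: "diff_map A B f p" and v: "v \<in> tangent_space A p"
  shows "differential A B f p v \<in> tangent_space B (f p)"
proof -
  have p: "p \<in> points A" "f p \<in> points B" using f by (auto simp: diff_map_def)
  let ?c = "chart_at A p"
  have c: "?c \<in> charts_at A p" by (rule chart_at_in[OF p(1)])
  have "local_deriv d e (\<lambda>p. p) (f p) (local_deriv ?c d f p u) = local_deriv ?c e f p u"
    if "d \<in> charts_at B (f p)" "e \<in> charts_at B (f p)" for d e u
    by (rule local_deriv_compose[OF A B f diff_map_id[OF B p(2)] c that, symmetric]) simp
  then show ?thesis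
    by (intro tangentI) (simp_all add: differential_eq)
qed

lemma differential_compose:
  assumes B: "diff_atlas B" and f: "diff_map A B f p" and g: "diff_map B C g (f p)"
    and v: "v \<in> tangent_space A p" and h: "\<And>q. q \<in> points A \<Longrightarrow> h q = g (f q)"
  shows "differential B C g (f p) (differential A B f p v) = differential A C h p v"
proof
  fix e
  have p: "p \<in> points A" "f p \<in> points B" using f by (auto simp: diff_map_def)
  let ?c = "chart_at A p" and ?d = "chart_at B (f p)"
  have c: "?c \<in> charts_at A p" and d: "?d \<in> charts_at B (f p)" by (simp_all add: chart_at_in p)
  have "\<And>q. q \<in> fst ?c \<Longrightarrow> h q = g (f q)"
    using h c by (auto simp: charts_at_iff points_def)
  from local_deriv_compose[OF A B f g c d _ this]
  show "differential B C g (f p) (differential A B f p v) e = differential A C h p v e"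
    using d h[OF p(1)] by (simp add: differential_eq)
qed

lemma differential_identity:
  assumes p: "p \<in> points A" and v: "v \<in> tangent_space A p" and h: "\<And>q. q \<in> points A \<Longrightarrow> h q = q"
  shows "differential A A h p v = v"
proof
  fix e
  let ?c = "chart_at A p"
  have c: "?c \<in> charts_at A p" by (simp add: chart_at_in p)
  have "\<And>q. q \<in> fst ?c \<Longrightarrow> h q = q" using h c by (auto simp: charts_at_iff points_def)
  then have "local_deriv ?c e h p (v ?c) = v e" if e: "e \<in> charts_at A p"
    using local_deriv_compose[OF A A diff_map_id[OF A p] diff_map_id[OF A p] c c e, of h]
      tangentD[OF v c e] local_deriv_id[OF A c] by simp
  then show "differential A A h p v e = v e"
    using h[OF p] by (simp add: differential_eq tangent_outside[OF v])
qed

lemma differential_add: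
  assumes "diff_map A B f p"
  shows "differential A B f p (\<lambda>c. u c + v c) = (\<lambda>d. differential A B f p u d + differential A B f p v d)"
proof -
  have "p \<in> points A" using assms by (auto simp: diff_map_def)
  then show ?thesis
    using linear_add[OF linear_local_deriv[OF assms chart_at_in]] by (auto simp: differential_eq)
qed

lemma differential_scale:
  assumes "diff_map A B f p"
  shows "differential A B f p (\<lambda>c. r *\<^sub>R v c) = (\<lambda>d. r *\<^sub>R differential A B f p v d)"
proof -
  have "p \<in> points A" using assms by (auto simp: diff_map_def)
  then show ?thesis
    using linear_scale[OF linear_local_deriv[OF assms chart_at_in]] by (auto simp: differential_eq)
qed

end

lemma smooth_atlas_diff:
  assumes "smooth_atlas A"
  shows "diff_atlas A"
  unfolding diff_atlas_def
proof (intro ballI conjI)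
  fix c d assume cd: "c \<in> A" "d \<in> A"
  have 1: "inj_on (snd c) (fst c)" "open (local_dom c d (\<lambda>p. p))"
    "smooth_on (local_dom c d (\<lambda>p. p)) (local_rep c d (\<lambda>p. p))"
    using assms cd by (simp_all add: smooth_atlas_def local_dom_def local_rep_def o_def Int_def)
  then show "inj_on (snd c) (fst c)" "open (local_dom c d (\<lambda>p. p))" by simp_all
  fix x assume "x \<in> local_dom c d (\<lambda>p. p)"
  then show "local_rep c d (\<lambda>p. p) differentiable (at x)"
    using smooth_on_has_derivative[OF 1(3)] unfolding differentiable_def by blast
qed

lemma smooth_map_local:
  assumes "smooth_map A B f" "c \<in> A" "d \<in> B"
  shows "open (local_dom c d f)" "smooth_on (local_dom c d f) (local_rep c d f)"
  using assms by (auto simp: smooth_map_def local_dom_def local_rep_def o_def)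

lemma smooth_map_points: "smooth_map A B f \<Longrightarrow> p \<in> points A \<Longrightarrow> f p \<in> points B"
  by (auto simp: smooth_map_def)

lemma smooth_map_diff:
  assumes f: "smooth_map A B f" and p: "p \<in> points A"
  shows "diff_map A B f p"
  unfolding diff_map_def
proof (intro conjI ballI p smooth_map_points[OF f p])
  fix c d assume "c \<in> charts_at A p" "d \<in> charts_at B (f p)"
  then have c: "c \<in> A" "d \<in> B" "snd c p \<in> local_dom c d f"
    by (auto simp: charts_at_iff local_domI)
  then show "\<exists>S. open S \<and> snd c p \<in> S \<and> S \<subseteq> local_dom c d f"
    using smooth_map_local[OF f] by blast
  show "local_rep c d f differentiable (at (snd c p))"
    using smooth_on_has_derivative[OF smooth_map_local(2)[OF f c(1,2)] c(3)] by (auto simp: differentiable_def)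
qed

lemma smooth_map_ident:
  assumes "smooth_atlas A"
  shows "smooth_map A A (\<lambda>p. p)"
  using assms by (auto simp: smooth_map_def smooth_atlas_def Int_def o_def)

section \<open>The cotangent bundle\<close>

lemma cotangentI:
  assumes "\<And>v. v \<notin> tangent_space A p \<Longrightarrow> \<xi> v = 0"
    and "\<And>u v. u \<in> tangent_space A p \<Longrightarrow> v \<in> tangent_space A p \<Longrightarrow> \<xi> (\<lambda>c. u c + v c) = \<xi> u + \<xi> v"
    and "\<And>r v. v \<in> tangent_space A p \<Longrightarrow> \<xi> (\<lambda>c. r *\<^sub>R v c) = r * \<xi> v"
  shows "\<xi> \<in> cotangent_space A p"
  using assms by (auto simp: cotangent_space_def)

lemma cotangentD:
  assumes "\<xi> \<in> cotangent_space A p"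
  shows "v \<notin> tangent_space A p \<Longrightarrow> \<xi> v = 0"
    and "u \<in> tangent_space A p \<Longrightarrow> v \<in> tangent_space A p \<Longrightarrow> \<xi> (\<lambda>c. u c + v c) = \<xi> u + \<xi> v"
    and "v \<in> tangent_space A p \<Longrightarrow> \<xi> (\<lambda>c. r *\<^sub>R v c) = r * \<xi> v"
  using assms by (auto simp: cotangent_space_def)

lemma cotangent_eqI:
  assumes "\<xi> \<in> cotangent_space A p" "\<eta> \<in> cotangent_space A p"
    and "\<And>v. v \<in> tangent_space A p \<Longrightarrow> \<xi> v = \<eta> v"
  shows "\<xi> = \<eta>"
proof
  fix v show "\<xi> v = \<eta> v"
    using assms(3) cotangentD(1)[OF assms(1), of v] cotangentD(1)[OF assms(2), of v]
    by (cases "v \<in> tangent_space A p") auto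
qed

text \<open>Inverse of a bundle chart on the fibre over \<open>p\<close>. The value 0 off the
  tangent space follows the convention of \<open>cotangent_space\<close>.\<close>

definition coord_covector ::
  "('a, 'e::real_normed_vector) chart set \<Rightarrow> ('a, 'e) chart \<Rightarrow> 'a \<Rightarrow> ('e \<Rightarrow>\<^sub>L real) \<Rightarrow> ('a, 'e) covector" where
  "coord_covector A c p l = (\<lambda>v. if v \<in> tangent_space A p then l (v c) else 0)"

definition model_basis :: "'e::real_vector set" where
  "model_basis = (SOME B. is_basis B)"

locale manifold_atlas =
  fixes A :: "('a, 'e::real_normed_vector) chart set"
  assumes mfd: "smooth_manifold A"
begin

lemma smooth: "smooth_atlas A"
  using mfd by (simp add: smooth_manifold_def)

lemma diff: "diff_atlas A"
  by (rule smooth_atlas_diff[OF smooth])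

lemma basis: "is_basis (model_basis :: 'e set)"
proof -
  obtain C :: "'e set" where "finite C" "span C = UNIV"
    using mfd by (auto simp: smooth_manifold_def)
  then obtain B :: "'e set" where "is_basis B" by (rule is_basis_exists)
  then show ?thesis unfolding model_basis_def by (rule someI)
qed

lemma coord_covector_in:
  assumes "c \<in> charts_at A p"
  shows "coord_covector A c p l \<in> cotangent_space A p"
  using tangent_add[OF diff] tangent_scale[OF diff]
  by (intro cotangentI) (auto simp: coord_covector_def blinfun.add_right blinfun.scaleR_right)

lemma coord_covector_coord_vector:
  "c \<in> charts_at A p \<Longrightarrow> coord_covector A c p l (coord_vector A c p u) = l u"
  by (simp add: coord_covector_def coord_vector_in[OF diff] coord_vector_self[OF diff])

lemma covector_coord_linear:
  assumes c: "c \<in> charts_at A p" and "\<xi> \<in> cotangent_space A p"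
  shows "linear (\<lambda>u. \<xi> (coord_vector A c p u))"
  by (intro linearI)
    (simp_all add: coord_vector_add[OF diff c] coord_vector_scale[OF diff c]
      cotangentD[OF assms(2)] coord_vector_in[OF diff c])

lemma covector_coord_bounded:
  assumes c: "c \<in> charts_at A p" and "\<xi> \<in> cotangent_space A p"
  shows "bounded_linear (\<lambda>u. \<xi> (coord_vector A c p u))"
  by (rule bounded_linear_finite_dim[OF basis covector_coord_linear[OF assms]])

section \<open>Bundle charts and cotangent lifts in coordinates\<close>

lemma cotangent_chart_snd:
  "snd (cotangent_chart A c) (p, \<xi>) = (snd c p, Blinfun (\<lambda>u. \<xi> (coord_vector A c p u)))"
  by (simp add: cotangent_chart_def)

lemma cotangent_chart_apply:
  assumes c: "c \<in> charts_at A p" and "\<xi> \<in> cotangent_space A p"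
  shows "snd (snd (cotangent_chart A c) (p, \<xi>)) u = \<xi> (coord_vector A c p u)"
  by (simp add: cotangent_chart_snd bounded_linear_Blinfun_apply covector_coord_bounded[OF assms])

lemma cotangent_chart_dom:
  "c \<in> A \<Longrightarrow> (p, \<xi>) \<in> fst (cotangent_chart A c) \<longleftrightarrow> p \<in> fst c \<and> \<xi> \<in> cotangent_space A p"
  by (auto simp: cotangent_chart_def cotangent_bundle_def points_def)

lemma coord_covector_tangent:
  assumes c: "c \<in> charts_at A p" and \<xi>: "\<xi> \<in> cotangent_space A p"
  shows "coord_covector A c p (snd (snd (cotangent_chart A c) (p, \<xi>))) = \<xi>"
proof (rule cotangent_eqI[OF coord_covector_in[OF c] \<xi>])
  fix v assume "v \<in> tangent_space A p"
  then show "coord_covector A c p (snd (snd (cotangent_chart A c) (p, \<xi>))) v = \<xi> v"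
    by (simp add: coord_covector_def cotangent_chart_apply[OF c \<xi>] coord_vector_tangent[OF diff _ c])
qed

lemma cotangent_chart_coord_covector:
  assumes c: "c \<in> charts_at A p"
  shows "snd (cotangent_chart A c) (p, coord_covector A c p l) = (snd c p, l)"
  by (intro prod_eqI blinfun_eqI)
    (simp_all add: cotangent_chart_apply[OF c coord_covector_in[OF c]] coord_covector_coord_vector[OF c],
      simp add: cotangent_chart_snd)

lemma cotangent_chart_inj:
  assumes c: "c \<in> A"
  shows "inj_on (snd (cotangent_chart A c)) (fst (cotangent_chart A c))"
proof (rule inj_onI; clarify)
  fix p \<xi> q \<eta>
  assume p: "(p, \<xi>) \<in> fst (cotangent_chart A c)" and q: "(q, \<eta>) \<in> fst (cotangent_chart A c)"
    and eq: "snd (cotangent_chart A c) (p, \<xi>) = snd (cotangent_chart A c) (q, \<eta>)"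
  have cp: "c \<in> charts_at A p" "\<xi> \<in> cotangent_space A p" and cq: "c \<in> charts_at A q" "\<eta> \<in> cotangent_space A q"
    using p q c by (simp_all add: cotangent_chart_dom charts_at_iff)
  have "snd c p = snd c q" using eq by (simp add: cotangent_chart_snd)
  then have "chart_inv c (snd c p) = chart_inv c (snd c q)" by simp
  then have "p = q" using cp cq by (simp add: chart_inv_chart[OF diff] charts_at_iff)
  moreover have "coord_covector A c p (snd (snd (cotangent_chart A c) (p, \<xi>)))
      = coord_covector A c q (snd (snd (cotangent_chart A c) (q, \<eta>)))"
    by (simp only: eq, simp only: \<open>p = q\<close>)
  then have "\<xi> = \<eta>"
    by (simp only: coord_covector_tangent[OF cp] coord_covector_tangent[OF cq])
  ultimately show "p = q \<and> \<xi> = \<eta>" by simp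
qed

lemma cotangent_chart_image:
  assumes c: "c \<in> A" and q: "q \<in> fst c"
  shows "(snd c q, l) \<in> snd (cotangent_chart A c) ` fst (cotangent_chart A c)"
    and "chart_inv (cotangent_chart A c) (snd c q, l) = (q, coord_covector A c q l)"
proof -
  have cq: "c \<in> charts_at A q" using c q by (simp add: charts_at_iff)
  have 1: "(q, coord_covector A c q l) \<in> fst (cotangent_chart A c)"
    using c q coord_covector_in[OF cq] by (simp add: cotangent_chart_dom)
  have 2: "snd (cotangent_chart A c) (q, coord_covector A c q l) = (snd c q, l)"
    by (rule cotangent_chart_coord_covector[OF cq])
  show "(snd c q, l) \<in> snd (cotangent_chart A c) ` fst (cotangent_chart A c)"
    using imageI[OF 1, of "snd (cotangent_chart A c)"] by (simp only: 2)
  show "chart_inv (cotangent_chart A c) (snd c q, l) = (q, coord_covector A c q l)"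
    unfolding chart_inv_def
    using inv_into_f_f[OF cotangent_chart_inj[OF c] 1] by (simp only: 2)
qed

text \<open>
  The cotangent lift of a diffeomorphism composed with the fibre translation by a one-form \<open>\<kappa>\<close>
  changes the canonical symplectic form by \<open>d\<kappa>\<close>. The derivative of the second component is
  obtained by differentiating \<open>\<Lambda>(x, l)(D\<phi>(x) v) = l v + \<kappa>(x) v\<close> for fixed \<open>v\<close>; the second
  derivative of \<open>\<phi>\<close> that appears is symmetric and cancels.
\<close>

lemma cotangent_lift_has_derivative:
  fixes \<Phi> :: "'a \<times> ('a, 'e) covector \<Rightarrow> 'a \<times> ('a, 'e) covector" and K :: "'e \<Rightarrow> 'e \<Rightarrow>\<^sub>L real"
  assumes f: "smooth_map A A f" and f': "smooth_map A A f'"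
    and inv: "\<And>p. p \<in> points A \<Longrightarrow> f' (f p) = p" "\<And>p. p \<in> points A \<Longrightarrow> f (f' p) = p"
    and c: "c \<in> charts_at A p0" and d: "d \<in> charts_at A (f p0)"
    and \<Phi>: "\<And>p \<xi>. p \<in> points A \<Longrightarrow> \<xi> \<in> cotangent_space A p \<Longrightarrow>
      fst (\<Phi> (p, \<xi>)) = f p \<and> snd (\<Phi> (p, \<xi>)) \<in> cotangent_space A (f p) \<and>
      (\<forall>v\<in>tangent_space A p. snd (\<Phi> (p, \<xi>)) (differential A A f p v) = \<xi> v + \<kappa> p v)"
    and K: "(K has_derivative K') (at (snd c p0))"
      "\<And>p u. p \<in> fst c \<Longrightarrow> K (snd c p) u = \<kappa> p (coord_vector A c p u)"
    and \<xi>0: "\<xi>0 \<in> cotangent_space A p0"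
  obtains D where
    "(local_rep (cotangent_chart A c) (cotangent_chart A d) \<Phi> has_derivative D) (at (snd (cotangent_chart A c) (p0, \<xi>0)))"
    "\<And>w. fst (D w) = local_deriv c d f p0 (fst w)"
    "\<And>w z. blinfun_apply (snd (D w)) (fst (D z)) - blinfun_apply (snd (D z)) (fst (D w)) =
       blinfun_apply (snd w) (fst z) - blinfun_apply (snd z) (fst w) + K' (fst w) (fst z) - K' (fst z) (fst w)"
proof -
  let ?c = "cotangent_chart A c" and ?d = "cotangent_chart A d"
  let ?F = "local_rep ?c ?d \<Phi>"
  define \<phi> where "\<phi> = local_rep c d f"
  define \<psi> where "\<psi> = local_rep d c f'"
  define S where "S = local_dom c d f"
  define S' where "S' = local_dom d c f'"
  define x0 where "x0 = snd c p0"
  define l0 where "l0 = snd (snd ?c (p0, \<xi>0))"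
  have cA: "c \<in> A" "p0 \<in> fst c" "d \<in> A" "f p0 \<in> fst d" using c d by (auto simp: charts_at_iff)
  have z0: "snd ?c (p0, \<xi>0) = (x0, l0)" by (simp add: x0_def l0_def cotangent_chart_snd)
  have \<phi>: "open S" "smooth_on S \<phi>" using smooth_map_local[OF f cA(1,3)] by (simp_all add: S_def \<phi>_def)
  have \<psi>: "open S'" "smooth_on S' \<psi>" using smooth_map_local[OF f' cA(3,1)] by (simp_all add: S'_def \<psi>_def)
  have x0: "x0 \<in> S" using cA by (simp add: x0_def S_def local_domI)
  have in_S: "\<exists>p\<in>points A. x = snd c p \<and> p \<in> fst c \<and> f p \<in> fst d" if "x \<in> S" for x
    using that cA(1) by (auto simp: S_def local_dom_def points_def)
  have \<phi>S: "\<phi> (snd c p) = snd d (f p)" if "p \<in> fst c" for p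
    using that cA by (simp add: \<phi>_def local_rep_chart[OF diff])
  have \<phi>x: "\<phi> x \<in> S'" if x: "x \<in> S" for x
  proof -
    obtain p where p: "p \<in> points A" "x = snd c p" "p \<in> fst c" "f p \<in> fst d" using in_S[OF x] by blast
    then have "snd d (f p) \<in> S'" unfolding S'_def using inv(1)[OF p(1)] by (intro local_domI) auto
    then show ?thesis using \<phi>S p by simp
  qed
  let ?D\<phi> = "\<lambda>x. frechet_derivative \<phi> (at x)" and ?D\<psi> = "\<lambda>x. frechet_derivative \<psi> (at x)"
  \<comment> \<open>Since \<open>f\<close> undoes \<open>f'\<close>, the Jacobian of
    \<open>\<psi>\<close> is a right inverse of that of \<open>\<phi>\<close>. Every basis vector is
    thus the image, under the Jacobian of \<open>\<phi>\<close>, of a vector that is known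
    explicitly.\<close>
  have cancel: "?D\<phi> x (?D\<psi> (\<phi> x) w) = w" if x: "x \<in> S" for x w
  proof -
    obtain p where p: "p \<in> points A" "x = snd c p" "p \<in> fst c" "f p \<in> fst d" using in_S[OF x] by blast
    have cp: "c \<in> charts_at A p" and dp: "d \<in> charts_at A (f p)" using p cA by (auto simp: charts_at_iff)
    have fp: "f p \<in> points A" by (rule smooth_map_points[OF f p(1)])
    have "diff_map A A f (f' (f p))" using smooth_map_diff[OF f p(1)] inv(1)[OF p(1)] by simp
    from local_deriv_compose[OF diff diff smooth_map_diff[OF f' fp] this dp, of c d "\<lambda>q. q"]
    have "local_deriv d d (\<lambda>q. q) (f p) w = local_deriv c d f p (local_deriv d c f' (f p) w)"
      using cp dp inv p cA by (fastforce simp: points_def)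
    then have "local_deriv c d f p (local_deriv d c f' (f p) w) = w"
      using local_deriv_id[OF diff dp] by simp
    then show ?thesis using p(2) \<phi>S[OF p(3)] by (simp add: local_deriv_def \<phi>_def \<psi>_def)
  qed
  \<comment> \<open>In charts, the hypothesis on \<open>\<Phi>\<close> describes its second
    component implicitly, through the values on images under the Jacobian of
    \<open>\<phi>\<close>.\<close>
  have F1: "fst (?F (x, l)) = \<phi> x" and F2: "snd (?F (x, l)) (?D\<phi> x u) = l u + K x u"
    if x: "x \<in> S" for x l u
  proof -
    obtain p where p: "p \<in> points A" "x = snd c p" "p \<in> fst c" "f p \<in> fst d" using in_S[OF x] by blast
    have cp: "c \<in> charts_at A p" and dp: "d \<in> charts_at A (f p)" using p cA by (auto simp: charts_at_iff)
    let ?\<xi> = "coord_covector A c p l"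
    have \<Phi>p: "fst (\<Phi> (p, ?\<xi>)) = f p" "snd (\<Phi> (p, ?\<xi>)) \<in> cotangent_space A (f p)"
      "\<And>v. v \<in> tangent_space A p \<Longrightarrow> snd (\<Phi> (p, ?\<xi>)) (differential A A f p v) = ?\<xi> v + \<kappa> p v"
      using \<Phi>[OF p(1) coord_covector_in[OF cp]] by blast+
    have F: "?F (x, l) = snd ?d (f p, snd (\<Phi> (p, ?\<xi>)))"
      using \<Phi>p(1) cotangent_chart_image(2)[OF cA(1) p(3)] p(2)
      by (simp add: local_rep_def prod_eq_iff[of "\<Phi> (p, ?\<xi>)"] flip: \<Phi>p(1))
    then show "fst (?F (x, l)) = \<phi> x" using \<phi>S p by (simp add: cotangent_chart_snd)
    let ?v = "coord_vector A c p u"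
    have v: "?v \<in> tangent_space A p" by (rule coord_vector_in[OF diff cp])
    have dm: "diff_map A A f p" by (rule smooth_map_diff[OF f p(1)])
    have "differential A A f p ?v d = local_deriv c d f p u"
      using differential_apply[OF diff dm v cp dp] by (simp add: coord_vector_self[OF diff cp])
    then have "coord_vector A d (f p) (?D\<phi> x u) = differential A A f p ?v"
      using coord_vector_tangent[OF diff differential_in[OF diff diff dm v] dp] p(2)
      by (simp add: local_deriv_def \<phi>_def)
    then show "snd (?F (x, l)) (?D\<phi> x u) = l u + K x u"
      using \<Phi>p(3)[OF v] K(2)[OF p(3)] p(2)
      by (simp add: F[unfolded p(2)] cotangent_chart_apply[OF dp \<Phi>p(2)] coord_covector_coord_vector[OF cp])
  qed
  \<comment> \<open>Evaluating \<open>F2\<close> at the preimage \<open>m b x\<close> of the basis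
    vector \<open>b\<close> gives the coefficient \<open>G b\<close> explicitly. This makes the
    second component differentiable, which has to be known before \<open>F2\<close> itself can be
    differentiated.\<close>
  define m where "m b x = ?D\<psi> (\<phi> x) b" for b x
  define G where "G b z = blinfun_apply (snd z) (m b (fst z)) + K (fst z) (m b (fst z))"
    for b and z :: "'e \<times> ('e \<Rightarrow>\<^sub>L real)"
  have F_expand: "?F z = (\<phi> (fst z), \<Sum>b\<in>model_basis. G b z *\<^sub>R dual_basis model_basis b)"
    if z: "z \<in> S \<times> UNIV" for z
  proof -
    obtain x l where z': "z = (x, l)" "x \<in> S" using z by auto
    have "snd (?F (x, l)) b = G b z" for b
      using F2[OF z'(2), of l "m b x"] cancel[OF z'(2), of b] by (simp add: G_def m_def z'(1))
    then show ?thesis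
      using blinfun_dual_expand[OF basis, of "snd (?F (x, l))"] F1[OF z'(2), of l]
      by (simp add: z'(1) prod_eq_iff)
  qed
  have D\<phi>: "(\<phi> has_derivative ?D\<phi> x0) (at x0)" by (rule smooth_on_has_derivative[OF \<phi>(2) x0])
  have "G b differentiable (at (x0, l0))" for b
  proof -
    have "(m b has_derivative (\<lambda>u. frechet_derivative (\<lambda>y. ?D\<psi> y b) (at (\<phi> x0)) (?D\<phi> x0 u))) (at x0)"
      unfolding m_def
      by (rule has_derivative_compose[OF D\<phi> smooth_on_has_derivative[OF smooth_on_derivative[OF \<psi>(2)] \<phi>x[OF x0]]])
    then obtain m' where m': "(m b has_derivative m') (at x0)" by blast
    have 1: "((\<lambda>z. m b (fst z)) has_derivative (\<lambda>w. m' (fst w))) (at (x0, l0))"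
      by (rule has_derivative_compose_fst) (simp add: m')
    have 2: "((\<lambda>z. K (fst z)) has_derivative (\<lambda>w. K' (fst w))) (at (x0, l0))"
      by (rule has_derivative_compose_fst) (use K(1) in \<open>simp add: x0_def\<close>)
    have "(G b has_derivative (\<lambda>w :: 'e \<times> ('e \<Rightarrow>\<^sub>L real). (l0 (m' (fst w)) + blinfun_apply (snd w) (m b x0)) + (K x0 (m' (fst w)) + K' (fst w) (m b x0)))) (at (x0, l0))"
      unfolding G_def
      using has_derivative_add[OF blinfun.FDERIV[OF has_derivative_snd[OF has_derivative_ident] 1] blinfun.FDERIV[OF 2 1]]
      by simp
    then show ?thesis by (auto simp: differentiable_def)
  qed
  then obtain G' where G': "\<And>b. (G b has_derivative G' b) (at (x0, l0))"
    unfolding differentiable_def by metis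
  have D\<phi>z: "((\<lambda>z. \<phi> (fst z)) has_derivative (\<lambda>w. ?D\<phi> x0 (fst w))) (at (x0, l0))"
    by (rule has_derivative_compose_fst) (simp add: D\<phi>)
  define D where "D w = (?D\<phi> x0 (fst w), \<Sum>b\<in>model_basis. G' b w *\<^sub>R dual_basis model_basis b)" for w
  have S_open: "open (S \<times> (UNIV :: ('e \<Rightarrow>\<^sub>L real) set))" "(x0, l0) \<in> S \<times> UNIV"
    using \<phi>(1) x0 by (auto intro: open_Times)
  have "((\<lambda>z. (\<phi> (fst z), \<Sum>b\<in>model_basis. G b z *\<^sub>R dual_basis model_basis b)) has_derivative D) (at (x0, l0))"
    unfolding D_def
    by (intro has_derivative_Pair D\<phi>z has_derivative_sum has_derivative_scaleR_left G')
  then have D: "(?F has_derivative D) (at (x0, l0))"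
    using has_derivative_transform_within_open[OF _ S_open] F_expand by (metis (no_types, lifting))
  define Q where "Q u v = frechet_derivative (\<lambda>y. ?D\<phi> y v) (at x0) u" for u v
  define \<Lambda>0 where "\<Lambda>0 = snd (?F (x0, l0))"
  have key: "\<Lambda>0 (Q (fst w) v) + blinfun_apply (snd (D w)) (?D\<phi> x0 v) = blinfun_apply (snd w) v + K' (fst w) v"
    for v and w :: "'e \<times> ('e \<Rightarrow>\<^sub>L real)"
  proof -
    have 1: "((\<lambda>z. ?D\<phi> (fst z) v) has_derivative (\<lambda>w. Q (fst w) v)) (at (x0, l0))"
      using has_derivative_compose_fst[of _ _ "(x0, l0)", simplified,
          OF smooth_on_has_derivative[OF smooth_on_derivative[OF \<phi>(2)] x0, of v]]
      by (simp add: Q_def)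
    have 2: "((\<lambda>z :: 'e \<times> ('e \<Rightarrow>\<^sub>L real). blinfun_apply (snd (?F z)) (?D\<phi> (fst z) v)) has_derivative
        (\<lambda>w :: 'e \<times> ('e \<Rightarrow>\<^sub>L real). \<Lambda>0 (Q (fst w) v) + blinfun_apply (snd (D w)) (?D\<phi> x0 v))) (at (x0, l0))"
      using blinfun.FDERIV[OF has_derivative_snd[OF D] 1] by (simp add: \<Lambda>0_def)
    have 3: "((\<lambda>z. K (fst z)) has_derivative (\<lambda>w. K' (fst w))) (at (x0, l0))"
      by (rule has_derivative_compose_fst) (use K(1) in \<open>simp add: x0_def\<close>)
    have 4: "((\<lambda>z :: 'e \<times> ('e \<Rightarrow>\<^sub>L real). blinfun_apply (snd z) v + K (fst z) v) has_derivative (\<lambda>w :: 'e \<times> ('e \<Rightarrow>\<^sub>L real). blinfun_apply (snd w) v + K' (fst w) v)) (at (x0, l0))"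
      using has_derivative_add[OF blinfun.FDERIV[OF has_derivative_snd[OF has_derivative_ident] has_derivative_const]
          blinfun.FDERIV[OF 3 has_derivative_const]] by (simp add: blinfun.zero_right)
    have "((\<lambda>z :: 'e \<times> ('e \<Rightarrow>\<^sub>L real). blinfun_apply (snd (?F z)) (?D\<phi> (fst z) v)) has_derivative (\<lambda>w :: 'e \<times> ('e \<Rightarrow>\<^sub>L real). blinfun_apply (snd w) v + K' (fst w) v)) (at (x0, l0))"
      by (rule has_derivative_transform_within_open[OF 4 S_open]) (use F2 in auto)
    from has_derivative_unique[OF 2 this] show ?thesis by meson
  qed
  have sym: "Q u v = Q v u" for u v
    unfolding Q_def by (rule smooth_on_second_symmetric[OF \<phi>(2,1) x0])
  show thesis
  proof (rule that[of D])
    show "(?F has_derivative D) (at (snd ?c (p0, \<xi>0)))" using D by (simp add: z0)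
    show "fst (D w) = local_deriv c d f p0 (fst w)" for w
      by (simp add: D_def local_deriv_def \<phi>_def x0_def)
    show "blinfun_apply (snd (D w)) (fst (D z)) - blinfun_apply (snd (D z)) (fst (D w)) =
       blinfun_apply (snd w) (fst z) - blinfun_apply (snd z) (fst w) + K' (fst w) (fst z) - K' (fst z) (fst w)" for w z
    proof -
      have "fst (D w) = ?D\<phi> x0 (fst w)" "fst (D z) = ?D\<phi> x0 (fst z)" by (simp_all add: D_def)
      then show ?thesis
        using key[of w "fst z"] key[of z "fst w"] sym[of "fst w" "fst z"] by simp
    qed
  qed
qed

end

text \<open>The values are bounded functionals rather than functions, so that the product rule for
  \<open>blinfun_apply\<close> differentiates a form applied to a moving vector.\<close>

definition coord_form :: "('a, 'e::real_normed_vector) chart set \<Rightarrow> ('a, 'e) chart \<Rightarrow> ('a, 'e) oneform \<Rightarrow> 'e \<Rightarrow> 'e \<Rightarrow>\<^sub>L real" where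
  "coord_form A c \<kappa> x = Blinfun (\<lambda>u. \<kappa> (chart_inv c x) (coord_vector A c (chart_inv c x) u))"

text \<open>The value at (x, y) minus the value at (y, x) is d\<kappa>(x, y) in the chart
  \<open>c\<close>, so symmetry of this derivative means that d\<kappa> vanishes at
  \<open>p\<close>.\<close>

definition coord_form_deriv :: "('a, 'e::real_normed_vector) chart set \<Rightarrow> ('a, 'e) chart \<Rightarrow> ('a, 'e) oneform \<Rightarrow> 'a \<Rightarrow> 'e \<Rightarrow> 'e \<Rightarrow>\<^sub>L real" where
  "coord_form_deriv A c \<kappa> p = frechet_derivative (coord_form A c \<kappa>) (at (snd c p))"

context manifold_atlas
begin

lemma coord_form_apply:
  assumes c: "c \<in> charts_at A p" and "\<kappa> p \<in> cotangent_space A p"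
  shows "coord_form A c \<kappa> (snd c p) u = \<kappa> p (coord_vector A c p u)"
  using c chart_inv_chart[OF diff, of c p]
  by (simp add: coord_form_def bounded_linear_Blinfun_apply covector_coord_bounded[OF assms] charts_at_iff)

section \<open>The cotangent atlas and the canonical forms in coordinates\<close>

lemma points_cotangent: "points (cotangent_atlas A) = cotangent_bundle A"
  by (auto simp: points_def cotangent_atlas_def cotangent_chart_dom cotangent_bundle_def cotangent_chart_def)

lemma charts_at_cotangent:
  assumes "\<xi> \<in> cotangent_space A p"
  shows "charts_at (cotangent_atlas A) (p, \<xi>) = cotangent_chart A ` charts_at A p"
proof (intro equalityI subsetI)
  fix C assume "C \<in> charts_at (cotangent_atlas A) (p, \<xi>)"
  then obtain c where c: "c \<in> A" "C = cotangent_chart A c" "(p, \<xi>) \<in> fst (cotangent_chart A c)"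
    unfolding charts_at_iff cotangent_atlas_def by blast
  then show "C \<in> cotangent_chart A ` charts_at A p"
    using cotangent_chart_dom[OF c(1)] by (simp add: charts_at_iff)
next
  fix C assume "C \<in> cotangent_chart A ` charts_at A p"
  then obtain c where c: "c \<in> A" "p \<in> fst c" "C = cotangent_chart A c" unfolding charts_at_def by blast
  then show "C \<in> charts_at (cotangent_atlas A) (p, \<xi>)"
    using cotangent_chart_dom[OF c(1)] assms by (simp add: charts_at_iff cotangent_atlas_def)
qed

lemma zero_in_cotangent: "(\<lambda>v. 0) \<in> cotangent_space A p"
  by (simp add: cotangent_space_def)

text \<open>A transition map of bundle charts is the cotangent lift of the identity, without fibre
  translation, read in two charts. This gives the differentiability demanded by
  \<open>diff_atlas\<close>.\<close>

lemma cotangent_transition: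
  assumes c: "c \<in> charts_at A p" and d: "d \<in> charts_at A p" and \<xi>: "\<xi> \<in> cotangent_space A p"
  obtains D where
    "(local_rep (cotangent_chart A c) (cotangent_chart A d) (\<lambda>a. a) has_derivative D)
      (at (snd (cotangent_chart A c) (p, \<xi>)))"
    "\<And>w. fst (D w) = local_deriv c d (\<lambda>p. p) p (fst w)"
proof (rule cotangent_lift_has_derivative[where \<Phi> = "\<lambda>a. a" and \<kappa> = "\<lambda>p v. 0" and K = "\<lambda>x. 0" and K' = "\<lambda>u. 0",
      OF smooth_map_ident[OF smooth] smooth_map_ident[OF smooth] _ _ c d _ _ _ \<xi>])
  show "fst (p, \<xi>) = p \<and> snd (p, \<xi>) \<in> cotangent_space A p \<and>
      (\<forall>v\<in>tangent_space A p. snd (p, \<xi>) (differential A A (\<lambda>p. p) p v) = \<xi> v + 0)"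
    if "p \<in> points A" "\<xi> \<in> cotangent_space A p" for p \<xi>
    using that differential_identity[OF diff that(1), of _ "\<lambda>p. p"] by simp
qed (use that in auto)

lemma local_dom_cotangent:
  assumes c: "c \<in> A" and d: "d \<in> A"
  shows "local_dom (cotangent_chart A c) (cotangent_chart A d) (\<lambda>a. a) = local_dom c d (\<lambda>p. p) \<times> UNIV"
proof (intro equalityI subsetI)
  fix z assume "z \<in> local_dom (cotangent_chart A c) (cotangent_chart A d) (\<lambda>a. a)"
  then show "z \<in> local_dom c d (\<lambda>p. p) \<times> UNIV"
    using c d by (auto simp: local_dom_def cotangent_chart_dom cotangent_chart_snd)
next
  fix z :: "'e \<times> ('e \<Rightarrow>\<^sub>L real)"
  assume "z \<in> local_dom c d (\<lambda>p. p) \<times> UNIV"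
  then obtain p l where p: "p \<in> fst c" "p \<in> fst d" "z = (snd c p, l)" by (auto simp: local_dom_def)
  then have cp: "c \<in> charts_at A p" using c by (simp add: charts_at_iff)
  have "snd (cotangent_chart A c) (p, coord_covector A c p l)
      \<in> local_dom (cotangent_chart A c) (cotangent_chart A d) (\<lambda>a. a)"
    using p c d coord_covector_in[OF cp] by (intro local_domI) (simp_all add: cotangent_chart_dom)
  then show "z \<in> local_dom (cotangent_chart A c) (cotangent_chart A d) (\<lambda>a. a)"
    by (simp add: cotangent_chart_coord_covector[OF cp] p(3))
qed

lemma diff_cotangent: "diff_atlas (cotangent_atlas A)"
  unfolding diff_atlas_def
proof (intro ballI conjI)
  fix C E assume "C \<in> cotangent_atlas A" "E \<in> cotangent_atlas A"
  then obtain c e where c: "C = cotangent_chart A c" "c \<in> A" and e: "E = cotangent_chart A e" "e \<in> A"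
    by (auto simp: cotangent_atlas_def)
  have "open (local_dom c e (\<lambda>p. p))" using smooth_map_local[OF smooth_map_ident[OF smooth] c(2) e(2)] by simp
  then show "open (local_dom C E (\<lambda>a. a))"
    by (simp add: c(1) e(1) local_dom_cotangent[OF c(2) e(2)] open_Times)
  fix z assume "z \<in> local_dom C E (\<lambda>a. a)"
  then obtain p \<xi> where p: "z = snd C (p, \<xi>)" "(p, \<xi>) \<in> fst C" "(p, \<xi>) \<in> fst E"
    by (auto simp: local_dom_def)
  then have "c \<in> charts_at A p" "e \<in> charts_at A p" "\<xi> \<in> cotangent_space A p"
    using c e by (auto simp: cotangent_chart_dom charts_at_iff)
  from cotangent_transition[OF this] show "local_rep C E (\<lambda>a. a) differentiable (at z)"
    unfolding p(1) c(1) e(1) differentiable_def by blast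
qed (auto simp: cotangent_atlas_def cotangent_chart_inj)

lemma projection_has_derivative:
  assumes c: "c \<in> charts_at A p" and d: "d \<in> charts_at A p" and \<xi>: "\<xi> \<in> cotangent_space A p"
  shows "(local_rep (cotangent_chart A c) d fst has_derivative (\<lambda>w. local_deriv c d (\<lambda>p. p) p (fst w)))
      (at (snd (cotangent_chart A c) (p, \<xi>)))"
proof -
  let ?z = "snd (cotangent_chart A c) (p, \<xi>)"
  let ?S = "local_dom c d (\<lambda>p. p) \<times> (UNIV :: ('e \<Rightarrow>\<^sub>L real) set)"
  have cd: "c \<in> A" "p \<in> fst c" "d \<in> A" "p \<in> fst d" using c d by (auto simp: charts_at_iff)
  have S: "open ?S" "?z \<in> ?S"
    using smooth_map_local[OF smooth_map_ident[OF smooth] cd(1,3)] cd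
    by (auto simp: open_Times cotangent_chart_snd local_domI)
  have "(local_rep c d (\<lambda>p. p) has_derivative local_deriv c d (\<lambda>p. p) p) (at (fst ?z))"
    using diff_map_has_derivative[OF diff_map_id[OF diff charts_at_points[OF c]] c d]
    by (simp add: cotangent_chart_snd)
  from has_derivative_compose_fst[OF this] show ?thesis
  proof (rule has_derivative_transform_within_open[OF _ S])
    fix z assume "z \<in> ?S"
    then obtain q l where q: "q \<in> fst c" "z = (snd c q, l)" by (auto simp: local_dom_def)
    then show "local_rep c d (\<lambda>p. p) (fst z) = local_rep (cotangent_chart A c) d fst z"
      using cotangent_chart_image(2)[OF cd(1) q(1), of l] chart_inv_chart[OF diff cd(1) q(1)]
      by (simp add: local_rep_def)
  qed
qed

lemma diff_map_projection:
  assumes "\<xi> \<in> cotangent_space A p" and p: "p \<in> points A"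
  shows "diff_map (cotangent_atlas A) A fst (p, \<xi>)"
  unfolding diff_map_def
proof (intro conjI ballI)
  show "(p, \<xi>) \<in> points (cotangent_atlas A)" using assms by (simp add: points_cotangent cotangent_bundle_def)
  show "fst (p, \<xi>) \<in> points A" using p by simp
  fix C d assume C: "C \<in> charts_at (cotangent_atlas A) (p, \<xi>)" and d: "d \<in> charts_at A (fst (p, \<xi>))"
  obtain c where c: "C = cotangent_chart A c" "c \<in> charts_at A p"
    using C charts_at_cotangent[OF assms(1)] by auto
  have d: "d \<in> charts_at A p" using d by simp
  show "local_rep C d fst differentiable (at (snd C (p, \<xi>)))"
    using projection_has_derivative[OF c(2) d assms(1)] by (auto simp: differentiable_def c(1))
  have cd: "c \<in> A" "p \<in> fst c" "d \<in> A" "p \<in> fst d" using c d by (auto simp: charts_at_iff)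
  let ?S = "local_dom c d (\<lambda>p. p) \<times> (UNIV :: ('e \<Rightarrow>\<^sub>L real) set)"
  have "open ?S" "snd C (p, \<xi>) \<in> ?S"
    using smooth_map_local[OF smooth_map_ident[OF smooth] cd(1,3)] cd
    by (auto simp: open_Times cotangent_chart_snd local_domI c(1))
  moreover have "?S \<subseteq> local_dom C d fst"
  proof
    fix z assume "z \<in> ?S"
    then obtain q l where q: "q \<in> fst c" "q \<in> fst d" "z = (snd c q, l)" by (auto simp: local_dom_def)
    then have cq: "c \<in> charts_at A q" using cd by (simp add: charts_at_iff)
    have "snd C (q, coord_covector A c q l) \<in> local_dom C d fst"
      using q coord_covector_in[OF cq] cd by (intro local_domI) (simp_all add: c(1) cotangent_chart_dom)
    then show "z \<in> local_dom C d fst" by (simp add: c(1) cotangent_chart_coord_covector[OF cq] q(3))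
  qed
  ultimately show "\<exists>S. open S \<and> snd C (p, \<xi>) \<in> S \<and> S \<subseteq> local_dom C d fst"
    by (intro exI[of _ ?S] conjI)
qed

text \<open>This is the formula p dq: the projection sends a tangent vector of the bundle to its
  base component, to which the covector is applied.\<close>

lemma canonical_one_form_coord:
  assumes c: "c \<in> charts_at A p" and \<xi>: "\<xi> \<in> cotangent_space A p"
  shows "canonical_one_form A (p, \<xi>) (coord_vector (cotangent_atlas A) (cotangent_chart A c) (p, \<xi>) w)
    = \<xi> (coord_vector A c p (fst w))"
proof -
  let ?C = "cotangent_chart A c"
  let ?W = "coord_vector (cotangent_atlas A) ?C (p, \<xi>) w"
  have p: "p \<in> points A" by (rule charts_at_points[OF c])
  have C: "?C \<in> charts_at (cotangent_atlas A) (p, \<xi>)" using c charts_at_cotangent[OF \<xi>] by auto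
  have W: "?W \<in> tangent_space (cotangent_atlas A) (p, \<xi>)" by (rule coord_vector_in[OF diff_cotangent C])
  have "differential (cotangent_atlas A) A fst (p, \<xi>) ?W = coord_vector A c p (fst w)"
  proof (rule tangent_eqI[OF _ coord_vector_in[OF diff c] c])
    show "differential (cotangent_atlas A) A fst (p, \<xi>) ?W \<in> tangent_space A p"
      using differential_in[OF diff_cotangent diff diff_map_projection[OF \<xi> p] W] by simp
    have "differential (cotangent_atlas A) A fst (p, \<xi>) ?W c = local_deriv ?C c fst (p, \<xi>) w"
      using differential_apply[OF diff_cotangent diff_map_projection[OF \<xi> p] W C, of c] c
      by (simp add: coord_vector_self[OF diff_cotangent C])
    also have "\<dots> = local_deriv c c (\<lambda>p. p) p (fst w)"
      using frechet_derivative_eq[OF projection_has_derivative[OF c c \<xi>]] by (simp add: local_deriv_def)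
    also have "\<dots> = coord_vector A c p (fst w) c"
      using c by (simp add: coord_vector_self[OF diff c] local_deriv_id[OF diff c])
    finally show "differential (cotangent_atlas A) A fst (p, \<xi>) ?W c = coord_vector A c p (fst w) c" .
  qed
  then show ?thesis using W p \<xi> by (simp add: canonical_one_form_def cotangent_bundle_def)
qed

text \<open>The coefficients of p dq are linear in the bundle coordinates, so their derivatives are
  constant and the exterior derivative is dp wedge dq. The chart is the one returned by
  \<open>chart_at\<close>, in which \<open>exterior_derivative\<close> is evaluated.\<close>

lemma canonical_symplectic_form_coord:
  assumes \<xi>: "\<xi> \<in> cotangent_space A p" and c: "c \<in> charts_at A p"
    and C: "chart_at (cotangent_atlas A) (p, \<xi>) = cotangent_chart A c"
  shows "canonical_symplectic_form A (p, \<xi>) u v =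
    blinfun_apply (snd (u (cotangent_chart A c))) (fst (v (cotangent_chart A c)))
    - blinfun_apply (snd (v (cotangent_chart A c))) (fst (u (cotangent_chart A c)))"
proof -
  let ?C = "cotangent_chart A c"
  let ?S = "snd c ` fst c \<times> (UNIV :: ('e \<Rightarrow>\<^sub>L real) set)"
  let ?z = "snd ?C (p, \<xi>)"
  have cA: "c \<in> A" "p \<in> fst c" using c by (auto simp: charts_at_iff)
  have S: "open ?S" "?z \<in> ?S"
    using open_chart_image[OF diff cA(1)] cA(2) by (auto simp: open_Times cotangent_chart_snd)
  have "((\<lambda>x. canonical_one_form A (chart_inv ?C x) (coord_vector (cotangent_atlas A) ?C (chart_inv ?C x) w))
      has_derivative (\<lambda>z. blinfun_apply (snd z) (fst w))) (at ?z)" for w :: "'e \<times> ('e \<Rightarrow>\<^sub>L real)"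
  proof (rule has_derivative_transform_within_open[OF _ S])
    show "((\<lambda>z. blinfun_apply (snd z) (fst w)) has_derivative (\<lambda>z. blinfun_apply (snd z) (fst w))) (at ?z)"
      by (rule bounded_linear_imp_has_derivative)
        (rule bounded_linear_compose[OF blinfun.bounded_linear_left bounded_linear_snd])
    fix z assume "z \<in> ?S"
    then obtain q l where q: "q \<in> fst c" "z = (snd c q, l)" by auto
    then have cq: "c \<in> charts_at A q" using cA by (simp add: charts_at_iff)
    show "blinfun_apply (snd z) (fst w)
      = canonical_one_form A (chart_inv ?C z) (coord_vector (cotangent_atlas A) ?C (chart_inv ?C z) w)"
      using cotangent_chart_image(2)[OF cA(1) q(1), of l]
      by (simp add: q(2) canonical_one_form_coord[OF cq coord_covector_in[OF cq]] coord_covector_coord_vector[OF cq])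
  qed
  from frechet_derivative_eq[OF this] show ?thesis
    by (simp add: canonical_symplectic_form_def exterior_derivative_def Let_def C)
qed

text \<open>The defect of invariance at a point is d\<kappa> on the base components of the two
  vectors, and these components are arbitrary. So invariance at \<open>(p, \<xi>)\<close> is
  closedness of \<kappa> at \<open>p\<close>, whatever \<xi> is. The chart is produced rather than
  given because the symplectic form is evaluated in the chart that \<open>chart_at\<close>
  selects.\<close>

lemma cotangent_lift_preserves_iff:
  fixes \<Phi> :: "'a \<times> ('a, 'e) covector \<Rightarrow> 'a \<times> ('a, 'e) covector" and \<kappa> :: "('a, 'e) oneform"
  assumes f: "smooth_map A A f" and f': "smooth_map A A f'"
    and inv: "\<And>p. p \<in> points A \<Longrightarrow> f' (f p) = p" "\<And>p. p \<in> points A \<Longrightarrow> f (f' p) = p"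
    and \<Phi>: "\<And>p \<xi>. p \<in> points A \<Longrightarrow> \<xi> \<in> cotangent_space A p \<Longrightarrow>
      fst (\<Phi> (p, \<xi>)) = f p \<and> snd (\<Phi> (p, \<xi>)) \<in> cotangent_space A (f p) \<and>
      (\<forall>v\<in>tangent_space A p. snd (\<Phi> (p, \<xi>)) (differential A A f p v) = \<xi> v + \<kappa> p v)"
    and \<kappa>: "\<And>p. p \<in> points A \<Longrightarrow> \<kappa> p \<in> cotangent_space A p"
      "\<And>p c. c \<in> charts_at A p \<Longrightarrow> coord_form A c \<kappa> differentiable (at (snd c p))"
    and \<xi>: "\<xi> \<in> cotangent_space A p" and p: "p \<in> points A"
  obtains c where "c \<in> charts_at A p"
    "(\<forall>u\<in>tangent_space (cotangent_atlas A) (p, \<xi>). \<forall>v\<in>tangent_space (cotangent_atlas A) (p, \<xi>).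
       canonical_symplectic_form A (\<Phi> (p, \<xi>))
         (differential (cotangent_atlas A) (cotangent_atlas A) \<Phi> (p, \<xi>) u)
         (differential (cotangent_atlas A) (cotangent_atlas A) \<Phi> (p, \<xi>) v)
       = canonical_symplectic_form A (p, \<xi>) u v)
     \<longleftrightarrow> (\<forall>x y. coord_form_deriv A c \<kappa> p x y = coord_form_deriv A c \<kappa> p y x)"
proof -
  let ?T = "cotangent_atlas A"
  have fp: "f p \<in> points A" by (rule smooth_map_points[OF f p])
  define \<eta> where "\<eta> = snd (\<Phi> (p, \<xi>))"
  have \<eta>: "\<Phi> (p, \<xi>) = (f p, \<eta>)" "\<eta> \<in> cotangent_space A (f p)"
    using \<Phi>[OF p \<xi>] by (simp_all add: \<eta>_def prod_eq_iff)
  have "(p, \<xi>) \<in> points ?T" "(f p, \<eta>) \<in> points ?T"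
    using p fp \<xi> \<eta>(2) by (simp_all add: points_cotangent cotangent_bundle_def)
  then have CD: "chart_at ?T (p, \<xi>) \<in> cotangent_chart A ` charts_at A p"
    "chart_at ?T (f p, \<eta>) \<in> cotangent_chart A ` charts_at A (f p)"
    using chart_at_in[of "(p, \<xi>)" ?T] chart_at_in[of "(f p, \<eta>)" ?T]
    by (simp_all add: charts_at_cotangent[OF \<xi>] charts_at_cotangent[OF \<eta>(2)])
  obtain c where c: "chart_at ?T (p, \<xi>) = cotangent_chart A c" "c \<in> charts_at A p" using CD(1) by (rule imageE)
  obtain d where d: "chart_at ?T (f p, \<eta>) = cotangent_chart A d" "d \<in> charts_at A (f p)" using CD(2) by (rule imageE)
  let ?C = "cotangent_chart A c" and ?D = "cotangent_chart A d"
  let ?K' = "coord_form_deriv A c \<kappa> p"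
  have C: "?C \<in> charts_at ?T (p, \<xi>)" and D: "?D \<in> charts_at ?T (f p, \<eta>)"
    using c(2) d(2) by (simp_all add: charts_at_cotangent[OF \<xi>] charts_at_cotangent[OF \<eta>(2)])
  have K: "(coord_form A c \<kappa> has_derivative ?K') (at (snd c p))"
    using \<kappa>(2)[OF c(2)] frechet_derivative_works unfolding coord_form_deriv_def by blast
  have K2: "coord_form A c \<kappa> (snd c q) u = \<kappa> q (coord_vector A c q u)" if "q \<in> fst c" for q u
  proof -
    have cq: "c \<in> charts_at A q" using c(2) that by (simp add: charts_at_iff)
    show ?thesis by (rule coord_form_apply[of c q \<kappa>, OF cq \<kappa>(1)[OF charts_at_points[OF cq]]])
  qed
  obtain L where L: "(local_rep ?C ?D \<Phi> has_derivative L) (at (snd ?C (p, \<xi>)))"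
    "\<And>w z. blinfun_apply (snd (L w)) (fst (L z)) - blinfun_apply (snd (L z)) (fst (L w)) =
       blinfun_apply (snd w) (fst z) - blinfun_apply (snd z) (fst w) + ?K' (fst w) (fst z) - ?K' (fst z) (fst w)"
  proof (rule cotangent_lift_has_derivative[where \<Phi> = \<Phi> and \<kappa> = \<kappa> and K = "coord_form A c \<kappa>" and K' = ?K',
        OF f f' _ _ c(2) d(2) _ K _ \<xi>])
    show "f' (f q) = q" "f (f' q) = q" if "q \<in> points A" for q using that by (rule inv)+
    show "fst (\<Phi> (q, \<zeta>)) = f q \<and> snd (\<Phi> (q, \<zeta>)) \<in> cotangent_space A (f q) \<and>
      (\<forall>v\<in>tangent_space A q. snd (\<Phi> (q, \<zeta>)) (differential A A f q v) = \<zeta> v + \<kappa> q v)"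
      if "q \<in> points A" "\<zeta> \<in> cotangent_space A q" for q \<zeta> using that by (rule \<Phi>)
    show "coord_form A c \<kappa> (snd c q) u = \<kappa> q (coord_vector A c q u)" if "q \<in> fst c" for q u
      using that by (rule K2)
  qed (rule that)
  have dL: "differential ?T ?T \<Phi> (p, \<xi>) u ?D = L (u ?C)" for u
    using D frechet_derivative_eq[OF L(1)] by (simp add: differential_eq c(1) \<eta>(1) local_deriv_def)
  have main: "canonical_symplectic_form A (\<Phi> (p, \<xi>)) (differential ?T ?T \<Phi> (p, \<xi>) u) (differential ?T ?T \<Phi> (p, \<xi>) v)
      = canonical_symplectic_form A (p, \<xi>) u v + ?K' (fst (u ?C)) (fst (v ?C)) - ?K' (fst (v ?C)) (fst (u ?C))" for u v
    unfolding \<eta>(1) canonical_symplectic_form_coord[OF \<xi> c(2,1)] canonical_symplectic_form_coord[OF \<eta>(2) d(2,1)]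
      dL[unfolded \<eta>(1)] by (rule L(2))
  have surj: "\<exists>u\<in>tangent_space ?T (p, \<xi>). fst (u ?C) = x" for x
    by (rule bexI[OF _ coord_vector_in[OF diff_cotangent C, of "(x, 0)"]])
      (simp add: coord_vector_self[OF diff_cotangent C])
  show thesis
  proof (rule that[OF c(2)])
    show "(\<forall>u\<in>tangent_space ?T (p, \<xi>). \<forall>v\<in>tangent_space ?T (p, \<xi>).
       canonical_symplectic_form A (\<Phi> (p, \<xi>)) (differential ?T ?T \<Phi> (p, \<xi>) u) (differential ?T ?T \<Phi> (p, \<xi>) v)
       = canonical_symplectic_form A (p, \<xi>) u v) \<longleftrightarrow> (\<forall>x y. ?K' x y = ?K' y x)"
      (is "?l \<longleftrightarrow> ?r")
    proof
      assume ?l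
      then have l: "?K' (fst (u ?C)) (fst (v ?C)) = ?K' (fst (v ?C)) (fst (u ?C))"
        if "u \<in> tangent_space ?T (p, \<xi>)" "v \<in> tangent_space ?T (p, \<xi>)" for u v
        using that main[of u v] by simp
      show ?r
      proof (intro allI)
        fix x y
        obtain u v where "u \<in> tangent_space ?T (p, \<xi>)" "fst (u ?C) = x" "v \<in> tangent_space ?T (p, \<xi>)" "fst (v ?C) = y"
          using surj[of x] surj[of y] by blast
        then show "?K' x y = ?K' y x" using l[of u v] by simp
      qed
    next
      assume r: ?r
      show ?l
      proof (intro ballI)
        fix u v show "canonical_symplectic_form A (\<Phi> (p, \<xi>)) (differential ?T ?T \<Phi> (p, \<xi>) u) (differential ?T ?T \<Phi> (p, \<xi>) v)
          = canonical_symplectic_form A (p, \<xi>) u v"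
          unfolding main[of u v] using r[rule_format, of "fst (u ?C)" "fst (v ?C)"] by simp
      qed
    qed
  qed
qed

text \<open>The second derivatives of the transition map cancel by symmetry.\<close>

lemma lie_bracket_tangent:
  assumes X: "X \<in> vector_fields A" and Y: "Y \<in> vector_fields A" and p: "p \<in> points A"
  shows "lie_bracket A X Y p \<in> tangent_space A p"
proof (rule tangentI)
  show "lie_bracket A X Y p c = 0" if "c \<notin> charts_at A p" for c
    using that by (simp add: lie_bracket_def)
next
  fix c d assume c: "c \<in> charts_at A p" and d: "d \<in> charts_at A p"
  have cd: "c \<in> A" "p \<in> fst c" "d \<in> A" "p \<in> fst d" using c d by (auto simp: charts_at_iff)
  define T where "T = local_rep c d (\<lambda>p. p)"
  define S where "S = local_dom c d (\<lambda>p. p)"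
  let ?x = "snd c p"
  have T: "smooth_on S T" "open S" "?x \<in> S"
    using smooth_map_local[OF smooth_map_ident[OF smooth] cd(1,3)] cd by (simp_all add: S_def T_def local_domI)
  have Tx: "T ?x = snd d p" using cd by (simp add: T_def local_rep_chart[OF diff])
  let ?DT = "\<lambda>x. frechet_derivative T (at x)"
  have DT: "?DT ?x = local_deriv c d (\<lambda>p. p) p" by (simp add: local_deriv_def T_def)
  have lin: "linear (?DT ?x)" by (rule has_derivative_linear[OF smooth_on_has_derivative[OF T(1,3)]])
  \<comment> \<open>The component of \<open>Y\<close> in \<open>d\<close> at the point
    \<open>T x\<close> is the Jacobian of \<open>T\<close> at \<open>x\<close> applied to the
    component in \<open>c\<close>. Both expressions are differentiated along \<open>X\<close>, one
    by the product rule (fact \<open>1\<close>), the other by the chain rule (fact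
    \<open>2\<close>).\<close>
  have *: "frechet_derivative (\<lambda>x. Y (chart_inv d x) d) (at (snd d p)) (X p d)
      = ?DT ?x (frechet_derivative (\<lambda>x. Y (chart_inv c x) c) (at ?x) (X p c))
        + frechet_derivative (\<lambda>x. ?DT x (Y p c)) (at ?x) (X p c)"
    if X: "X \<in> vector_fields A" and Y: "Y \<in> vector_fields A" for X Y
  proof -
    have sm: "smooth_on (snd e ` fst e) (\<lambda>x. Y (chart_inv e x) e)" if "e \<in> A" for e
      using Y that by (simp add: vector_fields_def)
    have De: "((\<lambda>x. Y (chart_inv e x) e) has_derivative frechet_derivative (\<lambda>x. Y (chart_inv e x) e) (at (snd e p))) (at (snd e p))"
      if "e \<in> A" "p \<in> fst e" for e
      using smooth_on_has_derivative[OF sm[OF that(1)]] that(2) by simp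
    have "((\<lambda>x. ?DT x (Y (chart_inv c x) c)) has_derivative
        (\<lambda>u. ?DT ?x (frechet_derivative (\<lambda>x. Y (chart_inv c x) c) (at ?x) u)
          + frechet_derivative (\<lambda>x. ?DT x (Y p c)) (at ?x) u)) (at ?x)"
      using has_derivative_derivative_apply[OF basis T De[OF cd(1,2)]] chart_inv_chart[OF diff cd(1,2)]
      by simp
    then have 1: "((\<lambda>x. Y (chart_inv d (T x)) d) has_derivative
        (\<lambda>u. ?DT ?x (frechet_derivative (\<lambda>x. Y (chart_inv c x) c) (at ?x) u)
          + frechet_derivative (\<lambda>x. ?DT x (Y p c)) (at ?x) u)) (at ?x)"
    proof (rule has_derivative_transform_within_open[OF _ T(2,3)])
      fix x assume "x \<in> S"
      then obtain q where q: "x = snd c q" "q \<in> fst c" "q \<in> fst d" by (auto simp: S_def local_dom_def)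
      then have "c \<in> charts_at A q" "d \<in> charts_at A q" using cd by (auto simp: charts_at_iff)
      moreover have "Y q \<in> tangent_space A q" using Y q cd by (auto simp: vector_fields_def points_def)
      ultimately have "Y q d = local_deriv c d (\<lambda>p. p) q (Y q c)" by (blast intro: tangentD)
      then show "?DT x (Y (chart_inv c x) c) = Y (chart_inv d (T x)) d"
        using q cd by (simp add: T_def local_deriv_def local_rep_chart[OF diff] chart_inv_chart[OF diff])
    qed
    have 2: "((\<lambda>x. Y (chart_inv d (T x)) d) has_derivative
        (\<lambda>u. frechet_derivative (\<lambda>x. Y (chart_inv d x) d) (at (snd d p)) (?DT ?x u))) (at ?x)"
      using De[OF cd(3,4)] Tx
      by (intro has_derivative_compose[OF smooth_on_has_derivative[OF T(1,3)]]) simp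
    have "X p d = ?DT ?x (X p c)"
      unfolding DT using X p by (intro tangentD[OF _ c d]) (simp add: vector_fields_def)
    then show ?thesis using has_derivative_unique[OF 2 1] by metis
  qed
  have "frechet_derivative (\<lambda>x. ?DT x (Y p c)) (at ?x) (X p c) = frechet_derivative (\<lambda>x. ?DT x (X p c)) (at ?x) (Y p c)"
    by (rule smooth_on_second_symmetric[OF T])
  then show "local_deriv c d (\<lambda>p. p) p (lie_bracket A X Y p c) = lie_bracket A X Y p d"
    using c d by (simp add: lie_bracket_def *[OF X Y] *[OF Y X] linear_diff[OF lin] flip: DT)
qed

end

section \<open>Left-invariant vector fields and one-forms\<close>

context lie_group
begin

sublocale manifold_atlas "atlas G"
  by (unfold_locales) (rule manifold)

abbreviation (input) A where "A \<equiv> atlas G"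

definition mult_dom :: "('a, 'e) chart \<Rightarrow> ('a, 'e) chart \<Rightarrow> ('a, 'e) chart \<Rightarrow> ('e \<times> 'e) set" where
  "mult_dom c d k = {z. fst z \<in> snd c ` fst c \<and> snd z \<in> snd d ` fst d \<and> chart_inv c (fst z) \<otimes> chart_inv d (snd z) \<in> fst k}"

definition mult_rep :: "('a, 'e) chart \<Rightarrow> ('a, 'e) chart \<Rightarrow> ('a, 'e) chart \<Rightarrow> 'e \<times> 'e \<Rightarrow> 'e" where
  "mult_rep c d k z = snd k (chart_inv c (fst z) \<otimes> chart_inv d (snd z))"

text \<open>\<open>chart_inv\<close> of the product chart is an inverse chosen for pairs.
  Injectivity makes it agree, on the domain, with the pair of inverses used in
  \<open>mult_rep\<close>.\<close>

lemma mult_smooth: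
  assumes c: "c \<in> A" and d: "d \<in> A" and k: "k \<in> A"
  shows "open (mult_dom c d k)" "smooth_on (mult_dom c d k) (mult_rep c d k)"
proof -
  define P where "P = (fst c \<times> fst d, \<lambda>(p, q). (snd c p, snd d q))"
  let ?m = "\<lambda>(g, h). g \<otimes> h"
  have P: "P \<in> product_atlas A A" using c d by (force simp: P_def product_atlas_def)
  have inj: "inj_on (snd P) (fst P)"
    using diff c d by (auto simp: diff_atlas_def P_def inj_on_def)
  have inv: "chart_inv P (snd c p, snd d q) = (p, q)" if "p \<in> fst c" "q \<in> fst d" for p q
    using inv_into_f_f[OF inj, of "(p, q)"] that by (simp add: chart_inv_def P_def)
  have dom: "local_dom P k ?m = mult_dom c d k"
    using chart_inv_chart[OF diff c] chart_inv_chart[OF diff d]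
    by (force simp: local_dom_def mult_dom_def P_def image_iff)
  show o: "open (mult_dom c d k)"
    using smooth_map_local(1)[OF smooth_mult P k] by (simp add: dom)
  show "smooth_on (mult_dom c d k) (mult_rep c d k)"
  proof (rule smooth_on_cong[OF o])
    show "smooth_on (mult_dom c d k) (local_rep P k ?m)"
      using smooth_map_local(2)[OF smooth_mult P k] by (simp add: dom)
    fix z assume "z \<in> mult_dom c d k"
    then obtain p q where "p \<in> fst c" "q \<in> fst d" "z = (snd c p, snd d q)"
      by (auto simp: mult_dom_def prod_eq_iff)
    then show "local_rep P k ?m z = mult_rep c d k z"
      using c d by (simp add: local_rep_def mult_rep_def inv chart_inv_chart[OF diff])
  qed
qed

lemma mult_domI:
  "c \<in> A \<Longrightarrow> d \<in> A \<Longrightarrow> p \<in> fst c \<Longrightarrow> q \<in> fst d \<Longrightarrow> p \<otimes> q \<in> fst k \<Longrightarrow> (snd c p, snd d q) \<in> mult_dom c d k"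
  by (simp add: mult_dom_def chart_inv_chart[OF diff])

lemma carrierI: "c \<in> charts_at A p \<Longrightarrow> p \<in> carrier G"
  unfolding carrier_eq by (rule charts_at_points)

text \<open>Left translation is multiplication with the first coordinate frozen, so it is smooth as
  a smooth map restricted along an affine embedding.\<close>

lemma left_smooth:
  assumes g: "g \<in> carrier G"
  shows "smooth_map A A (\<lambda>h. g \<otimes> h)"
  unfolding smooth_map_def
proof (intro conjI ballI)
  show "(\<lambda>h. g \<otimes> h) \<in> points A \<rightarrow> points A" using g by (auto simp flip: carrier_eq)
  fix c d assume c: "c \<in> A" and d: "d \<in> A"
  obtain k where k: "k \<in> A" "g \<in> fst k" using g by (auto simp: carrier_eq points_def)
  let ?S = "snd c ` {p \<in> fst c. g \<otimes> p \<in> fst d}"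
  have S: "?S = {y. (snd k g, y) \<in> mult_dom k c d}"
    using k c by (force simp: mult_dom_def chart_inv_chart[OF diff])
  have "open ((\<lambda>y. (snd k g, y)) -` mult_dom k c d)"
    by (rule open_vimage[OF mult_smooth(1)[OF k(1) c d]]) (intro continuous_intros)
  then show o: "open ?S" unfolding S by (simp add: vimage_def)
  have "smooth_on ?S (\<lambda>y. mult_rep k c d ((0, y) + (snd k g, 0)))"
    by (rule smooth_on_affine[OF _ o _ mult_smooth(2)[OF k(1) c d]])
      (use S in \<open>auto intro!: bounded_linear_Pair bounded_linear_zero bounded_linear_ident\<close>)
  then show "smooth_on ?S (snd d \<circ> (\<lambda>h. g \<otimes> h) \<circ> chart_inv c)"
    using chart_inv_chart[OF diff k] by (simp add: mult_rep_def o_def)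
qed

lemma left_diff: "g \<in> carrier G \<Longrightarrow> h \<in> carrier G \<Longrightarrow> diff_map A A (\<lambda>h. g \<otimes> h) h"
  by (rule smooth_map_diff[OF left_smooth]) (simp_all flip: carrier_eq)

text \<open>The differential of left translation becomes a partial derivative of multiplication
  whose base point records \<open>g\<close>. In this form its smooth dependence on \<open>g\<close>
  and on \<open>h\<close> is visible, which yields smoothness of invariant fields and forms.\<close>

lemma left_local_deriv:
  assumes k: "k \<in> charts_at A g" and c: "c \<in> charts_at A h" and d: "d \<in> charts_at A (g \<otimes> h)"
  shows "local_deriv c d (\<lambda>h. g \<otimes> h) h u = frechet_derivative (mult_rep k c d) (at (snd k g, snd c h)) (0, u)"
proof -
  have A: "k \<in> A" "g \<in> fst k" "c \<in> A" "h \<in> fst c" "d \<in> A" "g \<otimes> h \<in> fst d"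
    using k c d by (auto simp: charts_at_iff)
  have "(mult_rep k c d has_derivative frechet_derivative (mult_rep k c d) (at (snd k g, snd c h))) (at (snd k g, snd c h))"
    using A by (intro smooth_on_has_derivative[OF mult_smooth(2)] mult_domI)
  moreover have "((\<lambda>y. (snd k g, y)) has_derivative (\<lambda>u. (0, u))) (at (snd c h))"
    by (intro has_derivative_Pair has_derivative_const has_derivative_ident)
  ultimately have "((\<lambda>y. mult_rep k c d (snd k g, y)) has_derivative
      (\<lambda>u. frechet_derivative (mult_rep k c d) (at (snd k g, snd c h)) (0, u))) (at (snd c h))"
    by (rule has_derivative_compose[rotated])
  moreover have "(\<lambda>y. mult_rep k c d (snd k g, y)) = local_rep c d (\<lambda>h. g \<otimes> h)"
    using chart_inv_chart[OF diff A(1,2)] by (simp add: mult_rep_def local_rep_def)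
  ultimately show ?thesis by (simp add: local_deriv_def frechet_derivative_eq)
qed

lemma left_apply:
  assumes "g \<in> carrier G" "v \<in> tangent_space A h" "c \<in> charts_at A h" "d \<in> charts_at A (g \<otimes> h)"
  shows "left_differential G g h v d = local_deriv c d (\<lambda>h. g \<otimes> h) h (v c)"
  unfolding left_differential_def
  by (rule differential_apply[OF diff left_diff[OF assms(1) carrierI[OF assms(3)]] assms(2-4)])

lemma left_in:
  assumes "g \<in> carrier G" "h \<in> carrier G" "v \<in> tangent_space A h"
  shows "left_differential G g h v \<in> tangent_space A (g \<otimes> h)"
  unfolding left_differential_def by (rule differential_in[OF diff diff left_diff[OF assms(1,2)] assms(3)])

lemma left_in_one:
  assumes "g \<in> carrier G" "v \<in> tangent_space A \<one>"
  shows "left_differential G g \<one> v \<in> tangent_space A g"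
  using left_in[OF assms(1) one_closed assms(2)] assms(1) by simp

lemma left_compose:
  assumes "k \<in> carrier G" "g \<in> carrier G" "h \<in> carrier G" "v \<in> tangent_space A h"
  shows "left_differential G k (g \<otimes> h) (left_differential G g h v) = left_differential G (k \<otimes> g) h v"
  unfolding left_differential_def
  by (rule differential_compose[OF diff diff left_diff[OF assms(2,3)] left_diff[OF assms(1) m_closed[OF assms(2,3)]] assms(4)])
    (use assms in \<open>auto simp: m_assoc simp flip: carrier_eq\<close>)

lemma left_one:
  assumes "h \<in> carrier G" "v \<in> tangent_space A h"
  shows "left_differential G \<one> h v = v"
  unfolding left_differential_def
  using assms by (intro differential_identity[OF diff]) (auto simp flip: carrier_eq)

lemma left_add:
  assumes "g \<in> carrier G" "h \<in> carrier G"
  shows "left_differential G g h (\<lambda>c. u c + v c) = (\<lambda>d. left_differential G g h u d + left_differential G g h v d)"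
  unfolding left_differential_def by (rule differential_add[OF diff left_diff[OF assms]])

lemma left_scale:
  assumes "g \<in> carrier G" "h \<in> carrier G"
  shows "left_differential G g h (\<lambda>c. r *\<^sub>R v c) = (\<lambda>d. r *\<^sub>R left_differential G g h v d)"
  unfolding left_differential_def by (rule differential_scale[OF diff left_diff[OF assms]])

lemma left_inv_cancel:
  assumes "g \<in> carrier G" "v \<in> tangent_space A g"
  shows "left_differential G g \<one> (left_differential G (inv g) g v) = v"
  using left_compose[of g "inv g" g v] left_one[of g v] assms by simp

lemma left_inv_in:
  assumes "g \<in> carrier G" "v \<in> tangent_space A g"
  shows "left_differential G (inv g) g v \<in> tangent_space A \<one>"
  using left_in[of "inv g" g v] assms by simp

text \<open>It is the chart in which \<open>deriv_along\<close> is evaluated at the identity, so the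
  derivative of the representation becomes a derivative in these coordinates.\<close>

definition one_chart :: "('a, 'e) chart" where
  "one_chart = chart_at A \<one>"

lemma one_chart: "one_chart \<in> charts_at A \<one>"
  unfolding one_chart_def by (rule chart_at_in) (simp flip: carrier_eq)

text \<open>With the inverses \<open>lie_coord\<close> and \<open>dual_coord\<close>, the maps
  \<open>left_field\<close> and \<open>left_form\<close> identify the Lie algebra with the model
  space, and the dual of the one with the dual of the other. Linear algebra on invariant fields and
  forms is carried out through these identifications.\<close>

definition left_field :: "'e \<Rightarrow> ('a, 'e) vfield" where
  "left_field u g = (if g \<in> carrier G then left_differential G g \<one> (coord_vector A one_chart \<one> u) else (\<lambda>c. 0))"

definition left_form :: "('e \<Rightarrow>\<^sub>L real) \<Rightarrow> ('a, 'e) oneform" where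
  "left_form l g v = (if g \<in> carrier G \<and> v \<in> tangent_space A g then l (left_differential G (inv g) g v one_chart) else 0)"

definition lie_coord :: "('a, 'e) vfield \<Rightarrow> 'e" where
  "lie_coord X = X \<one> one_chart"

definition dual_coord :: "('a, 'e) oneform \<Rightarrow> 'e \<Rightarrow>\<^sub>L real" where
  "dual_coord \<alpha> = Blinfun (\<lambda>u. \<alpha> \<one> (coord_vector A one_chart \<one> u))"

section \<open>Invariant fields and forms determined at the identity\<close>

lemma left_field_one: "left_field u \<one> = coord_vector A one_chart \<one> u"
  using left_one[OF one_closed coord_vector_in[OF diff one_chart]] by (simp add: left_field_def)

lemma left_field_tangent: "g \<in> carrier G \<Longrightarrow> left_field u g \<in> tangent_space A g"
  using left_in_one[OF _ coord_vector_in[OF diff one_chart]] by (simp add: left_field_def)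

text \<open>Invariance is the chain rule for two successive left translations. In a chart the field
  is the partial derivative of multiplication at \<open>(p, \<one>)\<close> in the fixed direction
  \<open>(0, u)\<close>, hence smooth in \<open>p\<close>.\<close>

lemma left_field_in: "left_field u \<in> lie_algebra G"
  unfolding lie_algebra_def vector_fields_def
proof (intro CollectI conjI ballI allI impI)
  show "left_field u p \<in> tangent_space A p" if "p \<in> points A" for p
    using that left_field_tangent by (simp add: carrier_eq)
  show "left_field u p = (\<lambda>c. 0)" if "p \<notin> points A" for p
    using that by (simp add: left_field_def carrier_eq)
  show "left_differential G g h (left_field u h) = left_field u (g \<otimes> h)"
    if "g \<in> carrier G" "h \<in> carrier G" for g h
    using left_compose[OF that one_closed coord_vector_in[OF diff one_chart]] that by (simp add: left_field_def)
  fix c assume c: "c \<in> A"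
  let ?S = "snd c ` fst c" and ?e = "snd one_chart \<one>"
  have e: "one_chart \<in> A" "\<one> \<in> fst one_chart" using one_chart by (auto simp: charts_at_iff)
  have S: "open ?S" by (rule open_chart_image[OF diff c])
  have "smooth_on ?S (\<lambda>x. frechet_derivative (mult_rep c one_chart c) (at ((x, 0) + (0, ?e))) (0, u))"
  proof (rule smooth_on_affine[OF _ S _ smooth_on_derivative[OF mult_smooth(2)[OF c e(1) c]]])
    show "bounded_linear (\<lambda>x::'e. (x, 0::'e))"
      by (intro bounded_linear_Pair bounded_linear_zero bounded_linear_ident)
    fix x assume "x \<in> ?S"
    then obtain p where p: "p \<in> fst c" "x = snd c p" by auto
    then have "p \<in> carrier G" using c carrierI by (auto simp: charts_at_iff)
    then show "(x, 0) + (0, ?e) \<in> mult_dom c one_chart c"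
      using p c e mult_domI[of c one_chart p \<one> c] by simp
  qed
  then show "smooth_on ?S (\<lambda>x. left_field u (chart_inv c x) c)"
  proof (rule smooth_on_cong[OF S, rotated])
    fix x assume "x \<in> ?S"
    then obtain p where p: "p \<in> fst c" "x = snd c p" by auto
    then have cp: "c \<in> charts_at A p" using c by (simp add: charts_at_iff)
    then have pG: "p \<in> carrier G" by (rule carrierI)
    have "left_field u p c = local_deriv one_chart c (\<lambda>h. p \<otimes> h) \<one> u"
      using left_apply[OF pG coord_vector_in[OF diff one_chart] one_chart, of c] pG cp
      by (simp add: left_field_def coord_vector_self[OF diff one_chart])
    also have "\<dots> = frechet_derivative (mult_rep c one_chart c) (at (x, ?e)) (0, u)"
      using left_local_deriv[OF cp one_chart, of c u] pG cp p by simp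
    finally show "frechet_derivative (mult_rep c one_chart c) (at ((x, 0) + (0, ?e))) (0, u) = left_field u (chart_inv c x) c"
      using p chart_inv_chart[OF diff c] by simp
  qed
qed

lemma lie_tangent: "X \<in> lie_algebra G \<Longrightarrow> g \<in> carrier G \<Longrightarrow> X g \<in> tangent_space A g"
  by (simp add: lie_algebra_def vector_fields_def carrier_eq)

lemma lie_outside: "X \<in> lie_algebra G \<Longrightarrow> g \<notin> carrier G \<Longrightarrow> X g = (\<lambda>c. 0)"
  by (simp add: lie_algebra_def vector_fields_def carrier_eq)

lemma lie_left:
  "X \<in> lie_algebra G \<Longrightarrow> g \<in> carrier G \<Longrightarrow> h \<in> carrier G \<Longrightarrow> left_differential G g h (X h) = X (g \<otimes> h)"
  by (simp add: lie_algebra_def)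

lemma left_field_lie_coord:
  assumes X: "X \<in> lie_algebra G"
  shows "left_field (lie_coord X) = X"
proof
  fix g
  have "coord_vector A one_chart \<one> (lie_coord X) = X \<one>"
    unfolding lie_coord_def by (rule coord_vector_tangent[OF diff lie_tangent[OF X one_closed] one_chart])
  then show "left_field (lie_coord X) g = X g"
    using lie_left[OF X, of g \<one>] lie_outside[OF X, of g] by (simp add: left_field_def)
qed

lemma lie_coord_left_field: "lie_coord (left_field u) = u"
  by (simp add: lie_coord_def left_field_one coord_vector_self[OF diff one_chart])

lemma left_field_add: "left_field (u + v) = (\<lambda>g c. left_field u g c + left_field v g c)"
  by (intro ext) (simp add: left_field_def coord_vector_add[OF diff one_chart] left_add)

lemma left_field_scale: "left_field (r *\<^sub>R u) = (\<lambda>g c. r *\<^sub>R left_field u g c)"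
  by (intro ext) (simp add: left_field_def coord_vector_scale[OF diff one_chart] left_scale)

lemma lie_algebra_diff:
  assumes "X \<in> lie_algebra G" "Y \<in> lie_algebra G"
  shows "(\<lambda>g c. X g c - Y g c) \<in> lie_algebra G"
proof -
  have "left_field (lie_coord X + (- 1) *\<^sub>R lie_coord Y) = (\<lambda>g c. X g c - Y g c)"
    unfolding left_field_add left_field_scale left_field_lie_coord[OF assms(1)] left_field_lie_coord[OF assms(2)]
    by simp
  then show ?thesis using left_field_in by metis
qed

lemma lie_algebra_uminus:
  assumes "X \<in> lie_algebra G"
  shows "(\<lambda>g c. - X g c) \<in> lie_algebra G"
proof -
  have "left_field ((- 1) *\<^sub>R lie_coord X) = (\<lambda>g c. - X g c)"
    unfolding left_field_scale left_field_lie_coord[OF assms] by simp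
  then show ?thesis using left_field_in by metis
qed

lemma lie_algebra_through:
  assumes g: "g \<in> carrier G" and v: "v \<in> tangent_space A g"
  obtains X where "X \<in> lie_algebra G" "X g = v"
proof -
  let ?u = "left_differential G (inv g) g v one_chart"
  have "coord_vector A one_chart \<one> ?u = left_differential G (inv g) g v"
    by (rule coord_vector_tangent[OF diff left_inv_in[OF g v] one_chart])
  then have "left_field ?u g = v" using left_inv_cancel[OF g v] g by (simp add: left_field_def)
  then show ?thesis using that left_field_in by blast
qed

text \<open>In a chart the value on the coordinate vector of \<open>u\<close> is \<open>l\<close>
  applied to the partial derivative of multiplication at \<open>(inv p, p)\<close>, a point that
  depends smoothly on \<open>p\<close>. A chart containing \<open>inv p\<close> is available
  locally, so smoothness is proved near each point.\<close>

lemma left_form_in: "left_form l \<in> dual_lie_algebra G"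
  unfolding dual_lie_algebra_def one_forms_def
proof (intro CollectI conjI ballI allI impI)
  show "left_form l p \<in> cotangent_space A p" if "p \<in> points A" for p
  proof (rule cotangentI)
    have p: "p \<in> carrier G" using that by (simp add: carrier_eq)
    show "left_form l p v = 0" if "v \<notin> tangent_space A p" for v using that by (simp add: left_form_def)
    show "left_form l p (\<lambda>c. u c + v c) = left_form l p u + left_form l p v"
      if "u \<in> tangent_space A p" "v \<in> tangent_space A p" for u v
      using that p by (simp add: left_form_def tangent_add[OF diff] left_add blinfun.add_right)
    show "left_form l p (\<lambda>c. r *\<^sub>R v c) = r * left_form l p v"
      if "v \<in> tangent_space A p" for r v
      using that p by (simp add: left_form_def tangent_scale[OF diff] left_scale blinfun.scaleR_right)
  qed
  show "left_form l p = (\<lambda>v. 0)" if "p \<notin> points A" for p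
    using that by (intro ext) (simp add: left_form_def carrier_eq)
  show "left_form l (g \<otimes> h) (left_differential G g h v) = left_form l h v"
    if g: "g \<in> carrier G" and h: "h \<in> carrier G" and v: "v \<in> tangent_space A h" for g h v
  proof -
    have "inv (g \<otimes> h) \<otimes> g = inv h" using g h by (simp add: inv_mult_group m_assoc)
    then show ?thesis
      using left_compose[of "inv (g \<otimes> h)" g h v] left_in[OF g h v] g h v by (simp add: left_form_def)
  qed
  fix c u assume c: "c \<in> A"
  let ?f = "\<lambda>x. left_form l (chart_inv c x) (coord_vector A c (chart_inv c x) u)"
  have e: "one_chart \<in> A" "\<one> \<in> fst one_chart" using one_chart by (auto simp: charts_at_iff)
  obtain D :: "('e \<times> 'e) set" where D: "is_basis D" using prod_basis_exists[OF basis basis] .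
  show "smooth_on (snd c ` fst c) ?f"
    unfolding smooth_on_def
  proof (intro allI Ck_on_local)
    fix n x0 assume "x0 \<in> snd c ` fst c"
    then obtain p0 where p0: "p0 \<in> fst c" "x0 = snd c p0" by auto
    then have p0G: "p0 \<in> carrier G" using c carrierI by (auto simp: charts_at_iff)
    then obtain k where k: "k \<in> A" "inv p0 \<in> fst k"
      using inv_closed[OF p0G] by (auto simp: carrier_eq points_def)
    define T where "T = local_dom c k (\<lambda>g. inv g)"
    define J where "J = local_rep c k (\<lambda>g. inv g)"
    have T: "open T" "smooth_on T J" "x0 \<in> T"
      using smooth_map_local[OF smooth_inv c k(1)] p0 k by (auto simp: T_def J_def local_domI)
    have inT: "\<exists>p. x = snd c p \<and> p \<in> fst c \<and> inv p \<in> fst k \<and> p \<in> carrier G" if xT: "x \<in> T" for x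
    proof -
      obtain p where "x = snd c p" "p \<in> fst c" "inv p \<in> fst k"
        using xT by (auto simp: T_def local_dom_def)
      moreover have "p \<in> carrier G" using carrierI[of c p] c \<open>p \<in> fst c\<close> by (simp add: charts_at_iff)
      ultimately show ?thesis by blast
    qed
    have J: "J (snd c p) = snd k (inv p)" if "p \<in> fst c" for p
      using that c by (simp add: J_def local_rep_chart[OF diff])
    have "Ck_on n T (\<lambda>x. frechet_derivative (mult_rep k c one_chart) (at (J x, x)) (0, u))"
    proof (rule Ck_on_compose[OF D T(1) _ smooth_on_Ck[OF smooth_on_derivative[OF mult_smooth(2)[OF k(1) c e(1)]]]])
      show "Ck_on n T (\<lambda>x. (J x, x))"
      proof (rule Ck_on_Pair[OF T(1) smooth_on_Ck[OF T(2)]])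
        show "Ck_on n T (\<lambda>x. x)"
          using Ck_on_affine[of "\<lambda>x. 0" T "0::'e" UNIV n "\<lambda>x. x"] T(1)
          by (cases n) (auto simp: Ck_on_const)
      qed
      fix x assume "x \<in> T"
      then obtain p where "x = snd c p" "p \<in> fst c" "inv p \<in> fst k" "p \<in> carrier G" using inT by blast
      then show "(J x, x) \<in> mult_dom k c one_chart"
        using mult_domI[OF k(1) c, of "inv p" p one_chart] e J by simp
    qed
    from Ck_on_linear[OF blinfun.bounded_linear_right T(1) this]
    have "Ck_on n T (\<lambda>x. l (frechet_derivative (mult_rep k c one_chart) (at (J x, x)) (0, u)))" .
    then have "Ck_on n T ?f"
    proof (rule Ck_on_cong[OF T(1), rotated])
      fix x assume "x \<in> T"
      then obtain p where p: "x = snd c p" "p \<in> fst c" "inv p \<in> fst k" "p \<in> carrier G" using inT by blast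
      have cp: "c \<in> charts_at A p" and kp: "k \<in> charts_at A (inv p)" using p c k by (auto simp: charts_at_iff)
      have o: "one_chart \<in> charts_at A (inv p \<otimes> p)" using one_chart p by simp
      have v: "coord_vector A c p u \<in> tangent_space A p" by (rule coord_vector_in[OF diff cp])
      have "left_form l p (coord_vector A c p u) = l (left_differential G (inv p) p (coord_vector A c p u) one_chart)"
        using p v by (simp add: left_form_def)
      also have "left_differential G (inv p) p (coord_vector A c p u) one_chart
          = local_deriv c one_chart (\<lambda>h. inv p \<otimes> h) p u"
        using left_apply[OF _ v cp o] p by (simp add: coord_vector_self[OF diff cp])
      also have "\<dots> = frechet_derivative (mult_rep k c one_chart) (at (J x, x)) (0, u)"
        using left_local_deriv[OF kp cp o] p J by simp
      finally show "l (frechet_derivative (mult_rep k c one_chart) (at (J x, x)) (0, u)) = ?f x"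
        using chart_inv_chart[OF diff c p(2)] p(1) by simp
    qed
    then show "\<exists>T. open T \<and> x0 \<in> T \<and> Ck_on n T ?f" using T by blast
  qed
qed

lemma dual_cotangent: "\<alpha> \<in> dual_lie_algebra G \<Longrightarrow> g \<in> carrier G \<Longrightarrow> \<alpha> g \<in> cotangent_space A g"
  by (simp add: dual_lie_algebra_def one_forms_def carrier_eq)

lemma dual_outside: "\<alpha> \<in> dual_lie_algebra G \<Longrightarrow> g \<notin> carrier G \<Longrightarrow> \<alpha> g = (\<lambda>v. 0)"
  by (simp add: dual_lie_algebra_def one_forms_def carrier_eq)

lemma dual_left:
  "\<alpha> \<in> dual_lie_algebra G \<Longrightarrow> g \<in> carrier G \<Longrightarrow> h \<in> carrier G \<Longrightarrow> v \<in> tangent_space A h \<Longrightarrow>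
    \<alpha> (g \<otimes> h) (left_differential G g h v) = \<alpha> h v"
  by (simp add: dual_lie_algebra_def)

lemma dual_eqI:
  assumes "\<alpha> \<in> dual_lie_algebra G" "\<beta> \<in> dual_lie_algebra G"
    and "\<And>v. v \<in> tangent_space A \<one> \<Longrightarrow> \<alpha> \<one> v = \<beta> \<one> v"
  shows "\<alpha> = \<beta>"
proof
  fix g
  show "\<alpha> g = \<beta> g"
  proof (cases "g \<in> carrier G")
    case True
    show ?thesis
    proof (rule cotangent_eqI[OF dual_cotangent[OF assms(1) True] dual_cotangent[OF assms(2) True]])
      fix v assume v: "v \<in> tangent_space A g"
      then show "\<alpha> g v = \<beta> g v"
        using dual_left[OF assms(1) _ True v, of "inv g"] dual_left[OF assms(2) _ True v, of "inv g"]
          assms(3)[OF left_inv_in[OF True v]] True by simp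
    qed
  qed (simp add: dual_outside[OF assms(1)] dual_outside[OF assms(2)])
qed

lemma dual_coord_apply:
  assumes "\<alpha> \<in> dual_lie_algebra G"
  shows "dual_coord \<alpha> u = \<alpha> \<one> (coord_vector A one_chart \<one> u)"
  unfolding dual_coord_def
  by (simp add: bounded_linear_Blinfun_apply covector_coord_bounded[OF one_chart dual_cotangent[OF assms one_closed]])

lemma left_form_one: "v \<in> tangent_space A \<one> \<Longrightarrow> left_form l \<one> v = l (v one_chart)"
  by (simp add: left_form_def left_one)

lemma dual_coord_left_form: "dual_coord (left_form l) = l"
  by (rule blinfun_eqI)
    (simp add: dual_coord_apply[OF left_form_in] left_form_one coord_vector_in[OF diff one_chart]
      coord_vector_self[OF diff one_chart])

lemma left_form_dual_coord:
  assumes \<alpha>: "\<alpha> \<in> dual_lie_algebra G"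
  shows "left_form (dual_coord \<alpha>) = \<alpha>"
proof (rule dual_eqI[OF left_form_in \<alpha>])
  fix v assume v: "v \<in> tangent_space A \<one>"
  then show "left_form (dual_coord \<alpha>) \<one> v = \<alpha> \<one> v"
    by (simp add: left_form_one dual_coord_apply[OF \<alpha>] coord_vector_tangent[OF diff v one_chart])
qed

lemma pairing_coord:
  assumes "\<alpha> \<in> dual_lie_algebra G" "X \<in> lie_algebra G"
  shows "pairing G \<alpha> X = dual_coord \<alpha> (lie_coord X)"
  by (simp add: pairing_def dual_coord_apply[OF assms(1)] lie_coord_def
      coord_vector_tangent[OF diff lie_tangent[OF assms(2) one_closed] one_chart])

lemma pairing_const:
  assumes "\<alpha> \<in> dual_lie_algebra G" "X \<in> lie_algebra G" "g \<in> carrier G"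
  shows "\<alpha> g (X g) = pairing G \<alpha> X"
  using dual_left[OF assms(1,3) one_closed lie_tangent[OF assms(2) one_closed]]
    lie_left[OF assms(2,3) one_closed] assms(3) by (simp add: pairing_def)

lemma form_add_left_form: "form_add (left_form l) (left_form m) = left_form (l + m)"
  by (intro ext) (simp add: form_add_def left_form_def blinfun.add_left)

lemma form_scale_left_form: "form_scale r (left_form l) = left_form (r *\<^sub>R l)"
  by (intro ext) (simp add: form_scale_def left_form_def blinfun.scaleR_left)

lemma form_add_in:
  "\<alpha> \<in> dual_lie_algebra G \<Longrightarrow> \<beta> \<in> dual_lie_algebra G \<Longrightarrow> form_add \<alpha> \<beta> \<in> dual_lie_algebra G"
  using form_add_left_form[of "dual_coord \<alpha>" "dual_coord \<beta>"] left_form_in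
  by (simp add: left_form_dual_coord)

text \<open>Together with \<open>dual_eq_at\<close> this makes left trivialization a bijection onto
  the cotangent bundle, so the \<open>inv_into\<close> in the group law recovers the left-invariant
  form through a given covector.\<close>

lemma dual_through:
  assumes g: "g \<in> carrier G" and \<xi>: "\<xi> \<in> cotangent_space A g"
  obtains \<alpha> where "\<alpha> \<in> dual_lie_algebra G" "\<alpha> g = \<xi>"
proof -
  have lin: "linear (\<lambda>u. \<xi> (left_field u g))"
    by (intro linearI)
      (simp_all add: left_field_add left_field_scale cotangentD[OF \<xi>] left_field_tangent[OF g])
  define l where "l = Blinfun (\<lambda>u. \<xi> (left_field u g))"
  have l: "l u = \<xi> (left_field u g)" for u
    using bounded_linear_finite_dim[OF basis lin] by (simp add: l_def bounded_linear_Blinfun_apply)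
  have "left_form l g = \<xi>"
  proof (rule cotangent_eqI[OF dual_cotangent[OF left_form_in g] \<xi>])
    fix v assume v: "v \<in> tangent_space A g"
    have "coord_vector A one_chart \<one> (left_differential G (inv g) g v one_chart) = left_differential G (inv g) g v"
      by (rule coord_vector_tangent[OF diff left_inv_in[OF g v] one_chart])
    then show "left_form l g v = \<xi> v"
      using g v left_inv_cancel[OF g v] by (simp add: left_form_def l left_field_def)
  qed
  then show ?thesis using that left_form_in by blast
qed

lemma dual_eq_at:
  assumes \<alpha>: "\<alpha> \<in> dual_lie_algebra G" and \<beta>: "\<beta> \<in> dual_lie_algebra G" and g: "g \<in> carrier G"
    and eq: "\<alpha> g = \<beta> g"
  shows "\<alpha> = \<beta>"
proof (rule dual_eqI[OF \<alpha> \<beta>])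
  fix v assume v: "v \<in> tangent_space A \<one>"
  show "\<alpha> \<one> v = \<beta> \<one> v"
    using dual_left[OF \<alpha> g one_closed v] dual_left[OF \<beta> g one_closed v] eq g by simp
qed

end

section \<open>The derivative of the representation\<close>

context lie_group
begin

lemma one_chart_A: "one_chart \<in> A" "\<one> \<in> fst one_chart"
  using one_chart by (simp_all add: charts_at_iff)

text \<open>The identity p \<otimes> inv p = \<one> is differentiated at \<one>. Both partial
  derivatives of multiplication at (\<one>, \<one>) are the identity, so \<open>u\<close> plus its
  image under the derivative of inversion is 0.\<close>

lemma inverse_has_derivative:
  "(local_rep one_chart one_chart (\<lambda>g. inv g) has_derivative (\<lambda>u. - u)) (at (snd one_chart \<one>))"
proof -
  note o = one_chart_A
  let ?e = "snd one_chart \<one>"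
  define J where "J = local_rep one_chart one_chart (\<lambda>g. inv g)"
  define S where "S = local_dom one_chart one_chart (\<lambda>g. inv g)"
  define m where "m = mult_rep one_chart one_chart one_chart"
  have S: "open S" "smooth_on S J" "?e \<in> S"
    using smooth_map_local[OF smooth_inv o(1) o(1)] o(2) by (auto simp: S_def J_def local_domI)
  have Je: "J ?e = ?e" using o by (simp add: J_def local_rep_chart[OF diff])
  let ?J' = "frechet_derivative J (at ?e)" and ?m' = "frechet_derivative m (at (?e, ?e))"
  have J': "(J has_derivative ?J') (at ?e)" by (rule smooth_on_has_derivative[OF S(2,3)])
  have m': "(m has_derivative ?m') (at (?e, ?e))"
    unfolding m_def using o mult_domI[OF o(1) o(1) o(2) o(2), of one_chart]
    by (intro smooth_on_has_derivative[OF mult_smooth(2)]) simp_all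
  have right: "?m' (0, u) = u" for u
  proof -
    have "\<one> \<otimes> q = q" if "q \<in> fst one_chart" for q
      using that carrierI[of one_chart q] o(1) by (simp add: charts_at_iff)
    from local_deriv_id[OF diff one_chart this] show ?thesis
      using left_local_deriv[OF one_chart one_chart, of one_chart u] one_chart by (simp add: m_def)
  qed
  have left: "?m' (u, 0) = u" for u
  proof -
    have "((\<lambda>x. m (x, ?e)) has_derivative (\<lambda>u. ?m' (u, 0))) (at ?e)"
      by (rule has_derivative_compose[OF has_derivative_Pair[OF has_derivative_ident has_derivative_const]]) (rule m')
    moreover have "((\<lambda>x. m (x, ?e)) has_derivative (\<lambda>u. u)) (at ?e)"
    proof (rule has_derivative_transform_within_open[OF has_derivative_ident open_chart_image[OF diff o(1)]])
      show "?e \<in> snd one_chart ` fst one_chart" using o by simp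
      fix x assume "x \<in> snd one_chart ` fst one_chart"
      then obtain p where p: "p \<in> fst one_chart" "x = snd one_chart p" by auto
      then have "p \<in> carrier G" using carrierI[of one_chart p] o by (simp add: charts_at_iff)
      then show "x = m (x, ?e)" using p o by (simp add: m_def mult_rep_def chart_inv_chart[OF diff])
    qed
    ultimately have "(\<lambda>u. ?m' (u, 0)) = (\<lambda>u. u)" by (rule has_derivative_unique)
    from fun_cong[OF this, of u] show ?thesis .
  qed
  have "((\<lambda>x. m (x, J x)) has_derivative (\<lambda>u. ?m' (u, ?J' u))) (at ?e)"
    by (rule has_derivative_compose[OF has_derivative_Pair[OF has_derivative_ident J']]) (simp add: Je m')
  moreover have "((\<lambda>x. m (x, J x)) has_derivative (\<lambda>u. 0)) (at ?e)"
  proof (rule has_derivative_transform_within_open[OF has_derivative_const[of ?e] S(1,3)])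
    fix x assume "x \<in> S"
    then obtain p where p: "p \<in> fst one_chart" "inv p \<in> fst one_chart" "x = snd one_chart p"
      by (auto simp: S_def local_dom_def)
    then have "p \<in> carrier G" using carrierI[of one_chart p] o by (simp add: charts_at_iff)
    then show "?e = m (x, J x)" using p o by (simp add: m_def mult_rep_def J_def local_rep_def chart_inv_chart[OF diff])
  qed
  ultimately have "(\<lambda>u. ?m' (u, ?J' u)) = (\<lambda>u. 0)" by (rule has_derivative_unique)
  then have "?m' (u, ?J' u) = 0" for u by (rule fun_cong)
  moreover have "?m' (u, ?J' u) = ?m' (u, 0) + ?m' (0, ?J' u)" for u
    using linear_add[OF has_derivative_linear[OF m'], of "(u, 0)" "(0, ?J' u)"] by simp
  ultimately have "u + ?J' u = 0" for u by (simp add: left right)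
  then have "?J' u = - u" for u by (metis add.inverse_unique)
  then have "?J' = (\<lambda>u. - u)" by (rule ext)
  then show ?thesis using J' by (simp add: J_def)
qed

text \<open>It is applied to forms \<beta> that change with \<open>g\<close>: the invariant basis
  forms stay fixed and smooth, while the scalars \<open>dual_coord \<beta> b\<close> carry the
  variation.\<close>

lemma dual_expand:
  assumes \<beta>: "\<beta> \<in> dual_lie_algebra G"
  shows "\<beta> g v = (\<Sum>b\<in>model_basis. left_form (dual_basis model_basis b) g v * dual_coord \<beta> b)"
proof -
  let ?w = "left_differential G (inv g) g v one_chart"
  have "dual_coord \<beta> ?w = (\<Sum>b\<in>model_basis. dual_coord \<beta> b *\<^sub>R dual_basis model_basis b) ?w"
    using blinfun_dual_expand[OF basis, of "dual_coord \<beta>"] by simp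
  then have "left_form (dual_coord \<beta>) g v = (\<Sum>b\<in>model_basis. left_form (dual_basis model_basis b) g v * dual_coord \<beta> b)"
  proof (cases "g \<in> carrier G \<and> v \<in> tangent_space A g")
    case False
    then have "left_form l g v = 0" for l unfolding left_form_def by (rule if_not_P)
    then show ?thesis by simp
  qed (simp add: left_form_def blinfun.sum_left blinfun.scaleR_left mult.commute)
  then show ?thesis by (simp add: left_form_dual_coord[OF \<beta>])
qed

end

context dual_representation
begin

text \<open>Matrix coefficient of the representation near the identity. The form and the vector are
  separate parameters because the derivative has to be linear in each: in the vector to define a
  one-form, in the form to define a vector field.\<close>

definition rep_coeff :: "('a, 'e) oneform \<Rightarrow> 'e \<Rightarrow> 'e \<Rightarrow> real" where
  "rep_coeff \<alpha> w x = dual_coord (\<rho> (chart_inv one_chart x) \<alpha>) w"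

definition rep_coeff_deriv :: "('a, 'e) oneform \<Rightarrow> 'e \<Rightarrow> 'e \<Rightarrow> real" where
  "rep_coeff_deriv \<alpha> w = frechet_derivative (rep_coeff \<alpha> w) (at (snd one_chart \<one>))"

lemma rep_in: "g \<in> carrier G \<Longrightarrow> \<alpha> \<in> dual_lie_algebra G \<Longrightarrow> \<rho> g \<alpha> \<in> dual_lie_algebra G"
  using rep_bij bij_betwE by blast

lemma one_chart_point: "x \<in> snd one_chart ` fst one_chart \<Longrightarrow> chart_inv one_chart x \<in> carrier G"
  using carrierI[of one_chart "chart_inv one_chart x"] one_chart_A(1) by (simp add: charts_at_iff chart_inv_in)

lemma one_chart_nhd: "open (snd one_chart ` fst one_chart)" "snd one_chart \<one> \<in> snd one_chart ` fst one_chart"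
  using open_chart_image[OF diff one_chart_A(1)] one_chart_A(2) by auto

lemma rep_coeff_pairing:
  assumes "\<alpha> \<in> dual_lie_algebra G" "X \<in> lie_algebra G" "x \<in> snd one_chart ` fst one_chart"
  shows "pairing G (\<rho> (chart_inv one_chart x) \<alpha>) X = rep_coeff \<alpha> (lie_coord X) x"
  by (simp add: rep_coeff_def pairing_coord[OF rep_in[OF one_chart_point[OF assms(3)] assms(1)] assms(2)])

lemma rep_coeff_has_derivative:
  assumes \<alpha>: "\<alpha> \<in> dual_lie_algebra G"
  shows "(rep_coeff \<alpha> w has_derivative rep_coeff_deriv \<alpha> w) (at (snd one_chart \<one>))"
proof -
  let ?e = "snd one_chart \<one>"
  have "smooth_on (snd one_chart ` fst one_chart) ((\<lambda>g. pairing G (\<rho> g \<alpha>) (left_field w)) \<circ> chart_inv one_chart)"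
    using rep_smooth[OF \<alpha> left_field_in] one_chart_A by (simp add: smooth_function_def)
  from smooth_on_has_derivative[OF this one_chart_nhd(2)]
  obtain D where "((\<lambda>x. pairing G (\<rho> (chart_inv one_chart x) \<alpha>) (left_field w)) has_derivative D) (at ?e)"
    unfolding o_def by blast
  then have "(rep_coeff \<alpha> w has_derivative D) (at ?e)"
    by (rule has_derivative_transform_within_open[OF _ one_chart_nhd])
      (simp add: rep_coeff_pairing[OF \<alpha> left_field_in] lie_coord_left_field)
  then show ?thesis by (simp add: rep_coeff_deriv_def frechet_derivative_eq)
qed

lemma rep_coeff_deriv_linear_vector:
  assumes \<alpha>: "\<alpha> \<in> dual_lie_algebra G"
  shows "linear (\<lambda>w. rep_coeff_deriv \<alpha> w u)"
proof (rule linearI)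
  note D = rep_coeff_has_derivative[OF \<alpha>]
  fix v w r
  have "rep_coeff \<alpha> (v + w) = (\<lambda>x. rep_coeff \<alpha> v x + rep_coeff \<alpha> w x)"
    by (intro ext) (simp add: rep_coeff_def blinfun.add_right)
  then show "rep_coeff_deriv \<alpha> (v + w) u = rep_coeff_deriv \<alpha> v u + rep_coeff_deriv \<alpha> w u"
    using frechet_derivative_eq[OF has_derivative_add[OF D D, of v w]] unfolding rep_coeff_deriv_def by simp
  have "rep_coeff \<alpha> (r *\<^sub>R w) = (\<lambda>x. r *\<^sub>R rep_coeff \<alpha> w x)"
    by (intro ext) (simp add: rep_coeff_def blinfun.scaleR_right)
  then show "rep_coeff_deriv \<alpha> (r *\<^sub>R w) u = r *\<^sub>R rep_coeff_deriv \<alpha> w u"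
    using frechet_derivative_eq[OF has_derivative_scaleR_right[OF D, of r w]] unfolding rep_coeff_deriv_def by simp
qed

text \<open>Linearity in the form comes from that of \<open>\<rho> g\<close>, which is given for
  \<open>g\<close> in the carrier; the coefficients are therefore compared on the chart image around
  the identity.\<close>

lemma rep_coeff_deriv_linear_form: "linear (\<lambda>l. rep_coeff_deriv (left_form l) w u)"
proof (rule linearI)
  note D = rep_coeff_has_derivative[OF left_form_in]
  let ?e = "snd one_chart \<one>"
  fix l m r
  have "((\<lambda>x. rep_coeff (left_form l) w x + rep_coeff (left_form m) w x) has_derivative
      (\<lambda>u. rep_coeff_deriv (left_form l) w u + rep_coeff_deriv (left_form m) w u)) (at ?e)"
    by (rule has_derivative_add[OF D D])
  then have "(rep_coeff (left_form (l + m)) w has_derivative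
      (\<lambda>u. rep_coeff_deriv (left_form l) w u + rep_coeff_deriv (left_form m) w u)) (at ?e)"
  proof (rule has_derivative_transform_within_open[OF _ one_chart_nhd])
    fix x assume "x \<in> snd one_chart ` fst one_chart"
    then have g: "chart_inv one_chart x \<in> carrier G" by (rule one_chart_point)
    let ?g = "chart_inv one_chart x"
    have "\<rho> ?g (left_form (l + m)) = form_add (\<rho> ?g (left_form l)) (\<rho> ?g (left_form m))"
      using rep_add[OF g left_form_in left_form_in] by (simp add: form_add_left_form)
    also have "\<dots> = left_form (dual_coord (\<rho> ?g (left_form l)) + dual_coord (\<rho> ?g (left_form m)))"
      by (simp add: left_form_dual_coord rep_in[OF g left_form_in] flip: form_add_left_form)
    finally show "rep_coeff (left_form l) w x + rep_coeff (left_form m) w x = rep_coeff (left_form (l + m)) w x"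
      by (simp add: rep_coeff_def dual_coord_left_form blinfun.add_left)
  qed
  then show "rep_coeff_deriv (left_form (l + m)) w u = rep_coeff_deriv (left_form l) w u + rep_coeff_deriv (left_form m) w u"
    unfolding rep_coeff_deriv_def[of "left_form (l + m)"] by (simp add: frechet_derivative_eq)
  have "((\<lambda>x. r *\<^sub>R rep_coeff (left_form l) w x) has_derivative (\<lambda>u. r *\<^sub>R rep_coeff_deriv (left_form l) w u)) (at ?e)"
    by (rule has_derivative_scaleR_right[OF D])
  then have "(rep_coeff (left_form (r *\<^sub>R l)) w has_derivative (\<lambda>u. r *\<^sub>R rep_coeff_deriv (left_form l) w u)) (at ?e)"
  proof (rule has_derivative_transform_within_open[OF _ one_chart_nhd])
    fix x assume "x \<in> snd one_chart ` fst one_chart"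
    then have g: "chart_inv one_chart x \<in> carrier G" by (rule one_chart_point)
    let ?g = "chart_inv one_chart x"
    have "\<rho> ?g (left_form (r *\<^sub>R l)) = form_scale r (\<rho> ?g (left_form l))"
      using rep_scale[OF g left_form_in] by (simp flip: form_scale_left_form)
    also have "\<dots> = left_form (r *\<^sub>R dual_coord (\<rho> ?g (left_form l)))"
      by (simp add: left_form_dual_coord rep_in[OF g left_form_in] flip: form_scale_left_form)
    finally show "r *\<^sub>R rep_coeff (left_form l) w x = rep_coeff (left_form (r *\<^sub>R l)) w x"
      by (simp add: rep_coeff_def dual_coord_left_form blinfun.scaleR_left)
  qed
  then show "rep_coeff_deriv (left_form (r *\<^sub>R l)) w u = r *\<^sub>R rep_coeff_deriv (left_form l) w u"
    unfolding rep_coeff_deriv_def[of "left_form (r *\<^sub>R l)"] by (simp add: frechet_derivative_eq)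
qed

text \<open>The prescribed pairings fix all coordinates of the form and are linear in the vector, so
  exactly one left-invariant form has them. This resolves the definite description.\<close>

lemma rep_derivative:
  assumes \<alpha>: "\<alpha> \<in> dual_lie_algebra G" and X: "X \<in> lie_algebra G"
  shows "rep_derivative G \<rho> X \<alpha> \<in> dual_lie_algebra G"
    and "Y \<in> lie_algebra G \<Longrightarrow> pairing G (rep_derivative G \<rho> X \<alpha>) Y = rep_coeff_deriv \<alpha> (lie_coord Y) (lie_coord X)"
proof -
  have along: "deriv_along A (\<lambda>g. pairing G (\<rho> g \<alpha>) Y) \<one> (X \<one>) = rep_coeff_deriv \<alpha> (lie_coord Y) (lie_coord X)"
    if Y: "Y \<in> lie_algebra G" for Y
  proof -
    have "frechet_derivative (\<lambda>x. pairing G (\<rho> (chart_inv one_chart x) \<alpha>) Y) (at (snd one_chart \<one>))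
        = frechet_derivative (rep_coeff \<alpha> (lie_coord Y)) (at (snd one_chart \<one>))"
      by (rule frechet_derivative_cong_open[OF one_chart_nhd rep_coeff_pairing[OF \<alpha> Y]])
    then show ?thesis
      by (simp add: deriv_along_def Let_def o_def rep_coeff_deriv_def lie_coord_def flip: one_chart_def)
  qed
  define l where "l = Blinfun (\<lambda>w. rep_coeff_deriv \<alpha> w (lie_coord X))"
  have l: "l w = rep_coeff_deriv \<alpha> w (lie_coord X)" for w
    using bounded_linear_finite_dim[OF basis rep_coeff_deriv_linear_vector[OF \<alpha>]]
    by (simp add: l_def bounded_linear_Blinfun_apply)
  let ?P = "\<lambda>\<beta>. \<beta> \<in> dual_lie_algebra G \<and>
     (\<forall>Y\<in>lie_algebra G. pairing G \<beta> Y = deriv_along A (\<lambda>g. pairing G (\<rho> g \<alpha>) Y) \<one> (X \<one>))"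
  have "\<exists>!\<beta>. ?P \<beta>"
  proof (rule ex1I[of _ "left_form l"])
    show "?P (left_form l)"
      by (simp add: left_form_in along pairing_coord[OF left_form_in] dual_coord_left_form l)
    fix \<beta> assume \<beta>: "?P \<beta>"
    have "dual_coord \<beta> w = l w" for w
      using \<beta> along[OF left_field_in] pairing_coord[OF _ left_field_in, of \<beta> w] left_field_in[of w]
      by (simp add: lie_coord_left_field l)
    then have "dual_coord \<beta> = l" by (rule blinfun_eqI)
    then show "\<beta> = left_form l" using left_form_dual_coord[of \<beta>] \<beta> by simp
  qed
  from theI'[OF this] have P: "?P (rep_derivative G \<rho> X \<alpha>)" by (simp add: rep_derivative_def)
  then show "rep_derivative G \<rho> X \<alpha> \<in> dual_lie_algebra G" by blast
  show "pairing G (rep_derivative G \<rho> X \<alpha>) Y = rep_coeff_deriv \<alpha> (lie_coord Y) (lie_coord X)" if "Y \<in> lie_algebra G"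
    using P that along by simp
qed

lemma lie_coord_uminus: "lie_coord (\<lambda>g c. - X g c) = - lie_coord X"
  by (simp add: lie_coord_def)

text \<open>The connection is dual to the derivative of the representation, the model space being reflexive.\<close>

lemma rep_connection:
  assumes X: "X \<in> lie_algebra G" and Y: "Y \<in> lie_algebra G"
  shows "rep_connection G \<rho> X Y \<in> lie_algebra G"
    and "\<alpha> \<in> dual_lie_algebra G \<Longrightarrow>
      pairing G \<alpha> (rep_connection G \<rho> X Y) = rep_coeff_deriv \<alpha> (lie_coord Y) (- lie_coord X)"
proof -
  let ?R = "\<lambda>\<alpha>. rep_coeff_deriv \<alpha> (lie_coord Y) (- lie_coord X)"
  have R: "pairing G (rep_derivative G \<rho> (\<lambda>g c. - X g c) \<alpha>) Y = ?R \<alpha>" if "\<alpha> \<in> dual_lie_algebra G" for \<alpha>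
    using rep_derivative(2)[OF that lie_algebra_uminus[OF X] Y] by (simp add: lie_coord_uminus)
  \<comment> \<open>The coordinate of a vector along \<open>b\<close> is the value of the functional
    dual to \<open>b\<close>, so the required pairings with the dual basis leave this vector as the
    only candidate.\<close>
  define z where "z = (\<Sum>b\<in>model_basis. ?R (left_form (dual_basis model_basis b)) *\<^sub>R b)"
  have z: "dual_coord \<alpha> z = ?R \<alpha>" if \<alpha>: "\<alpha> \<in> dual_lie_algebra G" for \<alpha>
  proof -
    let ?l = "dual_coord \<alpha>"
    have "?R \<alpha> = ?R (left_form (\<Sum>b\<in>model_basis. ?l b *\<^sub>R dual_basis model_basis b))"
      by (simp add: left_form_dual_coord[OF \<alpha>] flip: blinfun_dual_expand[OF basis])
    also have "\<dots> = (\<Sum>b\<in>model_basis. ?l b *\<^sub>R ?R (left_form (dual_basis model_basis b)))"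
      by (simp only: linear_sum[OF rep_coeff_deriv_linear_form] linear_scale[OF rep_coeff_deriv_linear_form])
    also have "\<dots> = ?l z" by (simp add: z_def blinfun.sum_right blinfun.scaleR_right mult.commute)
    finally show ?thesis by simp
  qed
  let ?P = "\<lambda>Z. Z \<in> lie_algebra G \<and> (\<forall>\<alpha>\<in>dual_lie_algebra G.
        pairing G \<alpha> Z = pairing G (rep_derivative G \<rho> (\<lambda>g c. - X g c) \<alpha>) Y)"
  have "\<exists>!Z. ?P Z"
  proof (rule ex1I[of _ "left_field z"])
    show "?P (left_field z)"
      by (simp add: left_field_in R z pairing_coord[OF _ left_field_in] lie_coord_left_field)
    fix Z assume Z: "?P Z"
    have "lie_coord Z = z"
    proof (rule dual_separates[OF basis])
      fix l :: "'e \<Rightarrow>\<^sub>L real"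
      show "l (lie_coord Z) = l z"
        using Z left_form_in[of l] z[OF left_form_in, of l] pairing_coord[OF left_form_in, of Z l]
        by (simp add: R dual_coord_left_form)
    qed
    then show "Z = left_field z" using left_field_lie_coord[of Z] Z by simp
  qed
  from theI'[OF this] have P: "?P (rep_connection G \<rho> X Y)" by (simp add: rep_connection_def dual_rep_derivative_def)
  then show "rep_connection G \<rho> X Y \<in> lie_algebra G" by blast
  show "pairing G \<alpha> (rep_connection G \<rho> X Y) = ?R \<alpha>" if "\<alpha> \<in> dual_lie_algebra G"
    using P that R by simp
qed

section \<open>The one-forms translating the fibres\<close>

text \<open>This is the one-form \<kappa> of the overview. It need not be left-invariant, since the
  element \<open>\<rho> (inv h) \<alpha>\<close> of the dual space that is evaluated at
  \<open>h\<close> itself changes with \<open>h\<close>.\<close>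

definition shift_form :: "('a, 'e) oneform \<Rightarrow> ('a, 'e) oneform" where
  "shift_form \<alpha> h = \<rho> (inv h) \<alpha> h"

lemma shift_form_cotangent:
  "\<alpha> \<in> dual_lie_algebra G \<Longrightarrow> h \<in> carrier G \<Longrightarrow> shift_form \<alpha> h \<in> cotangent_space A h"
  unfolding shift_form_def by (intro dual_cotangent rep_in inv_closed)

text \<open>With \<open>h = g k\<close>, \<open>\<rho>(h\<inverse>)\<alpha> = \<rho>(k\<inverse>)\<rho>(g\<inverse>)\<alpha>\<close> reduces the derivative at \<open>g\<close> to the one at the identity.\<close>

lemma shift_pairing_has_derivative:
  assumes \<alpha>: "\<alpha> \<in> dual_lie_algebra G" and c: "c \<in> charts_at A g" and Y: "Y \<in> lie_algebra G"
  obtains D where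
    "((\<lambda>x. pairing G (\<rho> (inv (chart_inv c x)) \<alpha>) Y) has_derivative D) (at (snd c g))"
    "\<And>X. X \<in> lie_algebra G \<Longrightarrow> D (X g c) = rep_coeff_deriv (\<rho> (inv g) \<alpha>) (lie_coord Y) (- lie_coord X)"
proof -
  note o = one_chart_A
  let ?e = "snd one_chart \<one>"
  have cA: "c \<in> A" "g \<in> fst c" using c by (auto simp: charts_at_iff)
  have g: "g \<in> carrier G" "inv g \<in> carrier G" using carrierI[OF c] by simp_all
  let ?\<beta> = "\<rho> (inv g) \<alpha>"
  have \<beta>: "?\<beta> \<in> dual_lie_algebra G" by (rule rep_in[OF g(2) \<alpha>])
  define L where "L = local_rep c one_chart (\<lambda>h. inv g \<otimes> h)"
  define S where "S = local_dom c one_chart (\<lambda>h. inv g \<otimes> h)"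
  define J where "J = local_rep one_chart one_chart (\<lambda>h. inv h)"
  define S' where "S' = local_dom one_chart one_chart (\<lambda>h. inv h)"
  have S: "open S" "smooth_on S L" "snd c g \<in> S"
    using smooth_map_local[OF left_smooth[OF g(2)] cA(1) o(1)] cA o g by (auto simp: S_def L_def local_domI)
  have S': "open S'" "?e \<in> S'"
    using smooth_map_local[OF smooth_inv o(1) o(1)] o by (auto simp: S'_def local_domI)
  have Lg: "L (snd c g) = ?e" using cA g by (simp add: L_def local_rep_chart[OF diff])
  have Je: "J ?e = ?e" using o by (simp add: J_def local_rep_chart[OF diff])
  define L' where "L' = local_deriv c one_chart (\<lambda>h. inv g \<otimes> h) g"
  have L': "(L has_derivative L') (at (snd c g))"
    using diff_map_has_derivative[OF left_diff[OF g(2,1)] c] one_chart g by (simp add: L_def L'_def)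
  have J': "(J has_derivative (\<lambda>u. - u)) (at (L (snd c g)))"
    unfolding Lg using inverse_has_derivative by (simp add: J_def)
  have C': "(rep_coeff ?\<beta> (lie_coord Y) has_derivative rep_coeff_deriv ?\<beta> (lie_coord Y)) (at (J (L (snd c g))))"
    unfolding Lg Je by (rule rep_coeff_has_derivative[OF \<beta>])
  have D: "((\<lambda>x. rep_coeff ?\<beta> (lie_coord Y) (J (L x))) has_derivative
      (\<lambda>u. rep_coeff_deriv ?\<beta> (lie_coord Y) (- L' u))) (at (snd c g))"
    by (rule has_derivative_compose[OF has_derivative_compose[OF L' J'] C'])
  \<comment> \<open>Near \<open>g\<close>, both \<open>inv g \<otimes> p\<close> and its inverse lie
    in the domain of \<open>one_chart\<close>, so that \<open>J\<close> and \<open>rep_coeff\<close>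
    are evaluated where they describe inversion and the representation.\<close>
  have "continuous_on S L" using smooth_on_Ck[OF S(2), of 0] by simp
  then have N: "open (S \<inter> L -` S')" "snd c g \<in> S \<inter> L -` S'"
    using continuous_open_preimage[OF _ S(1) S'(1)] S(3) S'(2) Lg by auto
  show thesis
  proof (rule that)
    show "((\<lambda>x. pairing G (\<rho> (inv (chart_inv c x)) \<alpha>) Y) has_derivative
        (\<lambda>u. rep_coeff_deriv ?\<beta> (lie_coord Y) (- L' u))) (at (snd c g))"
    proof (rule has_derivative_transform_within_open[OF D N])
      fix x assume x: "x \<in> S \<inter> L -` S'"
      then obtain p where p: "x = snd c p" "p \<in> fst c" "inv g \<otimes> p \<in> fst one_chart"
        by (auto simp: S_def local_dom_def)
      then have pG: "p \<in> carrier G" using carrierI[of c p] cA by (simp add: charts_at_iff)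
      let ?k = "inv g \<otimes> p"
      have Lx: "L x = snd one_chart ?k" using p cA by (simp add: L_def local_rep_chart[OF diff])
      then have k: "inv ?k \<in> fst one_chart"
        using local_domD(4)[OF diff o(1), of "L x" one_chart "\<lambda>h. inv h"] x p(3)
        by (simp add: S'_def chart_inv_chart[OF diff o(1)])
      have JL: "J (L x) = snd one_chart (inv ?k)" using p(3) o by (simp add: Lx J_def local_rep_chart[OF diff])
      have "inv ?k \<otimes> inv g = inv p" using pG g by (simp add: inv_mult_group m_assoc)
      then have "\<rho> (inv p) \<alpha> = \<rho> (inv ?k) ?\<beta>" using rep_mult[OF _ g(2) \<alpha>, of "inv ?k"] pG g by simp
      then show "rep_coeff ?\<beta> (lie_coord Y) (J (L x)) = pairing G (\<rho> (inv (chart_inv c x)) \<alpha>) Y"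
        using rep_coeff_pairing[OF \<beta> Y, of "J (L x)"] k p cA o
        by (simp add: JL[unfolded p(1)] p(1) chart_inv_chart[OF diff])
    qed
    fix X assume X: "X \<in> lie_algebra G"
    \<comment> \<open>Translation by \<open>inv g\<close> moves the value of \<open>X\<close> at
      \<open>g\<close> to its value at the identity, so \<open>L'\<close> yields
      \<open>lie_coord X\<close>; the sign in the result is that of the derivative of
      inversion.\<close>
    have "left_differential G (inv g) g (X g) = X \<one>" using lie_left[OF X g(2,1)] g by simp
    moreover have "left_differential G (inv g) g (X g) one_chart = L' (X g c)"
      unfolding L'_def using one_chart g by (intro left_apply[OF g(2) lie_tangent[OF X g(1)] c]) simp
    ultimately have "L' (X g c) = lie_coord X" by (simp add: lie_coord_def)
    then show "rep_coeff_deriv ?\<beta> (lie_coord Y) (- L' (X g c)) = rep_coeff_deriv ?\<beta> (lie_coord Y) (- lie_coord X)"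
      by simp
  qed
qed

text \<open>At \<open>q\<close> the form is expanded in the left-invariant basis forms. These are
  smooth, and the coefficients are pairings of \<open>\<rho> (inv q) \<alpha>\<close> with
  left-invariant fields, differentiable by the preceding lemma.\<close>

lemma shift_form_differentiable:
  assumes \<alpha>: "\<alpha> \<in> dual_lie_algebra G" and c: "c \<in> charts_at A g"
  shows "coord_form A c (shift_form \<alpha>) differentiable (at (snd c g))"
proof -
  have cA: "c \<in> A" "g \<in> fst c" using c by (auto simp: charts_at_iff)
  let ?S = "snd c ` fst c"
  have S: "open ?S" "snd c g \<in> ?S" using open_chart_image[OF diff cA(1)] cA by auto
  define a where "a b b' x = left_form (dual_basis model_basis b') (chart_inv c x) (coord_vector A c (chart_inv c x) b)" for b b' x
  define p where "p b' x = pairing G (\<rho> (inv (chart_inv c x)) \<alpha>) (left_field b')" for b' x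
  have a: "a b b' differentiable (at (snd c g))" for b b'
  proof -
    have "smooth_on ?S (a b b')"
      using left_form_in[of "dual_basis model_basis b'"] cA(1)
      unfolding a_def[abs_def] by (simp add: dual_lie_algebra_def one_forms_def)
    from smooth_on_has_derivative[OF this S(2)] show ?thesis by (auto simp: differentiable_def)
  qed
  have p: "p b' differentiable (at (snd c g))" for b'
    using shift_pairing_has_derivative[OF \<alpha> c left_field_in[of b']] unfolding p_def differentiable_def by blast
  have "(\<lambda>x. \<Sum>b\<in>model_basis. (\<Sum>b'\<in>model_basis. a b b' x * p b' x) *\<^sub>R dual_basis model_basis b)
      differentiable (at (snd c g))"
    using basis by (intro differentiable_sum differentiable_scaleR differentiable_mult differentiable_const a p ballI)
      (auto simp: is_basis_def)
  then show ?thesis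
  proof (rule differentiable_cong_open[OF S, rotated])
    fix x assume "x \<in> ?S"
    then obtain q where q: "x = snd c q" "q \<in> fst c" by auto
    then have cq: "c \<in> charts_at A q" using cA by (simp add: charts_at_iff)
    have qG: "q \<in> carrier G" "inv q \<in> carrier G" using carrierI[OF cq] by simp_all
    have \<beta>: "\<rho> (inv q) \<alpha> \<in> dual_lie_algebra G" by (rule rep_in[OF qG(2) \<alpha>])
    have K: "coord_form A c (shift_form \<alpha>) x b = (\<Sum>b'\<in>model_basis. a b b' x * p b' x)" for b
      using coord_form_apply[of c q "shift_form \<alpha>", OF cq shift_form_cotangent[OF \<alpha> qG(1)]]
        dual_expand[OF \<beta>, of q "coord_vector A c q b"] q cA
      by (simp add: a_def p_def chart_inv_chart[OF diff] shift_form_def pairing_coord[OF \<beta> left_field_in] lie_coord_left_field)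
    show "(\<Sum>b\<in>model_basis. (\<Sum>b'\<in>model_basis. a b b' x * p b' x) *\<^sub>R dual_basis model_basis b)
        = coord_form A c (shift_form \<alpha>) x"
      using blinfun_dual_expand[OF basis, of "coord_form A c (shift_form \<alpha>) x"] unfolding K by (rule sym)
  qed
qed

text \<open>Cartan's formula \<open>d\<kappa>(X, Y) = X(\<kappa>(Y)) - Y(\<kappa>(X)) - \<kappa>([X, Y])\<close> for the coordinate expression of \<open>d\<kappa>\<close>.\<close>

lemma shift_form_curl:
  assumes \<alpha>: "\<alpha> \<in> dual_lie_algebra G" and c: "c \<in> charts_at A g"
    and X: "X \<in> lie_algebra G" and Y: "Y \<in> lie_algebra G"
  shows "coord_form_deriv A c (shift_form \<alpha>) g (X g c) (Y g c) - coord_form_deriv A c (shift_form \<alpha>) g (Y g c) (X g c)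
    = shift_form \<alpha> g (\<lambda>d. rep_connection G \<rho> X Y g d - rep_connection G \<rho> Y X g d)
      - shift_form \<alpha> g (lie_bracket A X Y g)"
proof -
  have cA: "c \<in> A" "g \<in> fst c" using c by (auto simp: charts_at_iff)
  have g: "g \<in> carrier G" "inv g \<in> carrier G" using carrierI[OF c] by simp_all
  let ?S = "snd c ` fst c" and ?x = "snd c g"
  have S: "open ?S" "?x \<in> ?S" using open_chart_image[OF diff cA(1)] cA by auto
  let ?\<beta> = "\<rho> (inv g) \<alpha>"
  have \<beta>: "?\<beta> \<in> dual_lie_algebra G" by (rule rep_in[OF g(2) \<alpha>])
  let ?K = "coord_form A c (shift_form \<alpha>)" and ?K' = "coord_form_deriv A c (shift_form \<alpha>) g"
  have K': "(?K has_derivative ?K') (at ?x)"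
    using shift_form_differentiable[OF \<alpha> c] frechet_derivative_works unfolding coord_form_deriv_def by blast
  have K: "?K (snd c q) u = shift_form \<alpha> q (coord_vector A c q u)" if "c \<in> charts_at A q" for q u
    by (rule coord_form_apply[of c q "shift_form \<alpha>", OF that shift_form_cotangent[OF \<alpha> carrierI[OF that]]])
  let ?D = "\<lambda>Y. frechet_derivative (\<lambda>x. Y (chart_inv c x) c) (at ?x)"
  \<comment> \<open>The function \<kappa>(Y) is differentiated along \<open>X\<close> in two ways:
    by the product rule in the chart, which gives the left side, and through the representation,
    which gives the pairing with the connection.\<close>
  have deriv: "?K' (X g c) (Y g c) + ?K ?x (?D Y (X g c)) = pairing G ?\<beta> (rep_connection G \<rho> X Y)"
    if X: "X \<in> lie_algebra G" and Y: "Y \<in> lie_algebra G" for X Y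
  proof -
    have "smooth_on ?S (\<lambda>x. Y (chart_inv c x) c)"
      using Y cA(1) by (simp add: lie_algebra_def vector_fields_def)
    from blinfun.FDERIV[OF K' smooth_on_has_derivative[OF this S(2)]]
    have 1: "((\<lambda>x. ?K x (Y (chart_inv c x) c)) has_derivative (\<lambda>u. ?K ?x (?D Y u) + ?K' u (Y g c))) (at ?x)"
      by (simp add: chart_inv_chart[OF diff cA])
    obtain D where D: "((\<lambda>x. pairing G (\<rho> (inv (chart_inv c x)) \<alpha>) Y) has_derivative D) (at ?x)"
      "\<And>X. X \<in> lie_algebra G \<Longrightarrow> D (X g c) = rep_coeff_deriv ?\<beta> (lie_coord Y) (- lie_coord X)"
      using shift_pairing_has_derivative[OF \<alpha> c Y] by blast
    have "((\<lambda>x. ?K x (Y (chart_inv c x) c)) has_derivative D) (at ?x)"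
    proof (rule has_derivative_transform_within_open[OF D(1) S])
      fix x assume "x \<in> ?S"
      then obtain q where q: "x = snd c q" "q \<in> fst c" by auto
      then have cq: "c \<in> charts_at A q" using cA by (simp add: charts_at_iff)
      have qG: "q \<in> carrier G" "inv q \<in> carrier G" using carrierI[OF cq] by simp_all
      have "coord_vector A c q (Y q c) = Y q" by (rule coord_vector_tangent[OF diff lie_tangent[OF Y qG(1)] cq])
      then show "pairing G (\<rho> (inv (chart_inv c x)) \<alpha>) Y = ?K x (Y (chart_inv c x) c)"
        using q K[OF cq] pairing_const[OF rep_in[OF qG(2) \<alpha>] Y qG(1)] cA
        by (simp add: chart_inv_chart[OF diff] shift_form_def)
    qed
    from has_derivative_unique[OF 1 this]
    have "?K ?x (?D Y (X g c)) + ?K' (X g c) (Y g c) = D (X g c)" by meson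
    then show ?thesis using D(2)[OF X] rep_connection(2)[OF X Y \<beta>] by simp
  qed
  \<comment> \<open>The difference of the terms that differentiate the fields is the coordinate
    formula for the bracket. Since the bracket is a tangent vector, its component in
    \<open>c\<close> determines it.\<close>
  have Kx: "?K ?x (?D Y (X g c)) - ?K ?x (?D X (Y g c)) = shift_form \<alpha> g (lie_bracket A X Y g)"
  proof -
    have "lie_bracket A X Y g \<in> tangent_space A g"
      using X Y g by (intro lie_bracket_tangent) (simp_all add: lie_algebra_def flip: carrier_eq)
    then have "coord_vector A c g (lie_bracket A X Y g c) = lie_bracket A X Y g"
      by (rule coord_vector_tangent[OF diff _ c])
    moreover have "lie_bracket A X Y g c = ?D Y (X g c) - ?D X (Y g c)"
      using c by (simp add: lie_bracket_def)
    ultimately show ?thesis using K[OF c, of "?D Y (X g c) - ?D X (Y g c)"] by (simp add: blinfun.diff_right)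
  qed
  let ?T = "\<lambda>g d. rep_connection G \<rho> X Y g d - rep_connection G \<rho> Y X g d"
  have T: "?T \<in> lie_algebra G" by (intro lie_algebra_diff rep_connection(1) X Y)
  have "pairing G ?\<beta> ?T = pairing G ?\<beta> (rep_connection G \<rho> X Y) - pairing G ?\<beta> (rep_connection G \<rho> Y X)"
    using pairing_coord[OF \<beta> T] pairing_coord[OF \<beta> rep_connection(1)[OF X Y]] pairing_coord[OF \<beta> rep_connection(1)[OF Y X]]
    by (simp add: lie_coord_def blinfun.diff_right)
  moreover have "shift_form \<alpha> g (?T g) = pairing G ?\<beta> ?T"
    using pairing_const[OF \<beta> T g(1)] by (simp add: shift_form_def)
  ultimately show ?thesis using deriv[OF X Y] deriv[OF Y X] Kx by simp
qed

text \<open>The curl formula tests symmetry on values of left-invariant fields, and these values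
  fill the tangent space at \<open>g\<close>, so every pair of coordinate vectors is
  reached.\<close>

lemma shift_form_closed_iff:
  assumes \<alpha>: "\<alpha> \<in> dual_lie_algebra G" and c: "c \<in> charts_at A g"
  shows "(\<forall>x y. coord_form_deriv A c (shift_form \<alpha>) g x y = coord_form_deriv A c (shift_form \<alpha>) g y x)
    \<longleftrightarrow> (\<forall>X\<in>lie_algebra G. \<forall>Y\<in>lie_algebra G.
      shift_form \<alpha> g (\<lambda>d. rep_connection G \<rho> X Y g d - rep_connection G \<rho> Y X g d)
      = shift_form \<alpha> g (lie_bracket A X Y g))"
    (is "?l \<longleftrightarrow> ?r")
proof
  assume l: ?l
  show ?r
  proof (intro ballI)
    fix X Y assume "X \<in> lie_algebra G" "Y \<in> lie_algebra G"
    from shift_form_curl[OF \<alpha> c this] l[rule_format, of "X g c" "Y g c"]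
    show "shift_form \<alpha> g (\<lambda>d. rep_connection G \<rho> X Y g d - rep_connection G \<rho> Y X g d)
      = shift_form \<alpha> g (lie_bracket A X Y g)" by simp
  qed
next
  assume r: ?r
  have ex: "\<exists>X\<in>lie_algebra G. X g c = x" for x
  proof -
    obtain X where "X \<in> lie_algebra G" "X g = coord_vector A c g x"
      using lie_algebra_through[OF carrierI[OF c] coord_vector_in[OF diff c]] .
    then show ?thesis by (intro bexI[of _ X]) (simp_all add: coord_vector_self[OF diff c])
  qed
  show ?l
  proof (intro allI)
    fix x y
    obtain X Y where XY: "X \<in> lie_algebra G" "Y \<in> lie_algebra G" "X g c = x" "Y g c = y"
      using ex[of x] ex[of y] by blast
    show "coord_form_deriv A c (shift_form \<alpha>) g x y = coord_form_deriv A c (shift_form \<alpha>) g y x"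
      using shift_form_curl[OF \<alpha> c XY(1,2)] r[rule_format, OF XY(1,2)] XY(3,4) by simp
  qed
qed

section \<open>The group structure on the cotangent bundle\<close>

text \<open>With \<beta> the left-invariant form through \<xi>, both summands of the product are
  left-invariant, so pulling back along left translation by \<open>g\<close> evaluates them at
  \<open>h\<close>. The result has the shape required of a lift followed by a fibre
  translation.\<close>

lemma cotangent_group_mult:
  assumes g: "g \<in> carrier G" and \<alpha>: "\<alpha> \<in> dual_lie_algebra G"
    and h: "h \<in> carrier G" and \<xi>: "\<xi> \<in> cotangent_space A h"
  defines "\<Phi> \<equiv> (g, \<alpha> g) \<otimes>\<^bsub>cotangent_group G \<rho>\<^esub> (h, \<xi>)"
  shows "fst \<Phi> = g \<otimes> h" "snd \<Phi> \<in> cotangent_space A (g \<otimes> h)"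
    "v \<in> tangent_space A h \<Longrightarrow> snd \<Phi> (left_differential G g h v) = \<xi> v + shift_form \<alpha> h v"
proof -
  have inj: "inj_on left_trivialization (carrier G \<times> dual_lie_algebra G)"
    using dual_eq_at by (auto simp: inj_on_def left_trivialization_def)
  have untriv: "inv_into (carrier G \<times> dual_lie_algebra G) left_trivialization (k, \<beta> k) = (k, \<beta>)"
    if "k \<in> carrier G" "\<beta> \<in> dual_lie_algebra G" for k \<beta>
    using inv_into_f_f[OF inj, of "(k, \<beta>)"] that by (simp add: left_trivialization_def)
  obtain \<beta> where \<beta>: "\<beta> \<in> dual_lie_algebra G" "\<beta> h = \<xi>" using dual_through[OF h \<xi>] .
  have in_dual: "\<rho> (inv h) \<alpha> \<in> dual_lie_algebra G" by (rule rep_in[OF inv_closed[OF h] \<alpha>])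
  have \<Phi>: "\<Phi> = (g \<otimes> h, form_add (\<rho> (inv h) \<alpha>) \<beta> (g \<otimes> h))"
    unfolding \<Phi>_def \<beta>(2)[symmetric]
    by (simp add: cotangent_group_def Let_def untriv[OF g \<alpha>] untriv[OF h \<beta>(1)])
      (simp add: left_trivialization_def)
  show "fst \<Phi> = g \<otimes> h" by (simp add: \<Phi>)
  show "snd \<Phi> \<in> cotangent_space A (g \<otimes> h)"
    using dual_cotangent[OF form_add_in[OF in_dual \<beta>(1)]] g h by (simp add: \<Phi>)
  show "snd \<Phi> (left_differential G g h v) = \<xi> v + shift_form \<alpha> h v" if "v \<in> tangent_space A h"
    using dual_left[OF in_dual g h that] dual_left[OF \<beta>(1) g h that] \<beta>(2)
    by (simp add: \<Phi> form_add_def shift_form_def)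
qed

text \<open>The right-hand side contains neither \<open>g\<close> nor \<xi>: at every point over
  \<open>h\<close>, and for every left factor whose invariant form is \<alpha>, invariance is the
  same condition.\<close>

lemma translation_preserves_iff:
  assumes g: "g \<in> carrier G" and \<alpha>: "\<alpha> \<in> dual_lie_algebra G"
    and h: "h \<in> carrier G" and \<xi>: "\<xi> \<in> cotangent_space A h"
  shows "(\<forall>u\<in>tangent_space (cotangent_atlas A) (h, \<xi>). \<forall>v\<in>tangent_space (cotangent_atlas A) (h, \<xi>).
       canonical_symplectic_form A ((g, \<alpha> g) \<otimes>\<^bsub>cotangent_group G \<rho>\<^esub> (h, \<xi>))
         (left_differential (cotangent_group G \<rho>) (g, \<alpha> g) (h, \<xi>) u)
         (left_differential (cotangent_group G \<rho>) (g, \<alpha> g) (h, \<xi>) v)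
       = canonical_symplectic_form A (h, \<xi>) u v)
    \<longleftrightarrow> (\<forall>X\<in>lie_algebra G. \<forall>Y\<in>lie_algebra G.
      shift_form \<alpha> h (\<lambda>d. rep_connection G \<rho> X Y h d - rep_connection G \<rho> Y X h d)
      = shift_form \<alpha> h (lie_bracket A X Y h))" (is "?l \<longleftrightarrow> ?r")
proof -
  let ?\<Phi> = "\<lambda>b. (g, \<alpha> g) \<otimes>\<^bsub>cotangent_group G \<rho>\<^esub> b"
  obtain c where c: "c \<in> charts_at A h"
    "(\<forall>u\<in>tangent_space (cotangent_atlas A) (h, \<xi>). \<forall>v\<in>tangent_space (cotangent_atlas A) (h, \<xi>).
       canonical_symplectic_form A (?\<Phi> (h, \<xi>))
         (differential (cotangent_atlas A) (cotangent_atlas A) ?\<Phi> (h, \<xi>) u)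
         (differential (cotangent_atlas A) (cotangent_atlas A) ?\<Phi> (h, \<xi>) v)
       = canonical_symplectic_form A (h, \<xi>) u v)
     \<longleftrightarrow> (\<forall>x y. coord_form_deriv A c (shift_form \<alpha>) h x y = coord_form_deriv A c (shift_form \<alpha>) h y x)"
  proof (rule cotangent_lift_preserves_iff[where \<Phi> = ?\<Phi> and \<kappa> = "shift_form \<alpha>" and p = h,
        OF left_smooth[OF g] left_smooth[OF inv_closed[OF g]] _ _ _ _ _ \<xi>])
    show "inv g \<otimes> (g \<otimes> p) = p" "g \<otimes> (inv g \<otimes> p) = p" if "p \<in> points A" for p
      using that g by (simp_all flip: carrier_eq m_assoc)
    show "fst (?\<Phi> (p, \<zeta>)) = g \<otimes> p \<and> snd (?\<Phi> (p, \<zeta>)) \<in> cotangent_space A (g \<otimes> p) \<and>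
      (\<forall>v\<in>tangent_space A p. snd (?\<Phi> (p, \<zeta>)) (differential A A (\<lambda>h. g \<otimes> h) p v) = \<zeta> v + shift_form \<alpha> p v)"
      if "p \<in> points A" "\<zeta> \<in> cotangent_space A p" for p \<zeta>
    proof -
      have p: "p \<in> carrier G" using that by (simp add: carrier_eq)
      show ?thesis using cotangent_group_mult[OF g \<alpha> p that(2)] by (simp add: left_differential_def)
    qed
    show "shift_form \<alpha> p \<in> cotangent_space A p" if "p \<in> points A" for p
      using that shift_form_cotangent[OF \<alpha>] by (simp add: carrier_eq)
    show "coord_form A c (shift_form \<alpha>) differentiable (at (snd c p))" if "c \<in> charts_at A p" for p c
      by (rule shift_form_differentiable[OF \<alpha> that])
    show "h \<in> points A" using h by (simp add: carrier_eq)
  qed (rule that)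
  have eq: "left_differential (cotangent_group G \<rho>) (g, \<alpha> g) (h, \<xi>)
      = differential (cotangent_atlas A) (cotangent_atlas A) ?\<Phi> (h, \<xi>)"
    by (simp add: left_differential_def cotangent_group_def)
  show ?thesis unfolding eq c(2) by (rule shift_form_closed_iff[OF \<alpha> c(1)])
qed

section \<open>From pointwise conditions to the equivalence on the whole group\<close>

lemma covectors_separate:
  assumes g: "g \<in> carrier G" and u: "u \<in> tangent_space A g" and v: "v \<in> tangent_space A g"
    and eq: "\<And>\<xi>. \<xi> \<in> cotangent_space A g \<Longrightarrow> \<xi> u = \<xi> v"
  shows "u = v"
proof -
  have c: "chart_at A g \<in> charts_at A g" (is "?c \<in> _") by (rule chart_at_in) (use g in \<open>simp add: carrier_eq\<close>)
  show ?thesis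
  proof (rule tangent_eqI[OF u v c])
    show "u ?c = v ?c"
      using eq[OF coord_covector_in[OF c]] u v
      by (intro dual_separates[OF basis]) (simp add: coord_covector_def)
  qed
qed

lemma left_invariant_iff_torsion_free:
  "left_invariant_twoform (cotangent_group G \<rho>) (canonical_symplectic_form A)
     \<longleftrightarrow> torsion_free G (rep_connection G \<rho>)"
proof
  let ?T = "\<lambda>X Y g d. rep_connection G \<rho> X Y g d - rep_connection G \<rho> Y X g d"
  have car: "carrier (cotangent_group G \<rho>) = cotangent_bundle A"
    and atl: "atlas (cotangent_group G \<rho>) = cotangent_atlas A"
    by (simp_all add: cotangent_group_def)
  {
    assume inv: "left_invariant_twoform (cotangent_group G \<rho>) (canonical_symplectic_form A)"
    show "torsion_free G (rep_connection G \<rho>)"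
      unfolding torsion_free_def
    proof (intro ballI ext)
      fix X Y g c assume XY: "X \<in> lie_algebra G" "Y \<in> lie_algebra G"
      have T: "?T X Y \<in> lie_algebra G" by (intro lie_algebra_diff rep_connection(1) XY)
      show "?T X Y g c = lie_bracket A X Y g c"
      proof (cases "g \<in> carrier G")
        case True
        have "?T X Y g = lie_bracket A X Y g"
        proof (rule covectors_separate[OF True lie_tangent[OF T True]])
          show "lie_bracket A X Y g \<in> tangent_space A g"
            using XY True by (intro lie_bracket_tangent) (simp_all add: lie_algebra_def flip: carrier_eq)
          fix \<xi> assume "\<xi> \<in> cotangent_space A g"
          then obtain \<beta> where \<beta>: "\<beta> \<in> dual_lie_algebra G" "\<beta> g = \<xi>" using dual_through[OF True] by blast
          \<comment> \<open>The operator \<open>\<rho> (inv g)\<close> is onto, so \<alpha> can be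
            chosen to make the shift form at \<open>g\<close> equal to the prescribed
            covector.\<close>
          obtain \<alpha> where \<alpha>: "\<alpha> \<in> dual_lie_algebra G" "\<rho> (inv g) \<alpha> = \<beta>"
            using rep_bij[OF inv_closed[OF True]] \<beta>(1) by (metis bij_betw_iff_bijections)
          have "(\<one>, \<alpha> \<one>) \<in> cotangent_bundle A" "(g, \<lambda>v. 0) \<in> cotangent_bundle A"
            using dual_cotangent[OF \<alpha>(1) one_closed] zero_in_cotangent True
            by (simp_all add: cotangent_bundle_def flip: carrier_eq)
          then have "shift_form \<alpha> g (?T X Y g) = shift_form \<alpha> g (lie_bracket A X Y g)"
            using translation_preserves_iff[OF one_closed \<alpha>(1) True zero_in_cotangent] inv XY
            unfolding left_invariant_twoform_def car atl by blast
          then show "\<xi> (?T X Y g) = \<xi> (lie_bracket A X Y g)" by (simp add: shift_form_def \<alpha>(2) \<beta>(2))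
        qed
        then show ?thesis by (rule fun_cong)
      next
        case False
        \<comment> \<open>Outside the carrier the torsion expression vanishes as a member of the Lie
          algebra, and the bracket vanishes because no chart contains \<open>g\<close>.\<close>
        then have "c \<notin> charts_at A g" using carrierI by blast
        then show ?thesis using fun_cong[OF lie_outside[OF T False], of c] by (simp add: lie_bracket_def)
      qed
    qed
  }
  assume tf: "torsion_free G (rep_connection G \<rho>)"
  show "left_invariant_twoform (cotangent_group G \<rho>) (canonical_symplectic_form A)"
    unfolding left_invariant_twoform_def car atl
  proof (intro ballI)
    fix a b u v assume a: "a \<in> cotangent_bundle A" and b: "b \<in> cotangent_bundle A"
      and uv: "u \<in> tangent_space (cotangent_atlas A) b" "v \<in> tangent_space (cotangent_atlas A) b"
    obtain g \<eta> where g: "a = (g, \<eta>)" "g \<in> carrier G" "\<eta> \<in> cotangent_space A g"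
      using a by (auto simp: cotangent_bundle_def carrier_eq)
    obtain \<alpha> where \<alpha>: "\<alpha> \<in> dual_lie_algebra G" "\<alpha> g = \<eta>" using dual_through[OF g(2,3)] .
    obtain h \<xi> where h: "b = (h, \<xi>)" "h \<in> carrier G" "\<xi> \<in> cotangent_space A h"
      using b by (auto simp: cotangent_bundle_def carrier_eq)
    have "shift_form \<alpha> h (?T X Y h) = shift_form \<alpha> h (lie_bracket A X Y h)"
      if "X \<in> lie_algebra G" "Y \<in> lie_algebra G" for X Y
    proof -
      have "?T X Y = lie_bracket A X Y" using tf that by (simp add: torsion_free_def)
      from fun_cong[OF this, of h] show ?thesis by simp
    qed
    then show "canonical_symplectic_form A (a \<otimes>\<^bsub>cotangent_group G \<rho>\<^esub> b)
        (left_differential (cotangent_group G \<rho>) a b u) (left_differential (cotangent_group G \<rho>) a b v)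
      = canonical_symplectic_form A b u v"
      using translation_preserves_iff[OF g(2) \<alpha>(1) h(2,3)] uv unfolding g(1) h(1) \<alpha>(2) by blast
  qed
qed

end

theorem proposition4p4:
  fixes G :: "('a, 'e::real_normed_vector) smooth_monoid"
    and \<rho> :: "'a \<Rightarrow> ('a, 'e) oneform \<Rightarrow> ('a, 'e) oneform"
  assumes "lie_group G"
    and "dual_representation G \<rho>"
  shows "left_invariant_twoform (cotangent_group G \<rho>) (canonical_symplectic_form (atlas G))
     \<longleftrightarrow> torsion_free G (rep_connection G \<rho>)"
  by (rule dual_representation.left_invariant_iff_torsion_free[OF assms(2)])

end
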